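(* Let $\Bbbk$ be a field, let $S=\Bbbk[x_1,\dots,x_n]$, let $I\subseteq S$ be a monomial ideal, and let $\mathbb{F}_\bullet$ be its minimal free resolution over $S$. Then one can choose a basis of $\mathbb{F}_\bullet$ such that the maps in the $2$-linear strand of $\mathbb{F}_\bullet$ have only coefficients in $\{-1,0,1\}$.
   Context: Modules are considered with the fine $\mathbb{Z}^n$-grading on $S$, and a basis of $\mathbb{F}_\bullet$ means a choice of a homogeneous $S$-basis of each free module $\mathbb{F}_i$. The $2$-linear strand of the minimal free resolution $\mathbb{F}_\bullet$ of $I$ (indexed so that $\mathbb{F}_0\to I$ is the augmentation) is the strand containing the generators of $I$ of total degree $2$. Its module in homological degree $i$ is the free module on the basis elements of $\mathbb{F}_i$ of total degree $i+2$, and its maps are the components of the differential of $\mathbb{F}_\bullet$ from the basis elements of $\mathbb{F}_i$ of total degree $i+2$ to the basis elements of $\mathbb{F}_{i-1}$ of total degree $i+1$ (for $i\ge 1$). In a homogeneous basis each matrix entry of such a map is of the form $c\,x_u$ with $c\in\Bbbk$ and $u\in\{1,\dots,n\}$; the scalars $c$ are the coefficients. *)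

theory Defs
  imports Complex_Main "HOL-Library.Poly_Mapping"
begin

section \<open>The polynomial ring and its fine grading\<close>

text \<open>
  \<open>('n, 'k) mpoly\<close> is \<open>S = k[x_1, \<dots>, x_n]\<close>: a polynomial maps exponent vectors to coefficients,
  and the variables are indexed by the finite type \<open>'n\<close> (so \<open>n = CARD('n)\<close> is arbitrary, \<open>n \<ge> 1\<close>).
  Degrees in the fine grading are functions \<open>'n \<Rightarrow> int\<close>, i.e. elements of \<open>\<int>\<^sup>n\<close>.
\<close>

type_synonym ('n, 'k) mpoly = "('n \<Rightarrow>\<^sub>0 nat) \<Rightarrow>\<^sub>0 'k"

definition var :: "'n \<Rightarrow> ('n, 'k::comm_ring_1) mpoly" where
  "var u = Poly_Mapping.single (Poly_Mapping.single u 1) 1"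

definition const :: "'k \<Rightarrow> ('n, 'k::comm_ring_1) mpoly" where
  "const c = Poly_Mapping.single 0 c"

definition mdeg :: "('n \<Rightarrow>\<^sub>0 nat) \<Rightarrow> 'n \<Rightarrow> int" where
  "mdeg m = (\<lambda>u. int (Poly_Mapping.lookup m u))"

definition total_degree :: "('n::finite \<Rightarrow> int) \<Rightarrow> int" where
  "total_degree a = (\<Sum>u\<in>UNIV. a u)"

definition poly_grading :: "('n \<Rightarrow> int) \<Rightarrow> ('n, 'k::comm_ring_1) mpoly set" where
  "poly_grading a = {p. \<forall>m \<in> Poly_Mapping.keys p. mdeg m = a}"

definition monomial_ideal :: "('n, 'k::comm_ring_1) mpoly set \<Rightarrow> bool" where
  "monomial_ideal I \<longleftrightarrow> (\<exists>A. I = module.span (*) ((\<lambda>m. Poly_Mapping.single m 1) ` A))"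

definition irrelevant_ideal :: "('n, 'k::comm_ring_1) mpoly set" where
  "irrelevant_ideal = module.span (*) (var ` UNIV)"


section \<open>Finely graded modules\<close>

text \<open>
  Modules are submodules \<open>M\<close> of an ambient \<open>S\<close>-module \<open>'m\<close> with scalar multiplication \<open>s\<close>; the
  ambient module is arbitrary, so any sequence of modules can be realised inside one
  (e.g. inside their direct sum). \<open>G a\<close> is the homogeneous component of degree \<open>a\<close>.
\<close>

definition graded_module ::
  "(('n, 'k::field) mpoly \<Rightarrow> 'm::ab_group_add \<Rightarrow> 'm) \<Rightarrow> 'm set \<Rightarrow> (('n \<Rightarrow> int) \<Rightarrow> 'm set) \<Rightarrow> bool"
where
  "graded_module s M G \<longleftrightarrow>
     module.subspace s M \<and>
     (\<forall>a. G a \<subseteq> M \<and> 0 \<in> G a \<and> (\<forall>x\<in>G a. \<forall>y\<in>G a. x + y \<in> G a)) \<and>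
     (\<forall>a b. \<forall>p\<in>poly_grading a. \<forall>x\<in>G b. s p x \<in> G (\<lambda>u. a u + b u)) \<and>
     (\<forall>x\<in>M. \<exists>!f. (\<forall>a. f a \<in> G a) \<and> finite {a. f a \<noteq> 0} \<and> x = (\<Sum>a | f a \<noteq> 0. f a))"

definition graded_hom ::
  "(('n, 'k::field) mpoly \<Rightarrow> 'm::ab_group_add \<Rightarrow> 'm) \<Rightarrow> 'm set \<Rightarrow> (('n \<Rightarrow> int) \<Rightarrow> 'm set) \<Rightarrow>
   (('n, 'k) mpoly \<Rightarrow> 'l::ab_group_add \<Rightarrow> 'l) \<Rightarrow> 'l set \<Rightarrow> (('n \<Rightarrow> int) \<Rightarrow> 'l set) \<Rightarrow>
   ('m \<Rightarrow> 'l) \<Rightarrow> bool"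
where
  "graded_hom s M G t N H f \<longleftrightarrow>
     f ` M \<subseteq> N \<and>
     (\<forall>x\<in>M. \<forall>y\<in>M. f (x + y) = f x + f y) \<and>
     (\<forall>p. \<forall>x\<in>M. f (s p x) = t p (f x)) \<and>
     (\<forall>a. f ` G a \<subseteq> H a)"

definition homogeneous_basis ::
  "(('n, 'k::field) mpoly \<Rightarrow> 'm::ab_group_add \<Rightarrow> 'm) \<Rightarrow> 'm set \<Rightarrow> (('n \<Rightarrow> int) \<Rightarrow> 'm set) \<Rightarrow> 'm set \<Rightarrow> bool"
where
  "homogeneous_basis s M G B \<longleftrightarrow>
     B \<subseteq> (\<Union>a. G a) \<and> \<not> module.dependent s B \<and> module.span s B = M"


section \<open>Minimal free resolutions of ideals\<close>

text \<open>
  \<open>F i\<close> is the module in homological degree \<open>i\<close>, with homogeneous components \<open>G i a\<close>. The differential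
  is \<open>d i : F i \<rightarrow> F (i - 1)\<close> for \<open>i \<ge> 1\<close> (\<open>d 0\<close> is irrelevant), and \<open>\<epsilon> : F 0 \<rightarrow> I\<close> is the augmentation.
\<close>

locale minimal_free_resolution = module s
  for s :: "('n::finite, 'k::field) mpoly \<Rightarrow> 'm::ab_group_add \<Rightarrow> 'm" +
  fixes F :: "nat \<Rightarrow> 'm set"
    and G :: "nat \<Rightarrow> ('n \<Rightarrow> int) \<Rightarrow> 'm set"
    and d :: "nat \<Rightarrow> 'm \<Rightarrow> 'm"
    and \<epsilon> :: "'m \<Rightarrow> ('n, 'k) mpoly"
    and I :: "('n, 'k) mpoly set"
  assumes graded: "graded_module s (F i) (G i)"
    and free: "\<exists>B. finite B \<and> homogeneous_basis s (F i) (G i) B"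
    and differential: "graded_hom s (F (Suc i)) (G (Suc i)) s (F i) (G i) (d (Suc i))"
    and augmentation: "graded_hom s (F 0) (G 0) (*) I (\<lambda>a. I \<inter> poly_grading a) \<epsilon>"
    and exact: "d (Suc (Suc i)) ` F (Suc (Suc i)) = {x \<in> F (Suc i). d (Suc i) x = 0}"
    and exact_0: "d 1 ` F 1 = {x \<in> F 0. \<epsilon> x = 0}"
    and augmentation_onto: "\<epsilon> ` F 0 = I"
    and minimal: "d (Suc i) ` F (Suc i) \<subseteq> span {s p y | p y. p \<in> irrelevant_ideal \<and> y \<in> F i}"


section \<open>The 2-linear strand\<close>

text \<open>
  With respect to homogeneous bases \<open>B i\<close> of the \<open>F i\<close>, the 2-linear strand is given by the basis
  elements of \<open>F i\<close> of total degree \<open>i + 2\<close> and the submatrices of the differential they index.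
\<close>

definition linear_strand_basis ::
  "(nat \<Rightarrow> ('n::finite \<Rightarrow> int) \<Rightarrow> 'm set) \<Rightarrow> (nat \<Rightarrow> 'm set) \<Rightarrow> nat \<Rightarrow> 'm set"
where
  "linear_strand_basis G B i = {b \<in> B i. \<exists>a. b \<in> G i a \<and> total_degree a = int i + 2}"

definition differential_entry ::
  "(('n, 'k::field) mpoly \<Rightarrow> 'm::ab_group_add \<Rightarrow> 'm) \<Rightarrow> (nat \<Rightarrow> 'm \<Rightarrow> 'm) \<Rightarrow> (nat \<Rightarrow> 'm set) \<Rightarrow>
   nat \<Rightarrow> 'm \<Rightarrow> 'm \<Rightarrow> ('n, 'k) mpoly"
where
  "differential_entry s d B i b' b = module.representation s (B (i - 1)) (d i b) b'"

end

theory Submission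
  imports Defs "HOL-Library.Multiset"
begin

text \<open>
  Iterating the linear part of the differential assigns to a basis element of degree \<open>a\<close> in the linear
  strand, in homological degree \<open>n\<close>, a scalar for every list of \<open>n\<close> variables. These coordinates are
  alternating since \<open>d \<circ> d = 0\<close>, and the coordinates of the linear part of the differential of an element
  are coordinates of the element itself. It therefore suffices to find, in each degree separately, a
  basis dual to some of the coordinates all of whose coordinates lie in \<open>{-1, 0, 1}\<close>. A minimal jointly
  injective set of coordinates provides one as soon as every coordinate vector \<open>z\<close> and every \<open>t\<close> with
  \<open>z t \<noteq> 0\<close> admit a coordinate vector with entries in \<open>{-1, 0, 1}\<close>, nonzero at \<open>t\<close> and supported in the
  support of \<open>z\<close>.

  If no variable of the ideal divides \<open>x^a\<close>, exactness identifies the coordinate vectors with the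
  alternating cycles supported on generators of degree 2. In squarefree degree such a cycle is, up to
  signs, \<open>f p - f q\<close>, where \<open>p\<close> and \<open>q\<close> are the variables missing from the list, and \<open>f\<close> may be replaced
  by the indicator function of one of its values; in the other degrees all its nonzero entries agree up to sign.
  A variable of the ideal dividing \<open>x^a\<close> is removed by a null-homotopy of the multiplication by it.
\<close>

section \<open>Alternating functions on lists\<close>

text \<open>Neighbouring free modules share the matrices of the strand, so improving the basis of
  one of them could spoil the next map. This does not happen because the inverse of a dual basis
  consists of coordinates: an entry with respect to two new bases is a single coordinate of one new
  basis vector of the source, whatever was chosen in the target.

  The number 2 enters through a count. In total degree \<open>n + 2\<close> a list of length
  \<open>n\<close> leaves out at most two of the variables dividing \<open>x^a\<close>, so a
  coordinate vector lives on the edges of a graph. Differences of a function along edges form a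
  space whose vectors of minimal support have, up to scaling, entries in {-1, 0, 1}, over every
  field.

  Variables in the ideal are the obstacle: the 2-linear strand is then no longer the lowest one, so
  the differential of its elements can have components outside it, and vanishing of the linear
  components no longer makes a vector a cycle. The null-homotopy is a way around the missing cycle
  condition.\<close>

definition alternating :: "nat \<Rightarrow> ('a list \<Rightarrow> 'k::field) \<Rightarrow> bool" where
  "alternating n z \<longleftrightarrow>
     (\<forall>xs u v ys. length xs + length ys + 2 = n \<longrightarrow>
        z (xs @ u # v # ys) = - z (xs @ v # u # ys) \<and> z (xs @ u # u # ys) = 0)"

text \<open>In characteristic 2 antisymmetry does not force vanishing on repeated entries, so both
  conditions have to be checked; the second then settles the swap of two equal entries.\<close>

lemma alternatingI:
  assumes "\<And>xs u v ys. length xs + length ys + 2 = n \<Longrightarrow> u \<noteq> v \<Longrightarrow>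
             z (xs @ u # v # ys) = - z (xs @ v # u # ys)"
    and "\<And>xs u ys. length xs + length ys + 2 = n \<Longrightarrow> z (xs @ u # u # ys) = 0"
  shows "alternating n z"
  unfolding alternating_def
proof (intro allI impI conjI)
  fix xs ys :: "'a list" and u v assume "length xs + length ys + 2 = n"
  then show "z (xs @ u # v # ys) = - z (xs @ v # u # ys)"
    using assms(1)[of xs ys u v] assms(2)[of xs ys u] by (cases "u = v") (simp, blast)
next
  fix xs ys :: "'a list" and u assume "length xs + length ys + 2 = n"
  then show "z (xs @ u # u # ys) = 0" by (rule assms(2))
qed

lemma alternatingD:
  assumes "alternating n z" "length xs + length ys + 2 = n"
  shows "z (xs @ u # v # ys) = - z (xs @ v # u # ys)" "z (xs @ u # u # ys) = 0"
  using assms unfolding alternating_def by blast+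

lemma alternating_Cons: "alternating (Suc n) z \<Longrightarrow> alternating n (\<lambda>t. z (u # t))"
proof (rule alternatingI)
  fix xs ys :: "'a list" and v w assume a: "alternating (Suc n) z" and l: "length xs + length ys + 2 = n"
  then have "length (u # xs) + length ys + 2 = Suc n" by simp
  from alternatingD(1)[OF a this, of v w] alternatingD(2)[OF a this, of v] show "z (u # xs @ v # w # ys) = - z (u # xs @ w # v # ys)"
    "z (u # xs @ v # v # ys) = 0"
    by (simp_all only: append_Cons)
qed

lemma alternating_diff:
  "alternating n z \<Longrightarrow> alternating n w \<Longrightarrow> alternating n (\<lambda>t. z t - w t)"
proof (rule alternatingI)
  fix xs ys :: "'a list" and u v assume a: "alternating n z" "alternating n w" and l: "length xs + length ys + 2 = n"
  show "z (xs @ u # v # ys) - w (xs @ u # v # ys) = - (z (xs @ v # u # ys) - w (xs @ v # u # ys))"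
    unfolding alternatingD(1)[OF a(1) l, of u v] alternatingD(1)[OF a(2) l, of u v] by simp
  show "z (xs @ u # u # ys) - w (xs @ u # u # ys) = 0"
    unfolding alternatingD(2)[OF a(1) l] alternatingD(2)[OF a(2) l] by simp
qed

lemma alternating_mult: "alternating n z \<Longrightarrow> alternating n (\<lambda>t. c * z t)"
proof (rule alternatingI)
  fix xs ys :: "'a list" and u v assume a: "alternating n z" and l: "length xs + length ys + 2 = n"
  show "c * z (xs @ u # v # ys) = - (c * z (xs @ v # u # ys))"
    unfolding alternatingD(1)[OF a l, of u v] by simp
  show "c * z (xs @ u # u # ys) = 0"
    unfolding alternatingD(2)[OF a l] by simp
qed

lemma alternating_sum:
  fixes z :: "'a \<Rightarrow> 'b list \<Rightarrow> 'k::field"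
  assumes "\<And>i. i \<in> A \<Longrightarrow> alternating n (z i)"
  shows "alternating n (\<lambda>t. \<Sum>i\<in>A. z i t)"
proof (rule alternatingI)
  fix xs ys :: "'b list" and u v assume l: "length xs + length ys + 2 = n"
  have "(\<Sum>i\<in>A. z i (xs @ u # v # ys)) = (\<Sum>i\<in>A. - z i (xs @ v # u # ys))"
    using alternatingD(1)[OF assms l, of _ u v] by (intro sum.cong) auto
  then show "(\<Sum>i\<in>A. z i (xs @ u # v # ys)) = - (\<Sum>i\<in>A. z i (xs @ v # u # ys))"
    by (simp add: sum_negf)
next
  fix xs ys :: "'b list" and u assume l: "length xs + length ys + 2 = n"
  show "(\<Sum>i\<in>A. z i (xs @ u # u # ys)) = 0"
    using alternatingD(2)[OF assms l] by (intro sum.neutral) auto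
qed

text \<open>The sign is left open here and in the next comparisons: the target set {-1, 0, 1} is
  closed under negation, so the signs of permutations need not be tracked.\<close>

lemma alternating_move_to_front:
  assumes "alternating (Suc (length xs + length ys)) z"
  shows "z (xs @ u # ys) = z (u # xs @ ys) \<or> z (xs @ u # ys) = - z (u # xs @ ys)"
  using assms
proof (induction xs arbitrary: ys rule: rev_induct)
  case (snoc x xs)
  have "z (xs @ x # u # ys) = - z (xs @ u # x # ys)"
    using snoc.prems by (rule alternatingD(1)) simp
  moreover have "z (xs @ u # x # ys) = z (u # xs @ x # ys) \<or> z (xs @ u # x # ys) = - z (u # xs @ x # ys)"
    using snoc.IH[of "x # ys"] snoc.prems by simp
  ultimately show ?case by auto
qed simp

lemma alternating_mset_eq:
  assumes "alternating (length xs) z" "mset xs = mset ys"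
  shows "z ys = z xs \<or> z ys = - z xs"
  using assms
proof (induction xs arbitrary: ys z)
  case (Cons x xs)
  then obtain as bs where ys: "ys = as @ x # bs"
    by (metis list.set_intros(1) set_mset_mset split_list)
  have eq: "mset xs = mset (as @ bs)" using Cons.prems ys by simp
  then have l: "length xs = length as + length bs"
    by (metis length_append mset_eq_length)
  have "z (x # as @ bs) = z (x # xs) \<or> z (x # as @ bs) = - z (x # xs)"
    using Cons.IH[of "\<lambda>t. z (x # t)", OF _ eq] alternating_Cons[of "length xs" z x] Cons.prems(1)
    by simp
  moreover have "z ys = z (x # as @ bs) \<or> z ys = - z (x # as @ bs)"
    unfolding ys using Cons.prems l by (intro alternating_move_to_front) auto
  ultimately show ?case by auto
qed simp

text \<open>Rearranging brings two equal entries next to each other at the front, at the cost of a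
  sign only.\<close>

lemma alternating_not_distinct:
  assumes "alternating (length t) z" "\<not> distinct t"
  shows "z t = 0"
proof -
  obtain xs ys zs y where t: "t = xs @ [y] @ ys @ [y] @ zs"
    using assms(2) not_distinct_decomp by blast
  have "mset t = mset (y # y # xs @ ys @ zs)" using t by simp
  then have "z (y # y # xs @ ys @ zs) = z t \<or> z (y # y # xs @ ys @ zs) = - z t"
    using alternating_mset_eq assms(1) by blast
  moreover have "z ([] @ y # y # (xs @ ys @ zs)) = 0"
    using assms(1) by (intro alternatingD(2)[of "length t"]) (auto simp: t)
  ultimately show ?thesis by auto
qed

lemma alternating_set_eq:
  assumes "alternating (length xs) z" "set xs = set ys" "length xs = length ys" "distinct xs"
  shows "z ys = z xs \<or> z ys = - z xs"
proof -
  have "distinct ys"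
    using assms by (metis card_distinct distinct_card)
  then have "mset xs = mset ys"
    using assms by (metis set_eq_iff_mset_eq_distinct)
  then show ?thesis using alternating_mset_eq assms(1) by blast
qed

text \<open>Showing that the sum equals its own negative would not suffice in characteristic 2. An
  enumeration of the index type instead splits \<open>f\<close> as \<open>?g u v - ?g v u\<close>,
  and the two halves have equal sums.\<close>

lemma sum_antisym_eq_0:
  fixes f :: "'a::finite \<Rightarrow> 'a \<Rightarrow> 'k::comm_ring_1"
  assumes anti: "\<And>u v. f u v = - f v u" and diag: "\<And>u. f u u = 0"
  shows "(\<Sum>u\<in>UNIV. \<Sum>v\<in>UNIV. f u v) = 0"
proof -
  obtain h :: "'a \<Rightarrow> nat" where h: "inj h"
    using finite_imp_inj_to_nat_seg[OF finite_UNIV] by blast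
  let ?g = "\<lambda>u v. if h u < h v then f u v else 0"
  have "f u v = ?g u v - ?g v u" for u v
  proof (cases "h u" "h v" rule: linorder_cases)
    case equal
    then show ?thesis using diag h by (auto dest: injD)
  next
    case greater
    then show ?thesis using anti[of u v] by (simp only: if_False if_True diff_0 less_not_sym)
  qed simp
  then have "(\<Sum>u\<in>UNIV. \<Sum>v\<in>UNIV. f u v) = (\<Sum>u\<in>UNIV. \<Sum>v\<in>UNIV. ?g u v - ?g v u)"
    by (intro sum.cong refl)
  also have "\<dots> = (\<Sum>u\<in>UNIV. \<Sum>v\<in>UNIV. ?g u v) - (\<Sum>u\<in>UNIV. \<Sum>v\<in>UNIV. ?g v u)"
    by (simp only: sum_subtractf)
  also have "(\<Sum>u\<in>UNIV. \<Sum>v\<in>UNIV. ?g v u) = (\<Sum>u\<in>UNIV. \<Sum>v\<in>UNIV. ?g u v)"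
    by (rule sum.swap)
  finally show ?thesis by simp
qed

section \<open>Signs of lists by counting inversions, orientations, coboundaries\<close>

fun list_sign :: "('a \<Rightarrow> nat) \<Rightarrow> 'a list \<Rightarrow> 'k::field" where
  "list_sign h [] = 1"
| "list_sign h (x # xs) = (-1) ^ length (filter (\<lambda>y. h y < h x) xs) * list_sign h xs"

lemma list_sign_cases: "list_sign h xs = (1::'k::field) \<or> list_sign h xs = (-1::'k)"
proof (induction xs)
  case (Cons x xs)
  then show ?case
    by (cases "even (length (filter (\<lambda>y. h y < h x) xs))") auto
qed simp

lemma list_sign_swap:
  assumes "h u \<noteq> h v"
  shows "list_sign h (xs @ u # v # ys) = - (list_sign h (xs @ v # u # ys) :: 'k::field)"
proof (induction xs)
  case Nil
  show ?case using assms by auto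
qed auto

definition orientation :: "('a \<Rightarrow> nat) \<Rightarrow> 'a set \<Rightarrow> 'a list \<Rightarrow> 'k::field" where
  "orientation h W t = (if distinct t \<and> set t = W then list_sign h t else 0)"

lemma alternating_orientation:
  assumes "inj h"
  shows "alternating n (orientation h W :: 'a list \<Rightarrow> 'k::field)"
proof (rule alternatingI)
  fix xs ys and u v :: 'a assume "u \<noteq> v"
  then have "h u \<noteq> h v" using assms by (auto dest: injD)
  then have s: "list_sign h (xs @ u # v # ys) = - (list_sign h (xs @ v # u # ys) :: 'k)"
    by (rule list_sign_swap)
  have "distinct (xs @ u # v # ys) = distinct (xs @ v # u # ys)"
    "set (xs @ u # v # ys) = set (xs @ v # u # ys)" by auto
  then show "orientation h W (xs @ u # v # ys) = - (orientation h W (xs @ v # u # ys) :: 'k)"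
    unfolding orientation_def s by (simp only: minus_zero if_distrib[of uminus])
qed (auto simp: orientation_def)

text \<open>Up to sign this is the simplicial coboundary of the function \<open>f\<close> on the
  vertices \<open>W\<close>, transported from edges to complementary lists by the orientation: if
  \<open>t\<close> leaves out exactly \<open>p\<close> and \<open>q\<close>, only the orders
  \<open>p, q\<close> and \<open>q, p\<close> contribute, with opposite signs.\<close>

definition coboundary :: "('a::finite \<Rightarrow> nat) \<Rightarrow> 'a set \<Rightarrow> ('a \<Rightarrow> 'k::field) \<Rightarrow> 'a list \<Rightarrow> 'k" where
  "coboundary h W f t = (\<Sum>p\<in>UNIV. \<Sum>q\<in>UNIV. f p * orientation h W (t @ [p, q]))"

lemma alternating_coboundary:
  fixes f :: "'a::finite \<Rightarrow> 'k::field"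
  assumes "inj h"
  shows "alternating n (coboundary h W f)"
proof -
  have a: "alternating (n + 2) (orientation h W :: 'a list \<Rightarrow> 'k)"
    by (rule alternating_orientation[OF assms])
  have "alternating n (\<lambda>t. orientation h W (t @ [p, q]) :: 'k)" for p q
    unfolding alternating_def
  proof (intro allI impI conjI)
    fix xs ys :: "'a list" and u v assume "length xs + length ys + 2 = n"
    then have l: "length xs + length (ys @ [p, q]) + 2 = n + 2" by simp
    show "orientation h W ((xs @ u # v # ys) @ [p, q]) = (- orientation h W ((xs @ v # u # ys) @ [p, q]) :: 'k)"
      "orientation h W ((xs @ u # u # ys) @ [p, q]) = (0 :: 'k)"
      using alternatingD(1)[OF a l, of u v] alternatingD(2)[OF a l, of u] by simp_all
  qed
  then show ?thesis
    unfolding coboundary_def by (intro alternating_sum alternating_mult)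
qed

text \<open>For fixed \<open>p\<close> the summand is antisymmetric in the new letter
  \<open>u\<close> and the letter \<open>q\<close>, because exchanging them takes three adjacent
  swaps.\<close>

lemma coboundary_cycle:
  fixes f :: "'a::finite \<Rightarrow> 'k::field"
  assumes "inj h"
  shows "(\<Sum>u\<in>UNIV. coboundary h W f (t @ [u])) = 0"
proof -
  have *: "(\<Sum>u\<in>UNIV. \<Sum>q\<in>UNIV. (orientation h W (t @ [u, p, q]) :: 'k)) = 0" for p
  proof (rule sum_antisym_eq_0)
    fix u v
    have a: "alternating (length t + 3) (orientation h W :: 'a list \<Rightarrow> 'k)"
      by (rule alternating_orientation[OF assms])
    have "orientation h W (t @ [u, p, v]) = (- orientation h W (t @ [p, u, v]) :: 'k)"
      using alternatingD(1)[OF a, of t "[v]" u p] by simp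
    also have "\<dots> = orientation h W ((t @ [p]) @ v # u # [])"
      using alternatingD(1)[OF a, of "t @ [p]" "[]" u v] by simp
    also have "\<dots> = - orientation h W (t @ [v, p, u])"
      using alternatingD(1)[OF a, of t "[u]" p v] by simp
    finally show "orientation h W (t @ [u, p, v]) = (- orientation h W (t @ [v, p, u]) :: 'k)" .
  qed (simp add: orientation_def)
  have "(\<Sum>u\<in>UNIV. coboundary h W f (t @ [u])) =
      (\<Sum>u\<in>UNIV. \<Sum>p\<in>UNIV. \<Sum>q\<in>UNIV. f p * orientation h W (t @ [u, p, q]))"
    by (simp add: coboundary_def)
  also have "\<dots> = (\<Sum>p\<in>UNIV. \<Sum>u\<in>UNIV. \<Sum>q\<in>UNIV. f p * orientation h W (t @ [u, p, q]))"
    by (rule sum.swap)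
  also have "\<dots> = (\<Sum>p\<in>UNIV. f p * (\<Sum>u\<in>UNIV. \<Sum>q\<in>UNIV. orientation h W (t @ [u, p, q])))"
    by (simp add: sum_distrib_left)
  finally show ?thesis using * by simp
qed

lemma coboundary_eq:
  fixes f :: "'a::finite \<Rightarrow> 'k::field"
  assumes "inj h" "distinct (t @ [p, q])" "set (t @ [p, q]) = W"
  shows "coboundary h W f t = list_sign h (t @ [p, q]) * (f p - f q)"
proof -
  let ?o = "\<lambda>p' q'. orientation h W (t @ [p', q']) :: 'k"
  have z: "?o p' q' = 0" if "(p', q') \<notin> {(p, q), (q, p)}" for p' q'
    using that assms unfolding orientation_def by auto
  have "coboundary h W f t = (\<Sum>x\<in>UNIV. f (fst x) * ?o (fst x) (snd x))"
    unfolding coboundary_def by (simp add: sum.cartesian_product case_prod_unfold)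
  also have "\<dots> = (\<Sum>x\<in>{(p, q), (q, p)}. f (fst x) * ?o (fst x) (snd x))"
  proof (rule sum.mono_neutral_right)
    show "\<forall>x\<in>UNIV - {(p, q), (q, p)}. f (fst x) * ?o (fst x) (snd x) = 0"
    proof
      fix x assume "x \<in> UNIV - {(p, q), (q, p)}"
      then have "(fst x, snd x) \<notin> {(p, q), (q, p)}" by simp
      from z[OF this] show "f (fst x) * ?o (fst x) (snd x) = 0" by simp
    qed
  qed auto
  also have "\<dots> = f p * ?o p q + f q * ?o q p" using assms by auto
  also have "?o q p = - ?o p q"
    by (rule alternatingD(1)[OF alternating_orientation[OF assms(1), of "length t + 2" W], of t "[]", simplified])
  also have "?o p q = list_sign h (t @ [p, q])" using assms by (simp add: orientation_def)
  finally show ?thesis by (simp add: algebra_simps)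
qed

lemma coboundary_eq_0:
  "\<not> (distinct t \<and> set t \<subseteq> W) \<Longrightarrow> coboundary h W f t = 0"
  unfolding coboundary_def orientation_def by (rule sum.neutral ballI)+ auto


section \<open>Alternating cycles supported on few variables\<close>

lemma finite_distinct_list_length:
  "finite A \<Longrightarrow> \<exists>xs. set xs = A \<and> distinct xs \<and> length xs = card A"
  using finite_distinct_list distinct_card by metis

text \<open>Two different supports of size \<open>n\<close> inside a set of size
  \<open>n + 1\<close> share \<open>n - 1\<close> elements. In the cycle relation of a list
  \<open>s\<close> of the shared elements only two terms survive, one for each support, so their
  values agree up to sign.\<close>

lemma alternating_cycle_eq_up_to_sign:
  fixes z :: "'n::finite list \<Rightarrow> 'k::field"
  assumes alt: "alternating n z"
    and supp: "\<And>t. length t = n \<Longrightarrow> z t \<noteq> 0 \<Longrightarrow> set t \<subseteq> W"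
    and cycle: "\<And>t. length t + 1 = n \<Longrightarrow> (\<Sum>u\<in>UNIV. z (t @ [u])) = 0"
    and W: "card W \<le> n + 1"
    and t: "length t = n" "z t \<noteq> 0" and t': "length t' = n" "z t' \<noteq> 0"
  shows "z t' = z t \<or> z t' = - z t"
proof (cases "set t = set t'")
  case True
  have "distinct t" using alternating_not_distinct alt t by blast
  then show ?thesis using alternating_set_eq[of t z t'] True alt t t' by auto
next
  case False
  have d: "distinct t" "distinct t'"
    using alternating_not_distinct[of t z] alternating_not_distinct[of t' z] alt t t' by auto
  then have c: "card (set t) = n" "card (set t') = n" using t t' by (simp_all add: distinct_card)
  have "\<not> set t' \<subseteq> set t"
    using False c by (metis List.finite_set card_subset_eq)
  then obtain p where p: "p \<in> set t'" "p \<notin> set t" by blast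
  have sub: "set t \<subseteq> W" "set t' \<subseteq> W" using supp t t' by auto
  have Weq: "W = insert p (set t)"
    using sub p c W by (intro card_seteq[symmetric]) auto
  have "\<not> set t \<subseteq> set t'"
    using False c by (metis List.finite_set card_subset_eq)
  then obtain w where w: "w \<in> set t" "w \<notin> set t'" by blast
  obtain s where s: "set s = set t - {w}" "distinct s" "length s = card (set t - {w})"
    using finite_distinct_list_length[of "set t - {w}"] by auto
  have ls: "length s + 1 = n"
    using s c w by (metis List.finite_set card_Suc_Diff1 Suc_eq_plus1)
  have pw: "p \<noteq> w" using p w by auto
  have zero: "z (s @ [u]) = 0" if "u \<notin> {p, w}" for u
  proof (cases "u \<in> set s")
    case True
    then show ?thesis using alt ls by (intro alternating_not_distinct) auto
  next
    case False
    then have "u \<notin> W" using that s Weq by auto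
    then show ?thesis using supp[of "s @ [u]"] ls by auto
  qed
  have "0 = (\<Sum>u\<in>{p, w}. z (s @ [u]))"
    unfolding cycle[OF ls, symmetric] using zero by (intro sum.mono_neutral_right) auto
  then have eq: "z (s @ [p]) = - z (s @ [w])"
    using pw by (simp add: eq_neg_iff_add_eq_0)
  have 1: "z t = z (s @ [w]) \<or> z t = - z (s @ [w])"
    using alt ls s w t by (intro alternating_set_eq) auto
  have "set t' \<subseteq> insert p (set t - {w})" using sub w Weq by auto
  then have "set t' = insert p (set t - {w})"
    using c p s ls by (intro card_seteq) simp_all
  then have 2: "z t' = z (s @ [p]) \<or> z t' = - z (s @ [p])"
    using alt ls s p t' by (intro alternating_set_eq) auto
  show ?thesis using 1 2 eq by auto
qed

text \<open>For \<open>card W = n + 2\<close> an alternating cycle is the same as a function on \<open>W\<close> up to constants: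
  \<open>z t\<close> is, up to sign, the difference of the values at the two elements of \<open>W\<close> missing from \<open>t\<close>.\<close>

lemma alternating_cycle_is_coboundary:
  fixes z :: "'n::finite list \<Rightarrow> 'k::field"
  assumes alt: "alternating n z"
    and supp: "\<And>t. length t = n \<Longrightarrow> z t \<noteq> 0 \<Longrightarrow> set t \<subseteq> W"
    and cycle: "\<And>t. length t + 1 = n \<Longrightarrow> (\<Sum>u\<in>UNIV. z (t @ [u])) = 0"
    and W: "card W = n + 2" and h: "inj h"
  obtains f where "\<And>t. length t = n \<Longrightarrow> z t = coboundary h W f t"
proof -
  obtain q0 where q0: "q0 \<in> W" using W by fastforce
  define l where "l p = (SOME t. set t = W - {p, q0} \<and> distinct t)" for p
  have l: "set (l p) = W - {p, q0} \<and> distinct (l p)" for p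
    unfolding l_def by (rule someI_ex) (simp add: finite_distinct_list)
  \<comment> \<open>The formula for the coboundary on \<open>l p\<close> is solved for
    \<open>f p\<close>, after normalising the free additive constant by \<open>f q0 = 0\<close>; the
    sign is its own inverse.\<close>
  define f where "f p = (if p = q0 then 0 else list_sign h (l p @ [p, q0]) * z (l p))" for p
  define y where "y t = z t - coboundary h W f t" for t
  have alty: "alternating n y"
    unfolding y_def by (intro alternating_diff alt alternating_coboundary h)
  have cycy: "(\<Sum>u\<in>UNIV. y (t @ [u])) = 0" if "length t + 1 = n" for t
    unfolding y_def using cycle[OF that] coboundary_cycle[OF h] by (simp add: sum_subtractf)
  have suppy: "y t = 0" if "length t = n" "\<not> (distinct t \<and> set t \<subseteq> W)" for t
    using that coboundary_eq_0[of t W h f] supp[of t] alternating_not_distinct[of t z] alt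
    by (auto simp: y_def)
  have card_l: "length (l p) = n" if "p \<in> W" "p \<noteq> q0" for p
    using l[of p] that q0 W by (metis add_diff_cancel_right' card_2_iff card_Diff_subset distinct_card finite insert_subset empty_subsetI)
  have yl: "y (l p) = 0" if "p \<in> W" "p \<noteq> q0" for p
  proof -
    have "coboundary h W f (l p) = list_sign h (l p @ [p, q0]) * (f p - f q0)"
      using l[of p] that q0 by (intro coboundary_eq h) auto
    also have "\<dots> = (list_sign h (l p @ [p, q0]) * list_sign h (l p @ [p, q0])) * z (l p)"
      using that by (simp add: f_def)
    also have "list_sign h (l p @ [p, q0]) * list_sign h (l p @ [p, q0]) = (1::'k)"
      using list_sign_cases[of h "l p @ [p, q0]", where 'k = 'k] by auto
    finally show ?thesis by (simp add: y_def)
  qed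
  \<comment> \<open>A list in \<open>W\<close> that avoids \<open>q0\<close> misses exactly one
    further element \<open>p\<close>, so it is a rearrangement of \<open>l p\<close>.\<close>
  have y0: "y t = 0" if t: "length t = n" "q0 \<notin> set t" for t
  proof (cases "distinct t \<and> set t \<subseteq> W")
    case True
    then have "card (W - {q0} - set t) = 1"
      using t q0 W by (subst card_Diff_subset) (auto simp: distinct_card)
    then obtain p where p: "W - {q0} - set t = {p}" by (meson card_1_singletonE)
    have pW: "p \<in> W" "p \<noteq> q0" using p by auto
    have "set (l p) = set t" using l[of p] p True t by auto
    then have "y t = y (l p) \<or> y t = - y (l p)"
      using alty l[of p] t card_l[OF pW] by (intro alternating_set_eq) simp_all
    then show ?thesis using yl[OF pW] by simp
  qed (use suppy t in auto)
  have "y t = 0" if t: "length t = n" for t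
  proof (cases "distinct t \<and> set t \<subseteq> W \<and> q0 \<in> set t")
    case True
    obtain s where s: "set s = set t - {q0}" "distinct s" "length s = card (set t - {q0})"
      using finite_distinct_list_length[of "set t - {q0}"] by auto
    have ls: "length s + 1 = n"
      using s True t by (metis List.finite_set card_Suc_Diff1 Suc_eq_plus1 distinct_card)
    \<comment> \<open>Every extension of \<open>s\<close> other than the one by \<open>q0\<close>
      avoids \<open>q0\<close>, so the cycle relation of \<open>s\<close> reduces to its term at
      \<open>q0\<close>.\<close>
    have "y (s @ [u]) = 0" if "u \<noteq> q0" for u
      using that s ls by (intro y0) auto
    then have "(\<Sum>u\<in>UNIV. y (s @ [u])) = (\<Sum>u\<in>{q0}. y (s @ [u]))"
      by (intro sum.mono_neutral_right) auto
    then have "y (s @ [q0]) = 0" using cycy[OF ls] by simp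
    moreover have "y t = y (s @ [q0]) \<or> y t = - y (s @ [q0])"
      using alty s ls True t by (intro alternating_set_eq) auto
    ultimately show ?thesis by auto
  qed (use suppy y0 t in blast)
  then show ?thesis using that[of f] by (simp add: y_def)
qed

lemma exists_signed_cycle:
  fixes z :: "'n::finite list \<Rightarrow> 'k::field"
  assumes alt: "alternating n z"
    and supp: "\<And>t. length t = n \<Longrightarrow> z t \<noteq> 0 \<Longrightarrow> set t \<subseteq> W"
    and cycle: "\<And>t. length t + 1 = n \<Longrightarrow> (\<Sum>u\<in>UNIV. z (t @ [u])) = 0"
    and W: "card W \<le> n + 2"
    and t0: "length t0 = n" "z t0 \<noteq> 0"
  obtains z' :: "'n list \<Rightarrow> 'k" where "alternating n z'" "z' t0 \<noteq> 0"
    "\<And>t. length t + 1 = n \<Longrightarrow> (\<Sum>u\<in>UNIV. z' (t @ [u])) = 0"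
    "\<And>t. length t = n \<Longrightarrow> z' t \<in> {-1, 0, 1}"
    "\<And>t. length t = n \<Longrightarrow> z t = 0 \<Longrightarrow> z' t = 0"
proof (cases "card W = n + 2")
  case False
  \<comment> \<open>All nonzero values agree with \<open>z t0\<close> up to sign, so one rescaling
    makes all of them signed units without changing the support.\<close>
  let ?z = "\<lambda>t. inverse (z t0) * z t"
  have "z t = 0 \<or> z t = z t0 \<or> z t = - z t0" if "length t = n" for t
    using alternating_cycle_eq_up_to_sign[OF alt supp cycle _ t0 that] W False by auto
  then have "?z t \<in> {-1, 0, 1}" if "length t = n" for t
    using that t0 by fastforce
  moreover have "(\<Sum>u\<in>UNIV. ?z (t @ [u])) = 0" if "length t + 1 = n" for t
    using cycle[OF that] by (simp flip: sum_distrib_left)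
  ultimately show ?thesis
    using that[of ?z] t0 alternating_mult[OF alt] by auto
next
  case True
  obtain h :: "'n \<Rightarrow> nat" where h: "inj h"
    using finite_imp_inj_to_nat_seg[OF finite_UNIV] by blast
  obtain f where f: "\<And>t. length t = n \<Longrightarrow> z t = coboundary h W f t"
    using alternating_cycle_is_coboundary[OF alt supp cycle True h] by blast
  have compl: "\<exists>p q. distinct (t @ [p, q]) \<and> set (t @ [p, q]) = W"
    if "length t = n" "distinct t" "set t \<subseteq> W" for t
  proof -
    have "card (W - set t) = 2"
      using that True by (subst card_Diff_subset) (auto simp: distinct_card)
    then obtain p q where "W - set t = {p, q}" "p \<noteq> q" by (auto simp: card_2_iff)
    then show ?thesis using that by (intro exI[of _ p] exI[of _ q]) auto
  qed
  have "distinct t0" "set t0 \<subseteq> W" using coboundary_eq_0[of t0] f t0 by metis+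
  then obtain p0 q0 where t0W: "distinct (t0 @ [p0, q0])" "set (t0 @ [p0, q0]) = W"
    using compl t0 by blast
  \<comment> \<open>Equal values of \<open>f\<close> give equal values of \<open>g\<close>, so zeros
    of \<open>z\<close> remain zeros; \<open>p0\<close> and \<open>q0\<close> have different values
    under \<open>f\<close>, so the value at \<open>t0\<close> survives.\<close>
  define g where "g p = (if f p = f p0 then 1 else 0 :: 'k)" for p
  let ?z = "coboundary h W g"
  have val: "?z t \<in> {-1, 0, 1} \<and> (z t = 0 \<longrightarrow> ?z t = 0)" if t: "length t = n" for t
  proof (cases "distinct t \<and> set t \<subseteq> W")
    case True
    then obtain p q where pq: "distinct (t @ [p, q])" "set (t @ [p, q]) = W"
      using compl t by blast
    show ?thesis
      using list_sign_cases[of h "t @ [p, q]", where 'k = 'k]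
      unfolding f[OF t] coboundary_eq[OF h pq] g_def by auto
  qed (simp add: coboundary_eq_0)
  have "f p0 \<noteq> f q0"
    using t0 unfolding f[OF t0(1)] coboundary_eq[OF h t0W] by auto
  then have "?z t0 \<noteq> 0"
    using list_sign_cases[of h "t0 @ [p0, q0]", where 'k = 'k]
    unfolding coboundary_eq[OF h t0W] g_def by auto
  then show ?thesis
    using that[of ?z] val coboundary_cycle[OF h] alternating_coboundary[OF h] by blast
qed

section \<open>Resolutions by monomial matrices\<close>

definition dec :: "'n \<Rightarrow> ('n \<Rightarrow> int) \<Rightarrow> 'n \<Rightarrow> int" where
  "dec u a = a(u := a u - 1)"

lemma dec_apply: "dec u a w = (if w = u then a w - 1 else a w)"
  by (simp add: dec_def)

lemma dec_commute: "dec u (dec v a) = dec v (dec u a)"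
  by (auto simp: dec_def fun_eq_iff)

lemma dec_le: "dec u a \<le> a"
  by (auto simp: le_fun_def dec_apply)

lemma inj_dec: "dec u a = dec v a \<longleftrightarrow> u = v"
proof
  assume "dec u a = dec v a"
  then have "dec u a u = dec v a u" by simp
  then show "u = v" by (simp add: dec_apply split: if_splits)
qed simp

lemma total_degree_dec [simp]: "total_degree (dec u a) = total_degree a - 1"
proof -
  have "total_degree (dec u a) = (\<Sum>w\<in>UNIV. a w - (if w = u then 1 else 0))"
    unfolding total_degree_def by (intro sum.cong) (auto simp: dec_apply)
  then show ?thesis by (simp add: sum_subtractf total_degree_def)
qed

lemma total_degree_mono: "a \<le> b \<Longrightarrow> total_degree a \<le> total_degree b"
  unfolding total_degree_def by (intro sum_mono) (auto simp: le_fun_def)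

lemma total_degree_strict_mono:
  assumes "a \<le> b" "a \<noteq> b"
  shows "total_degree a < total_degree b"
proof -
  obtain u where "a u \<noteq> b u" using assms(2) by blast
  then have "a u < b u" using assms(1) by (simp add: le_fun_def order_less_le)
  then show ?thesis
    unfolding total_degree_def using assms(1) by (intro sum_strict_mono_ex1) (auto simp: le_fun_def)
qed

lemma eq_dec:
  assumes "b \<le> a" "total_degree b + 1 = total_degree a"
  obtains u where "b = dec u a"
proof -
  have "b \<noteq> a" using assms by auto
  then obtain u where u: "b u \<noteq> a u" by blast
  then have "b \<le> dec u a" using assms(1) by (auto simp: le_fun_def order_less_le dec_apply)
  then have "b = dec u a" using total_degree_strict_mono[of b "dec u a"] assms by fastforce
  then show ?thesis by (rule that)
qed

text \<open>The interval between a degree and one two steps below it has no further interior points.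
  This isolates the at most two intermediate degrees in the relation that the differential squares
  to zero.\<close>

lemma between_dec_dec:
  fixes a :: "'n::finite \<Rightarrow> int"
  assumes "dec v (dec u a) \<le> m" "m \<le> a" "m \<noteq> dec v (dec u a)" "m \<noteq> a"
  shows "m = dec u a \<or> m = dec v a"
proof -
  have "total_degree (dec v (dec u a)) < total_degree m" "total_degree m < total_degree a"
    using assms total_degree_strict_mono by metis+
  then obtain w where w: "m = dec w a" using eq_dec[OF assms(2)] by auto
  have "w = u \<or> w = v"
    using le_funD[OF assms(1), of w] w by (auto simp: dec_apply split: if_splits)
  then show ?thesis using w by auto
qed

fun dec_list :: "'n list \<Rightarrow> ('n \<Rightarrow> int) \<Rightarrow> 'n \<Rightarrow> int" where
  "dec_list [] a = a"
| "dec_list (u # t) a = dec_list t (dec u a)"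

lemma dec_list_apply: "dec_list t a w = a w - int (count_list t w)"
  by (induction t arbitrary: a) (auto simp: dec_apply)

lemma total_degree_dec_list: "total_degree (dec_list t a) = total_degree a - int (length t)"
  by (induction t arbitrary: a) auto

text \<open>The augmented resolution in coordinates: \<open>C 0\<close> is the basis of \<open>S\<close>, \<open>C (Suc i)\<close> that of \<open>F i\<close>, and the
  entry of the differential at \<open>e\<close>, \<open>e'\<close> is \<open>D i e e'\<close> times the monomial of degree \<open>dg e - dg e'\<close>.
  In degree \<open>a\<close> only the basis elements of degree at most \<open>a\<close> contribute, one dimension each.\<close>

locale monomial_complex =
  fixes C :: "nat \<Rightarrow> 'e set"
    and dg :: "nat \<Rightarrow> 'e \<Rightarrow> 'n::finite \<Rightarrow> int"
    and D :: "nat \<Rightarrow> 'e \<Rightarrow> 'e \<Rightarrow> 'k::field"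
    and unit :: 'e
  assumes finite_C: "finite (C i)"
    and C_0: "C 0 = {unit}"
    and dg_0: "dg 0 unit = (\<lambda>_. 0)"
    and D_le: "e \<in> C (Suc i) \<Longrightarrow> e' \<in> C i \<Longrightarrow> D i e e' \<noteq> 0 \<Longrightarrow> dg i e' \<le> dg (Suc i) e"
    and D_minimal: "e \<in> C (Suc (Suc i)) \<Longrightarrow> e' \<in> C (Suc i) \<Longrightarrow> D (Suc i) e e' \<noteq> 0 \<Longrightarrow>
           dg (Suc i) e' \<noteq> dg (Suc (Suc i)) e"
    and DD: "e \<in> C (Suc (Suc i)) \<Longrightarrow> e'' \<in> C i \<Longrightarrow> (\<Sum>e'\<in>C (Suc i). D (Suc i) e e' * D i e' e'') = 0"
    and D_exact: "(\<And>e. e \<in> C (Suc i) \<Longrightarrow> c e \<noteq> 0 \<Longrightarrow> dg (Suc i) e \<le> a) \<Longrightarrow>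
           (\<And>e'. e' \<in> C i \<Longrightarrow> (\<Sum>e\<in>C (Suc i). c e * D i e e') = 0) \<Longrightarrow>
           \<exists>c'. (\<forall>e\<in>C (Suc (Suc i)). c' e \<noteq> 0 \<longrightarrow> dg (Suc (Suc i)) e \<le> a) \<and>
                (\<forall>e\<in>C (Suc i). c e = (\<Sum>e''\<in>C (Suc (Suc i)). c' e'' * D (Suc i) e'' e))"
begin

section \<open>Exactness and minimality in matrix form\<close>

definition R :: "nat \<Rightarrow> ('n \<Rightarrow> int) \<Rightarrow> 'e set" where
  "R i a = {e \<in> C i. dg i e = a}"

lemma finite_R: "finite (R i a)"
  unfolding R_def using finite_C by auto

text \<open>By exactness \<open>c\<close> is a boundary of elements of degree at most
  \<open>a\<close>, but by minimality an element whose differential involves \<open>e\<close> has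
  degree strictly above that of \<open>e\<close>, which is \<open>a\<close>.\<close>

lemma cycle_top_degree_eq_0:
  assumes "\<And>e. e \<in> C (Suc i) \<Longrightarrow> c e \<noteq> 0 \<Longrightarrow> dg (Suc i) e \<le> a"
    and "\<And>e'. e' \<in> C i \<Longrightarrow> (\<Sum>e\<in>C (Suc i). c e * D i e e') = 0"
    and e: "e \<in> R (Suc i) a"
  shows "c e = 0"
proof -
  obtain c' where c': "\<forall>e\<in>C (Suc (Suc i)). c' e \<noteq> 0 \<longrightarrow> dg (Suc (Suc i)) e \<le> a"
    "\<forall>e\<in>C (Suc i). c e = (\<Sum>e''\<in>C (Suc (Suc i)). c' e'' * D (Suc i) e'' e)"
    using D_exact[of i c a] assms by auto
  have "c' e'' * D (Suc i) e'' e = 0" if "e'' \<in> C (Suc (Suc i))" for e''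
  proof (rule ccontr)
    assume "c' e'' * D (Suc i) e'' e \<noteq> 0"
    then have "dg (Suc (Suc i)) e'' \<le> a" "a \<le> dg (Suc (Suc i)) e''" "a \<noteq> dg (Suc (Suc i)) e''"
      using c' that e D_le[of e'' "Suc i" e] D_minimal[of e'' i e] by (auto simp: R_def)
    then show False by auto
  qed
  then show ?thesis using c' e by (auto simp: R_def intro!: sum.neutral)
qed

text \<open>A vanishing row would make the unit vector at \<open>e\<close> a cycle with nonzero
  coefficient in its own top degree.\<close>

lemma exists_D_nonzero:
  assumes "e \<in> C (Suc i)"
  obtains e' where "e' \<in> C i" "D i e e' \<noteq> 0" "dg i e' \<le> dg (Suc i) e"
proof -
  let ?c = "\<lambda>x. if x = e then 1 else 0 :: 'k"
  have s: "(\<Sum>x\<in>C (Suc i). ?c x * D i x e') = D i e e'" for e'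
    using assms finite_C by (simp add: if_distrib[of "\<lambda>x. x * _"] cong: if_cong)
  have "\<exists>e'\<in>C i. D i e e' \<noteq> 0"
  proof (rule ccontr)
    assume "\<not> (\<exists>e'\<in>C i. D i e e' \<noteq> 0)"
    then have "?c e = 0"
      using s assms by (intro cycle_top_degree_eq_0[of i ?c "dg (Suc i) e" e])
        (auto simp: R_def split: if_splits)
    then show False by simp
  qed
  then show ?thesis using D_le assms that by blast
qed

lemma dg_nonneg: "e \<in> C i \<Longrightarrow> 0 \<le> dg i e u"
proof (induction i arbitrary: e)
  case 0
  then show ?case using C_0 dg_0 by simp
next
  case (Suc i)
  obtain e' where "e' \<in> C i" "dg i e' \<le> dg (Suc i) e"
    using exists_D_nonzero[OF Suc.prems] by blast
  then show ?case using Suc.IH[of e'] by (auto simp: le_fun_def intro: order_trans)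
qed

lemma D_less_total_degree:
  assumes "e \<in> C (Suc (Suc i))" "e' \<in> C (Suc i)" "D (Suc i) e e' \<noteq> 0"
  shows "total_degree (dg (Suc i) e') < total_degree (dg (Suc (Suc i)) e)"
  using D_le D_minimal assms total_degree_strict_mono by metis

lemma sum_dec_rows:
  assumes "\<And>e. e \<in> C i \<Longrightarrow> f e \<noteq> (0::'k) \<Longrightarrow> \<exists>u. dg i e = dec u a"
  shows "(\<Sum>e\<in>C i. f e) = (\<Sum>u\<in>UNIV. \<Sum>e\<in>R i (dec u a). f e)"
proof -
  have "(\<Sum>u\<in>UNIV. \<Sum>e\<in>R i (dec u a). f e) = (\<Sum>e\<in>(\<Union>u\<in>UNIV. R i (dec u a)). f e)"
    by (rule sum.UNION_disjoint[symmetric]) (auto simp: finite_R, auto simp: R_def inj_dec)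
  also have "\<dots> = (\<Sum>e\<in>C i. f e)"
    using assms finite_C by (intro sum.mono_neutral_left) (auto simp: R_def)
  finally show ?thesis by simp
qed

text \<open>A list of length \<open>n\<close> is evaluated on \<open>C (Suc n)\<close>, the basis of
  \<open>F n\<close>, following the differential through one variable per letter. The base value is
  the augmentation scalar rather than 1, so that the relation between the first differential and the
  augmentation turns into a relation on the last letter.\<close>

fun L :: "'n list \<Rightarrow> 'e \<Rightarrow> 'k" where
  "L [] e = D 0 e unit"
| "L (u # t) e = (\<Sum>e'\<in>R (Suc (length t)) (dec u (dg (Suc (Suc (length t))) e)).
      D (Suc (length t)) e e' * L t e')"

text \<open>Any element contributing to the square of the differential between \<open>e\<close> and
  \<open>e''\<close> has a degree strictly inside an interval of length two. The lower index is a
  successor so that minimality of both maps excludes the endpoints of that interval.\<close>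

lemma DD_rows:
  fixes i :: nat
  defines "n \<equiv> Suc i"
  assumes e: "e \<in> C (Suc (Suc n))" and e'': "e'' \<in> R n (dec v (dec u (dg (Suc (Suc n)) e)))"
  defines "S \<equiv> \<lambda>w. \<Sum>e'\<in>R (Suc n) (dec w (dg (Suc (Suc n)) e)). D (Suc n) e e' * D n e' e''"
  shows "u \<noteq> v \<Longrightarrow> S u + S v = 0" "u = v \<Longrightarrow> S u = 0"
proof -
  let ?a = "dg (Suc (Suc n)) e"
  let ?U = "R (Suc n) (dec u ?a) \<union> R (Suc n) (dec v ?a)"
  have c: "e'' \<in> C n" "dg n e'' = dec v (dec u ?a)" using e'' by (auto simp: R_def)
  have "D (Suc n) e e' * D n e' e'' = 0" if "e' \<in> C (Suc n) - ?U" for e'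
  proof (rule ccontr)
    assume "D (Suc n) e e' * D n e' e'' \<noteq> 0"
    then have "dg (Suc n) e' = dec u ?a \<or> dg (Suc n) e' = dec v ?a"
      using that e c D_le[of e "Suc n" e'] D_le[of e' n e''] D_minimal[of e n e'] D_minimal[of e' i e'']
      by (intro between_dec_dec) (auto simp: n_def)
    then show False using that by (auto simp: R_def)
  qed
  then have *: "(\<Sum>e'\<in>?U. D (Suc n) e e' * D n e' e'') = 0"
    using DD[OF e c(1)] finite_C
    by (subst sum.mono_neutral_left[of "C (Suc n)"]) (auto simp: R_def)
  show "S u = 0" if "u = v" using * that by (simp add: S_def)
  show "S u + S v = 0" if "u \<noteq> v"
    using * that unfolding S_def
    by (subst (asm) sum.union_disjoint) (auto simp: finite_R, auto simp: R_def inj_dec)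
qed

lemma L_Cons_Cons:
  assumes "e \<in> C (length t + 3)"
  defines "a \<equiv> dg (length t + 3) e"
  shows "L (u # v # t) e = (\<Sum>e''\<in>R (Suc (length t)) (dec v (dec u a)).
     (\<Sum>e'\<in>R (Suc (Suc (length t))) (dec u a). D (Suc (Suc (length t))) e e' * D (Suc (length t)) e' e'') * L t e'')"
proof -
  let ?n = "Suc (length t)"
  have "L (u # v # t) e = (\<Sum>e'\<in>R (Suc ?n) (dec u a). D (Suc ?n) e e' *
      (\<Sum>e''\<in>R ?n (dec v (dec u a)). D ?n e' e'' * L t e''))"
    unfolding a_def by (simp add: R_def eval_nat_numeral)
  also have "\<dots> = (\<Sum>e'\<in>R (Suc ?n) (dec u a). \<Sum>e''\<in>R ?n (dec v (dec u a)).
      D (Suc ?n) e e' * D ?n e' e'' * L t e'')"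
    by (simp add: sum_distrib_left mult.assoc)
  also have "\<dots> = (\<Sum>e''\<in>R ?n (dec v (dec u a)). \<Sum>e'\<in>R (Suc ?n) (dec u a).
      D (Suc ?n) e e' * D ?n e' e'' * L t e'')"
    by (rule sum.swap)
  finally show ?thesis by (simp add: sum_distrib_right)
qed

text \<open>A swap of the first two letters is the vanishing square of the differential, read
  through \<open>DD_rows\<close>; a swap further down is inherited from the elements one step
  lower.\<close>

lemma alternating_L: "e \<in> C (Suc n) \<Longrightarrow> alternating n (\<lambda>t. L t e)"
proof (induction n arbitrary: e)
  case 0
  show ?case by (rule alternatingI) simp_all
next
  case (Suc n)
  show ?case
  proof (rule alternatingI)
    fix xs ys :: "'n list" and u v :: 'n
    assume l: "length xs + length ys + 2 = Suc n" and "u \<noteq> v"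
    show "L (xs @ u # v # ys) e = - L (xs @ v # u # ys) e"
    proof (cases xs)
      case Nil
      then have e: "e \<in> C (length ys + 3)" using Suc.prems l by (simp add: eval_nat_numeral)
      have "L (u # v # ys) e + L (v # u # ys) e = 0"
        unfolding L_Cons_Cons[OF e] dec_commute[of u v] sum.distrib[symmetric] distrib_right[symmetric]
        using DD_rows(1)[of e "length ys" _ v u] e \<open>u \<noteq> v\<close>
        by (intro sum.neutral ballI) (simp add: eval_nat_numeral)
      then show ?thesis using Nil by (simp add: eq_neg_iff_add_eq_0)
    next
      case (Cons x xs')
      have "L (xs' @ u # v # ys) e' = - L (xs' @ v # u # ys) e'" if "e' \<in> C (Suc n)" for e'
        using Suc.IH[OF that] by (rule alternatingD(1)) (use l Cons in simp)
      moreover have "Suc (Suc (length xs' + length ys)) = n" using l Cons by simp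
      ultimately show ?thesis using Cons
        by (auto simp: R_def sum_negf[symmetric] intro!: sum.cong)
    qed
  next
    fix xs ys :: "'n list" and u
    assume l: "length xs + length ys + 2 = Suc n"
    show "L (xs @ u # u # ys) e = 0"
    proof (cases xs)
      case Nil
      then have e: "e \<in> C (length ys + 3)" using Suc.prems l by (simp add: eval_nat_numeral)
      have "L (u # u # ys) e = 0"
        unfolding L_Cons_Cons[OF e]
        using DD_rows(2)[of e "length ys" _ u u] e
        by (intro sum.neutral ballI) (simp add: eval_nat_numeral)
      then show ?thesis using Nil by simp
    next
      case (Cons x xs')
      have "L (xs' @ u # u # ys) e' = 0" if "e' \<in> C (Suc n)" for e'
        using Suc.IH[OF that] by (rule alternatingD(2)) (use l Cons in simp)
      moreover have "Suc (Suc (length xs' + length ys)) = n" using l Cons by simp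
      ultimately show ?thesis using Cons
        by (auto simp: R_def intro!: sum.neutral)
    qed
  qed
qed

section \<open>Degrees in which the 2-linear strand is the lowest strand\<close>

definition gens :: "('n \<Rightarrow> int) set" where
  "gens = dg (Suc 0) ` C (Suc 0)"

lemma gens_D:
  assumes "b \<in> gens"
  obtains e where "e \<in> C (Suc 0)" "dg (Suc 0) e = b" "D 0 e unit \<noteq> 0"
proof -
  obtain e where e: "e \<in> C (Suc 0)" "dg (Suc 0) e = b" using assms by (auto simp: gens_def)
  then show ?thesis using exists_D_nonzero[OF e(1)] that C_0 by auto
qed

lemma gens_nonneg: "b \<in> gens \<Longrightarrow> 0 \<le> b u"
  unfolding gens_def using dg_nonneg by blast

lemma L_nonzero:
  "e \<in> C (Suc (length t)) \<Longrightarrow> L t e \<noteq> 0 \<Longrightarrow> dec_list t (dg (Suc (length t)) e) \<in> gens"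
proof (induction t arbitrary: e)
  case (Cons u t)
  then obtain e' where e': "e' \<in> R (Suc (length t)) (dec u (dg (Suc (Suc (length t))) e))" "L t e' \<noteq> 0"
    by (auto elim: sum.not_neutral_contains_not_neutral)
  then show ?case using Cons.IH[of e'] by (auto simp: R_def)
qed (simp add: gens_def)

text \<open>Besides the variables this also excludes the generator 1 of the unit ideal, whose degree
  0 lies below every nonnegative degree.\<close>

definition clean :: "('n \<Rightarrow> int) \<Rightarrow> bool" where
  "clean a \<longleftrightarrow> (\<forall>b\<in>gens. b \<le> a \<longrightarrow> 2 \<le> total_degree b)"

lemma clean_mono: "clean a \<Longrightarrow> b \<le> a \<Longrightarrow> clean b"
  unfolding clean_def by (meson order_trans)

text \<open>The generators below a clean degree start in total degree 2, and minimality makes every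
  differential lower the total degree by at least one.\<close>

lemma clean_total_degree:
  "e \<in> C (Suc n) \<Longrightarrow> clean (dg (Suc n) e) \<Longrightarrow> int n + 2 \<le> total_degree (dg (Suc n) e)"
proof (induction n arbitrary: e)
  case (Suc n)
  obtain e' where e': "e' \<in> C (Suc n)" "D (Suc n) e e' \<noteq> 0" "dg (Suc n) e' \<le> dg (Suc (Suc n)) e"
    using exists_D_nonzero[OF Suc.prems(1)] by blast
  then show ?case
    using Suc.IH[of e'] clean_mono[OF Suc.prems(2)] D_less_total_degree[OF Suc.prems(1) e'(1,2)] by auto
qed (auto simp: clean_def gens_def)

text \<open>A squeeze: minimality keeps the total degree of \<open>e'\<close> below
  \<open>n + 3\<close>, and cleanness keeps it at \<open>n + 2\<close> or above. Below a clean
  degree the differential therefore has only linear components.\<close>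

lemma clean_D_dec:
  assumes "clean a" "total_degree a = int n + 3" "e \<in> C (Suc (Suc n))" "dg (Suc (Suc n)) e \<le> a"
    "e' \<in> C (Suc n)" "D (Suc n) e e' \<noteq> 0"
  shows "\<exists>u. dg (Suc n) e' = dec u a"
proof -
  have le: "dg (Suc n) e' \<le> a" using D_le assms order_trans by metis
  have "total_degree (dg (Suc n) e') < total_degree a"
    using D_less_total_degree[of e n e'] total_degree_mono assms by fastforce
  moreover have "int n + 2 \<le> total_degree (dg (Suc n) e')"
    using clean_total_degree assms clean_mono le by blast
  ultimately have "total_degree (dg (Suc n) e') + 1 = total_degree a" using assms by simp
  then show ?thesis using eq_dec[OF le] by blast
qed

text \<open>Summing over the last letter composes the first differential with the augmentation.
  Cleanness ensures that the rows one variable below account for the whole of this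
  composition.\<close>

lemma L_cycle:
  assumes "e \<in> C (Suc (Suc (length t)))" "clean (dg (Suc (Suc (length t))) e)"
    "total_degree (dg (Suc (Suc (length t))) e) = int (length t) + 3"
  shows "(\<Sum>u\<in>UNIV. L (t @ [u]) e) = 0"
  using assms
proof (induction t arbitrary: e)
  case Nil
  let ?a = "dg (Suc (Suc 0)) e"
  have "(\<Sum>u\<in>UNIV. L ([] @ [u]) e) =
      (\<Sum>u\<in>UNIV. \<Sum>e'\<in>R (Suc 0) (dec u ?a). D (Suc 0) e e' * D 0 e' unit)" by simp
  also have "\<dots> = (\<Sum>e'\<in>C (Suc 0). D (Suc 0) e e' * D 0 e' unit)"
    using clean_D_dec[of ?a 0 e] Nil by (intro sum_dec_rows[symmetric]) auto
  also have "\<dots> = 0" using DD[of e 0] Nil C_0 by auto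
  finally show ?case .
next
  case (Cons x t)
  let ?r = "R (Suc (Suc (length t))) (dec x (dg (Suc (Suc (Suc (length t)))) e))"
  have "(\<Sum>u\<in>UNIV. L ((x # t) @ [u]) e) =
      (\<Sum>u\<in>UNIV. \<Sum>e'\<in>?r. D (Suc (Suc (length t))) e e' * L (t @ [u]) e')" by simp
  also have "\<dots> = (\<Sum>e'\<in>?r. D (Suc (Suc (length t))) e e' * (\<Sum>u\<in>UNIV. L (t @ [u]) e'))"
    unfolding sum_distrib_left by (rule sum.swap)
  also have "\<dots> = 0"
  proof (intro sum.neutral ballI)
    fix e' assume "e' \<in> ?r"
    then show "D (Suc (Suc (length t))) e e' * (\<Sum>u\<in>UNIV. L (t @ [u]) e') = 0"
      using Cons.IH[of e'] Cons.prems clean_mono[OF _ dec_le] by (simp add: R_def)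
  qed
  finally show ?case .
qed

section \<open>Coordinates of vectors of one fixed degree\<close>

definition coord :: "nat \<Rightarrow> ('n \<Rightarrow> int) \<Rightarrow> ('e \<Rightarrow> 'k) \<Rightarrow> 'n list \<Rightarrow> 'k" where
  "coord n a c t = (\<Sum>e\<in>R (Suc n) a. c e * L t e)"

definition push :: "nat \<Rightarrow> ('n \<Rightarrow> int) \<Rightarrow> ('e \<Rightarrow> 'k) \<Rightarrow> 'e \<Rightarrow> 'k" where
  "push n a c e' = (\<Sum>e\<in>R (Suc (Suc n)) a. c e * D (Suc n) e e')"

lemma coord_Cons:
  assumes "length t = n"
  shows "coord (Suc n) a c (u # t) = coord n (dec u a) (push n a c) t"
proof -
  have "coord (Suc n) a c (u # t) =
     (\<Sum>e\<in>R (Suc (Suc n)) a. \<Sum>e'\<in>R (Suc n) (dec u a). c e * D (Suc n) e e' * L t e')"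
    unfolding coord_def using assms
    by (intro sum.cong refl) (simp add: R_def sum_distrib_left mult.assoc)
  also have "\<dots> = (\<Sum>e'\<in>R (Suc n) (dec u a). \<Sum>e\<in>R (Suc (Suc n)) a. c e * D (Suc n) e e' * L t e')"
    by (rule sum.swap)
  finally show ?thesis unfolding coord_def push_def by (simp add: sum_distrib_right)
qed

lemma alternating_coord: "alternating n (coord n a c)"
  unfolding coord_def
  by (intro alternating_sum alternating_mult alternating_L) (simp add: R_def)

lemma coord_nonzero:
  assumes "coord n a c t \<noteq> 0" "length t = n"
  shows "dec_list t a \<in> gens" "\<exists>e. e \<in> R (Suc n) a"
proof -
  obtain e where "e \<in> R (Suc n) a" "L t e \<noteq> 0"
    using assms(1) unfolding coord_def by (auto elim: sum.not_neutral_contains_not_neutral)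
  then show "dec_list t a \<in> gens" "\<exists>e. e \<in> R (Suc n) a"
    using L_nonzero[of e t] assms(2) by (auto simp: R_def)
qed

lemma coord_nonzero_subset:
  assumes "coord n a c t \<noteq> 0" "length t = n"
  shows "set t \<subseteq> {u. 0 < a u}"
proof
  fix u assume "u \<in> set t"
  then have "0 < count_list t u" by (metis count_list_0_iff neq0_conv)
  then show "u \<in> {u. 0 < a u}"
    using gens_nonneg[OF coord_nonzero(1)[OF assms], of u] by (simp add: dec_list_apply)
qed

lemma coord_cycle:
  assumes "clean a" "total_degree a = int n + 2" "length t + 1 = n"
  shows "(\<Sum>u\<in>UNIV. coord n a c (t @ [u])) = 0"
proof -
  have "(\<Sum>u\<in>UNIV. coord n a c (t @ [u])) = (\<Sum>e\<in>R (Suc n) a. c e * (\<Sum>u\<in>UNIV. L (t @ [u]) e))"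
    unfolding coord_def sum_distrib_left by (rule sum.swap)
  also have "\<dots> = 0"
    using L_cycle[of _ t] assms by (intro sum.neutral ballI) (auto simp: R_def)
  finally show ?thesis .
qed

text \<open>Exactness only bounds degrees by \<open>a\<close>. An element of degree strictly below
  \<open>a\<close> cannot involve \<open>e'\<close>, since its total degree would lie strictly
  between two consecutive integers.\<close>

lemma push_eq:
  assumes "\<And>e. e \<in> C (Suc (Suc n)) \<Longrightarrow> c e \<noteq> 0 \<Longrightarrow> dg (Suc (Suc n)) e \<le> a"
    and e': "e' \<in> R (Suc n) (dec u a)"
  shows "(\<Sum>e\<in>C (Suc (Suc n)). c e * D (Suc n) e e') = push n a c e'"
  unfolding push_def
proof (rule sum.mono_neutral_right)
  show "\<forall>e\<in>C (Suc (Suc n)) - R (Suc (Suc n)) a. c e * D (Suc n) e e' = 0"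
  proof (intro ballI, rule ccontr)
    fix e assume e: "e \<in> C (Suc (Suc n)) - R (Suc (Suc n)) a" "c e * D (Suc n) e e' \<noteq> 0"
    then have "dg (Suc (Suc n)) e \<le> a" "dg (Suc (Suc n)) e \<noteq> a"
      using assms by (auto simp: R_def)
    then have "total_degree (dg (Suc (Suc n)) e) < total_degree a"
      by (rule total_degree_strict_mono)
    moreover have "total_degree (dg (Suc n) e') < total_degree (dg (Suc (Suc n)) e)"
      using e e' by (intro D_less_total_degree) (auto simp: R_def)
    moreover have "total_degree (dg (Suc n) e') = total_degree a - 1"
      using e' by (simp add: R_def)
    ultimately show False by simp
  qed
qed (use finite_C in \<open>auto simp: R_def\<close>)

text \<open>By induction all linear components of the differential vanish. In a clean degree there
  are no other components, so the vector is a cycle concentrated in its top degree and hence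
  zero.\<close>

lemma clean_coord_injective:
  assumes "clean a" "total_degree a = int n + 2" "\<And>t. length t = n \<Longrightarrow> coord n a c t = 0"
    "e \<in> R (Suc n) a"
  shows "c e = 0"
  using assms
proof (induction n arbitrary: a c e)
  case 0
  let ?c = "\<lambda>e. if e \<in> R (Suc 0) a then c e else 0"
  have "(\<Sum>e\<in>C (Suc 0). ?c e * D 0 e unit) = coord 0 a c []"
    unfolding coord_def using finite_C
    by (intro sum.mono_neutral_cong_right) (auto simp: R_def)
  then have "?c e = 0"
    using 0 C_0 by (intro cycle_top_degree_eq_0[of 0 ?c a e]) (auto simp: R_def split: if_splits)
  then show ?case using 0 by simp
next
  case (Suc n)
  \<comment> \<open>The values of \<open>c\<close> off the row set are arbitrary, so they are cut
    off before the exactness argument is applied.\<close>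
  let ?c = "\<lambda>e. if e \<in> R (Suc (Suc n)) a then c e else 0"
  have "(\<Sum>e\<in>C (Suc (Suc n)). ?c e * D (Suc n) e e') = 0" if e': "e' \<in> C (Suc n)" for e'
  proof (cases "\<exists>u. dg (Suc n) e' = dec u a")
    case True
    then obtain u where u: "e' \<in> R (Suc n) (dec u a)" using e' by (auto simp: R_def)
    have "push n a c e' = 0"
    proof (rule Suc.IH[OF clean_mono[OF Suc.prems(1) dec_le] _ _ u])
      show "total_degree (dec u a) = int n + 2" using Suc.prems(2) by simp
      show "coord n (dec u a) (push n a c) t = 0" if "length t = n" for t
        using Suc.prems(3)[of "u # t"] coord_Cons[OF that] that by simp
    qed
    moreover have "(\<Sum>e\<in>C (Suc (Suc n)). ?c e * D (Suc n) e e') = push n a c e'"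
      unfolding push_def using finite_C
      by (intro sum.mono_neutral_cong_right) (auto simp: R_def)
    ultimately show ?thesis by simp
  next
    case False
    then show ?thesis
      using clean_D_dec[OF Suc.prems(1), of n _ e'] Suc.prems(2) e'
      by (intro sum.neutral ballI) (auto simp: R_def)
  qed
  then have "?c e = 0"
    using Suc.prems by (intro cycle_top_degree_eq_0[of "Suc n" ?c a e]) (auto simp: R_def split: if_splits)
  then show ?case using Suc.prems by simp
qed

end

section \<open>Degrees without variables of the ideal\<close>

context monomial_complex
begin

text \<open>The slices of \<open>z\<close> by first letter are realised one homological degree lower
  and glued to a vector \<open>y\<close>. Alternation of \<open>z\<close> makes \<open>y\<close> a
  cycle, and a lift of \<open>y\<close> through the next differential has coordinates
  \<open>z\<close>.\<close>

lemma clean_coord_surjective: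
  assumes "clean a" "total_degree a = int n + 2" "alternating n z"
    and "\<And>t. length t = n \<Longrightarrow> z t \<noteq> 0 \<Longrightarrow> dec_list t a \<in> gens"
    and "\<And>t. length t + 1 = n \<Longrightarrow> (\<Sum>u\<in>UNIV. z (t @ [u])) = 0"
  shows "\<exists>c. \<forall>t. length t = n \<longrightarrow> coord n a c t = z t"
  using assms
proof (induction n arbitrary: a z)
  case 0
  show ?case
  proof (cases "z [] = 0")
    case True
    then show ?thesis by (intro exI[of _ "\<lambda>_. 0"]) (simp add: coord_def)
  next
    case False
    then obtain e where e: "e \<in> C (Suc 0)" "dg (Suc 0) e = a" "D 0 e unit \<noteq> 0"
      using 0(4)[of "[]"] gens_D by auto
    have "(\<Sum>x\<in>R (Suc 0) a. (if x = e then z [] / D 0 e unit else 0) * D 0 x unit) =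
       (\<Sum>x\<in>R (Suc 0) a. if x = e then z [] else 0)"
      using e by (intro sum.cong) auto
    also have "\<dots> = z []" using e by (simp add: finite_R) (simp add: R_def)
    finally show ?thesis
      by (intro exI[of _ "\<lambda>x. if x = e then z [] / D 0 e unit else 0"]) (simp add: coord_def)
  qed
next
  case (Suc n)
  have "\<exists>c. \<forall>t. length t = n \<longrightarrow> coord n (dec u a) c t = z (u # t)" for u
  proof (rule Suc.IH)
    show "clean (dec u a)" using Suc.prems(1) dec_le by (rule clean_mono)
    show "total_degree (dec u a) = int n + 2" using Suc.prems(2) by simp
    show "alternating n (\<lambda>t. z (u # t))" using Suc.prems(3) by (rule alternating_Cons)
    show "dec_list t (dec u a) \<in> gens" if "length t = n" "z (u # t) \<noteq> 0" for t
      using Suc.prems(4)[of "u # t"] that by simp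
    show "(\<Sum>v\<in>UNIV. z (u # t @ [v])) = 0" if "length t + 1 = n" for t
      using Suc.prems(5)[of "u # t"] that by simp
  qed
  then obtain c where c: "\<And>u t. length t = n \<Longrightarrow> coord n (dec u a) (c u) t = z (u # t)"
    by metis
  \<comment> \<open>The degrees \<open>dec u a\<close> are pairwise different, so at most one slice
    contributes at each basis element.\<close>
  define y where "y e = (\<Sum>u\<in>UNIV. if e \<in> R (Suc n) (dec u a) then c u e else 0)" for e
  have y_eq: "y e = c u e" if "e \<in> R (Suc n) (dec u a)" for u e
  proof -
    have "y e = (\<Sum>v\<in>UNIV. if v = u then c u e else 0)"
      unfolding y_def using that by (intro sum.cong) (auto simp: R_def inj_dec)
    then show ?thesis by simp
  qed
  have y_supp: "\<exists>u. dg (Suc n) e = dec u a" if "e \<in> C (Suc n)" "y e \<noteq> 0" for e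
    using that unfolding y_def R_def by (auto elim!: sum.not_neutral_contains_not_neutral split: if_splits)
  have y_sum: "(\<Sum>e\<in>C (Suc n). y e * f e) = (\<Sum>u\<in>UNIV. \<Sum>e\<in>R (Suc n) (dec u a). c u e * f e)" for f
    using y_supp y_eq by (subst sum_dec_rows[of _ _ a]) auto
  \<comment> \<open>For \<open>n = 0\<close> the target is the ring itself and this is the cycle
    condition for the empty list. For larger \<open>n\<close> it comes from alternation of
    \<open>z\<close>, via injectivity of coordinates two steps below \<open>a\<close>.\<close>
  have y_cycle: "(\<Sum>e\<in>C (Suc n). y e * D n e e') = 0" if e': "e' \<in> C n" for e'
  proof (cases n)
    case 0
    then have "e' = unit" using e' C_0 by simp
    then have "(\<Sum>e\<in>C (Suc n). y e * D n e e') = (\<Sum>u\<in>UNIV. coord n (dec u a) (c u) [])"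
      unfolding y_sum coord_def using 0 by simp
    also have "\<dots> = 0" using c[of "[]"] Suc.prems(5)[of "[]"] 0 by simp
    finally show ?thesis .
  next
    case (Suc m)
    show ?thesis
    proof (cases "\<exists>u v. dg n e' = dec v (dec u a)")
      case False
      have "y e * D n e e' = 0" if e: "e \<in> C (Suc n)" for e
      proof (rule ccontr)
        assume nz: "y e * D n e e' \<noteq> 0"
        then obtain u where u: "dg (Suc n) e = dec u a" using y_supp e by auto
        then have "\<exists>v. dg n e' = dec v (dec u a)"
          using clean_D_dec[of "dec u a" m e e'] clean_mono[OF Suc.prems(1) dec_le] Suc.prems(2) nz e e' Suc
          by auto
        then show False using False by blast
      qed
      then show ?thesis by (intro sum.neutral) simp
    next
      case True
      then obtain u v where e'b: "e' \<in> R n (dec v (dec u a))" using e' by (auto simp: R_def)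
      define b where "b = dec v (dec u a)"
      define w where "w x = (\<Sum>e\<in>C (Suc n). y e * D n e x)" for x
      have part: "(\<Sum>x\<in>R n b. (\<Sum>e\<in>R (Suc n) (dec u a). c u e * D n e x) * L t x) = z (u # v # t)"
        if t: "length t = m" and b: "b = dec v (dec u a)" for t u v
      proof -
        have "z (u # v # t) = coord n (dec u a) (c u) (v # t)" using c[of "v # t" u] t Suc by simp
        also have "\<dots> = coord m b (push m (dec u a) (c u)) t"
          using coord_Cons[OF t, of "dec u a"] b Suc by simp
        finally show ?thesis unfolding coord_def push_def Suc by simp
      qed
      have rows: "u' \<in> {u, v}" if "x \<in> R n b" "e \<in> R (Suc n) (dec u' a)" "D n e x \<noteq> 0" for u' x e
      proof (rule ccontr)
        assume u': "u' \<notin> {u, v}"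
        have "dec v (dec u a) u' \<le> dec u' a u'"
          using D_le[of e n x] that by (auto simp: R_def le_fun_def b_def)
        then show False using u' by (simp add: dec_apply split: if_splits)
      qed
      have "coord m b w t = 0" if t: "length t = m" for t
      proof -
        have "w x = (\<Sum>u'\<in>{u, v}. \<Sum>e\<in>R (Suc n) (dec u' a). c u' e * D n e x)" if "x \<in> R n b" for x
          unfolding w_def y_sum
        proof (rule sum.mono_neutral_right)
          have "c u' e * D n e x = 0" if "u' \<notin> {u, v}" "e \<in> R (Suc n) (dec u' a)" for u' e
            using rows[OF \<open>x \<in> R n b\<close> that(2)] that(1) by auto
          then show "\<forall>u'\<in>UNIV - {u, v}. (\<Sum>e\<in>R (Suc n) (dec u' a). c u' e * D n e x) = 0"
            by (intro ballI sum.neutral) blast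
        qed auto
        then have "coord m b w t =
            (\<Sum>x\<in>R n b. \<Sum>u'\<in>{u, v}. (\<Sum>e\<in>R (Suc n) (dec u' a). c u' e * D n e x) * L t x)"
          unfolding coord_def Suc[symmetric] by (intro sum.cong refl) (simp only: sum_distrib_right)
        also have "\<dots> = (\<Sum>u'\<in>{u, v}. \<Sum>x\<in>R n b. (\<Sum>e\<in>R (Suc n) (dec u' a). c u' e * D n e x) * L t x)"
          by (rule sum.swap)
        \<comment> \<open>The two routes contribute \<open>z (u # v # t)\<close> and
          \<open>z (v # u # t)\<close>, which cancel; if \<open>u = v\<close> there is a single
          route and it contributes 0.\<close>
        also have "\<dots> = 0"
        proof (cases "u = v")
          case True
          then show ?thesis
            using part[OF t, of v u] alternatingD(2)[OF Suc.prems(3), of "[]" t u] t Suc by (simp add: b_def)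
        next
          case False
          then show ?thesis
            using part[OF t, of v u] part[OF t, of u v] dec_commute[of u v a]
              alternatingD(1)[OF Suc.prems(3), of "[]" t u v] t Suc by (simp add: b_def)
        qed
        finally show ?thesis .
      qed
      then have "w e' = 0"
        using e'b clean_mono[OF Suc.prems(1) order_trans[OF dec_le dec_le]] Suc.prems(2) Suc
        by (intro clean_coord_injective[of b m w e']) (auto simp: b_def)
      then show ?thesis by (simp add: w_def)
    qed
  qed
  have "dg (Suc n) e \<le> a" if "e \<in> C (Suc n)" "y e \<noteq> 0" for e
    using y_supp[OF that] dec_le by metis
  then obtain c' where c': "\<And>e. e \<in> C (Suc (Suc n)) \<Longrightarrow> c' e \<noteq> 0 \<Longrightarrow> dg (Suc (Suc n)) e \<le> a"
    "\<And>e. e \<in> C (Suc n) \<Longrightarrow> y e = (\<Sum>e''\<in>C (Suc (Suc n)). c' e'' * D (Suc n) e'' e)"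
    using D_exact[of n y a] y_cycle by blast
  have "coord (Suc n) a c' (u # t) = z (u # t)" if t: "length t = n" for u t
  proof -
    have "push n a c' e = c u e" if "e \<in> R (Suc n) (dec u a)" for e
      using push_eq[OF c'(1) that] c'(2)[of e] y_eq[OF that] that by (auto simp: R_def)
    then have "coord n (dec u a) (push n a c') t = coord n (dec u a) (c u) t"
      unfolding coord_def by (intro sum.cong) auto
    then show ?thesis using coord_Cons[OF t] c[OF t] by simp
  qed
  then show ?case by (metis length_Suc_conv)
qed

text \<open>The second clause amounts to saying that vectors of minimal support in the coordinate
  space are scalar multiples of vectors with entries in {-1, 0, 1}, as for the chain groups of
  regular matroids. Stating it for all vectors spares the passage to minimal supports.\<close>

definition regular :: "nat \<Rightarrow> ('n \<Rightarrow> int) \<Rightarrow> bool" where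
  "regular n a \<longleftrightarrow>
     (\<forall>c. (\<forall>t. length t = n \<longrightarrow> coord n a c t = 0) \<longrightarrow> (\<forall>e\<in>R (Suc n) a. c e = 0)) \<and>
     (\<forall>c t0. length t0 = n \<longrightarrow> coord n a c t0 \<noteq> 0 \<longrightarrow>
        (\<exists>c'. coord n a c' t0 \<noteq> 0 \<and>
           (\<forall>t. length t = n \<longrightarrow> coord n a c' t \<in> {-1, 0, 1} \<and>
              (coord n a c t = 0 \<longrightarrow> coord n a c' t = 0))))"

lemma clean_regular:
  assumes "clean a" "total_degree a = int n + 2"
  shows "regular n a"
  unfolding regular_def
proof (intro conjI allI impI)
  fix c assume "\<forall>t. length t = n \<longrightarrow> coord n a c t = 0"
  then show "\<forall>e\<in>R (Suc n) a. c e = 0" using clean_coord_injective[OF assms] by blast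
next
  fix c t0 assume t0: "length t0 = n" "coord n a c t0 \<noteq> 0"
  obtain e where e: "e \<in> R (Suc n) a" using coord_nonzero(2)[OF t0(2,1)] by blast
  have nonneg: "0 \<le> a u" for u using dg_nonneg[of e "Suc n" u] e by (auto simp: R_def)
  \<comment> \<open>The support of \<open>a\<close> has at most as many elements as the total
    degree, and the bound is reached only in squarefree degrees.\<close>
  let ?W = "{u. 0 < a u}"
  have "int (card ?W) = (\<Sum>u\<in>?W. 1)" by simp
  also have "\<dots> \<le> (\<Sum>u\<in>?W. a u)" by (intro sum_mono) auto
  also have "\<dots> \<le> total_degree a"
    unfolding total_degree_def using nonneg by (intro sum_mono2) auto
  finally have card: "card ?W \<le> n + 2" using assms(2) by simp
  obtain z :: "'n list \<Rightarrow> 'k" where z: "alternating n z" "z t0 \<noteq> 0"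
    "\<And>t. length t + 1 = n \<Longrightarrow> (\<Sum>u\<in>UNIV. z (t @ [u])) = 0"
    "\<And>t. length t = n \<Longrightarrow> z t \<in> {-1, 0, 1}"
    "\<And>t. length t = n \<Longrightarrow> coord n a c t = 0 \<Longrightarrow> z t = 0"
  proof (rule exists_signed_cycle[OF alternating_coord _ coord_cycle[OF assms] card t0])
    note * = that
    show "set t \<subseteq> ?W" if "length t = n" "coord n a c t \<noteq> 0" for t
      using coord_nonzero_subset that by blast
    show thesis if z: "alternating n z" "z t0 \<noteq> 0"
      "\<And>t. length t + 1 = n \<Longrightarrow> (\<Sum>u\<in>UNIV. z (t @ [u])) = 0"
      "\<And>t. length t = n \<Longrightarrow> z t \<in> {-1, 0, 1}"
      "\<And>t. length t = n \<Longrightarrow> coord n a c t = 0 \<Longrightarrow> z t = 0" for z :: "'n list \<Rightarrow> 'k"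
      by (rule *[OF z])
  qed
  obtain c' where c': "\<And>t. length t = n \<Longrightarrow> coord n a c' t = z t"
    using clean_coord_surjective[OF assms z(1) _ z(3)] z(5) coord_nonzero(1) by metis
  then show "\<exists>c'. coord n a c' t0 \<noteq> 0 \<and>
           (\<forall>t. length t = n \<longrightarrow> coord n a c' t \<in> {-1, 0, 1} \<and>
              (coord n a c t = 0 \<longrightarrow> coord n a c' t = 0))"
    using z t0 by (intro exI[of _ c']) auto
qed

end

section \<open>Dual bases with signed coordinates\<close>

lemma exists_minimal_subset:
  assumes "finite A" "P A"
  obtains B where "B \<subseteq> A" "P B" "\<And>x. x \<in> B \<Longrightarrow> \<not> P (B - {x})"
proof -
  define B where "B = arg_min card (\<lambda>B. B \<subseteq> A \<and> P B)"
  have B: "B \<subseteq> A" "P B"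
    unfolding B_def using arg_min_natI[of "\<lambda>B. B \<subseteq> A \<and> P B" A card] assms by auto
  have min: "card B \<le> card B'" if "B' \<subseteq> A" "P B'" for B'
    unfolding B_def using arg_min_nat_le[of "\<lambda>B. B \<subseteq> A \<and> P B" B' card] that by auto
  have "\<not> P (B - {x})" if x: "x \<in> B" for x
  proof
    assume "P (B - {x})"
    then have "card B \<le> card (B - {x})" using B by (intro min) auto
    moreover have "finite B" using B assms finite_subset by blast
    ultimately show False using x by (metis card_Diff1_less not_le)
  qed
  then show ?thesis using that B by blast
qed

context monomial_complex
begin

lemma regular_dual_basis:
  assumes "regular n a"
  obtains T b where "T \<subseteq> {t. length t = n}" "finite T"
    "\<And>t t'. t \<in> T \<Longrightarrow> t' \<in> T \<Longrightarrow> coord n a (b t) t' = (if t = t' then 1 else 0)"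
    "\<And>t t'. t \<in> T \<Longrightarrow> length t' = n \<Longrightarrow> coord n a (b t) t' \<in> {-1, 0, 1}"
    "\<And>c e. (\<And>t. t \<in> T \<Longrightarrow> coord n a c t = 0) \<Longrightarrow> e \<in> R (Suc n) a \<Longrightarrow> c e = 0"
proof -
  let ?X = "{t :: 'n list. length t = n}"
  let ?P = "\<lambda>T. \<forall>c. (\<forall>t\<in>T. coord n a c t = 0) \<longrightarrow> (\<forall>e\<in>R (Suc n) a. c e = 0)"
  have fX: "finite ?X" using finite_lists_length_eq[of "UNIV :: 'n set" n] by simp
  have "?P ?X" using assms unfolding regular_def by blast
  then obtain T where T: "T \<subseteq> ?X" "?P T" "\<And>t. t \<in> T \<Longrightarrow> \<not> ?P (T - {t})"
    by (rule exists_minimal_subset[where P = ?P, OF fX]) blast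
  have "\<exists>c. coord n a c t = 1 \<and> (\<forall>t'\<in>T - {t}. coord n a c t' = 0) \<and>
      (\<forall>t'. length t' = n \<longrightarrow> coord n a c t' \<in> {-1, 0, 1})" if t: "t \<in> T" for t
  proof -
    \<comment> \<open>Without \<open>t\<close> the coordinates in \<open>T\<close> are no longer
      injective. A witness of this vanishes on the rest of \<open>T\<close>, and cannot vanish at
      \<open>t\<close> because \<open>T\<close> itself is injective.\<close>
    obtain c e where c: "\<forall>t'\<in>T - {t}. coord n a c t' = 0" "e \<in> R (Suc n) a" "c e \<noteq> 0"
      using T(3) t by blast
    have "coord n a c t \<noteq> 0" using T(2) c t by blast
    then obtain c' where c': "coord n a c' t \<noteq> 0"
      "\<And>t. length t = n \<Longrightarrow> coord n a c' t \<in> {-1, 0, 1} \<and> (coord n a c t = 0 \<longrightarrow> coord n a c' t = 0)"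
      using assms T(1) t unfolding regular_def by blast
    \<comment> \<open>This value is a sign, so multiplying by it normalises the coordinate at
      \<open>t\<close> to 1 and keeps all others in {-1, 0, 1}; the smaller support preserves the
      zeros on the rest of \<open>T\<close>.\<close>
    let ?s = "coord n a c' t"
    have s: "?s = 1 \<or> ?s = -1" using c' T(1) t by blast
    have eq: "coord n a (\<lambda>e. ?s * c' e) t' = ?s * coord n a c' t'" for t'
      by (simp add: coord_def sum_distrib_left mult.assoc)
    show ?thesis
    proof (intro exI[of _ "\<lambda>e. ?s * c' e"] conjI ballI allI impI)
      show "coord n a (\<lambda>e. ?s * c' e) t = 1" unfolding eq using s by auto
      show "coord n a (\<lambda>e. ?s * c' e) t' = 0" if "t' \<in> T - {t}" for t'
        unfolding eq using that c c'(2)[of t'] T(1) by auto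
      show "coord n a (\<lambda>e. ?s * c' e) t' \<in> {-1, 0, 1}" if "length t' = n" for t'
        unfolding eq using c'(2)[OF that] s by auto
    qed
  qed
  then obtain b where b: "\<And>t. t \<in> T \<Longrightarrow> coord n a (b t) t = 1 \<and> (\<forall>t'\<in>T - {t}. coord n a (b t) t' = 0) \<and>
      (\<forall>t'. length t' = n \<longrightarrow> coord n a (b t) t' \<in> {-1, 0, 1})" by metis
  show ?thesis
  proof (rule that[of T b])
    show "finite T" using T(1) fX finite_subset by blast
    show "coord n a (b t) t' = (if t = t' then 1 else 0)" if "t \<in> T" "t' \<in> T" for t t'
      using b[OF that(1)] that by auto
    show "coord n a (b t) t' \<in> {-1, 0, 1}" if "t \<in> T" "length t' = n" for t t'
      using b[OF that(1)] that by auto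
    show "c e = 0" if "\<And>t. t \<in> T \<Longrightarrow> coord n a c t = 0" "e \<in> R (Suc n) a" for c e
      using T(2) that by blast
  qed (rule T(1))
qed

end

section \<open>Variables in the ideal\<close>

definition inc :: "'n \<Rightarrow> ('n \<Rightarrow> int) \<Rightarrow> 'n \<Rightarrow> int" where
  "inc u a = a(u := a u + 1)"

lemma inc_apply: "inc u a w = (if w = u then a w + 1 else a w)"
  by (simp add: inc_def)

lemma dec_eq_iff: "dec u a = b \<longleftrightarrow> a = inc u b"
  by (auto simp: dec_def inc_def)

lemma inc_mono: "a \<le> b \<Longrightarrow> inc u a \<le> inc u b"
  by (auto simp: le_fun_def inc_apply)

lemma inc_ge: "a \<le> inc u a"
  by (auto simp: le_fun_def inc_apply)

lemma total_degree_inc: "total_degree (inc u a) = total_degree a + 1"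
proof -
  have "dec u (inc u a) = a" by (simp add: dec_eq_iff)
  then show ?thesis using total_degree_dec[of u "inc u a"] by simp
qed

lemma le_inc_cases:
  fixes a b :: "'n \<Rightarrow> int"
  assumes "b \<le> a" "a \<le> inc v b"
  shows "a = b \<or> b = dec v a"
proof -
  have bd: "b w \<le> a w" "a w \<le> inc v b w" for w using assms by (simp_all add: le_fun_def)
  have eq: "a w = b w" if "w \<noteq> v" for w using bd[of w] that by (simp add: inc_apply)
  show ?thesis
  proof (cases "a v = b v")
    case True
    then have "a w = b w" for w using eq by (cases "w = v") auto
    then show ?thesis by auto
  next
    case False
    then have "a v = b v + 1" using bd[of v] by (simp add: inc_apply)
    then have "b w = dec v a w" for w using eq[of w] by (simp add: dec_apply)
    then show ?thesis by auto
  qed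
qed

context monomial_complex
begin

text \<open>If one generator divided a different one, subtracting the appropriate multiple would
  give a cycle with coefficient 1 at \<open>e\<close> in the degree of \<open>e\<close>.\<close>

lemma generators_antichain:
  assumes "e \<in> C (Suc 0)" "e1 \<in> C (Suc 0)" "dg (Suc 0) e1 \<le> dg (Suc 0) e"
  shows "e1 = e"
proof (rule ccontr)
  assume ne: "e1 \<noteq> e"
  have nz: "D 0 e1 unit \<noteq> 0" using exists_D_nonzero[OF assms(2)] C_0 by auto
  let ?c = "\<lambda>x. (if x = e then 1 else 0) - (if x = e1 then D 0 e unit / D 0 e1 unit else 0)"
  have "(\<Sum>x\<in>C (Suc 0). ?c x * D 0 x unit) =
      (\<Sum>x\<in>C (Suc 0). if x = e then D 0 e unit else 0) - (\<Sum>x\<in>C (Suc 0). if x = e1 then D 0 e unit else 0)"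
    unfolding sum_subtractf[symmetric] using nz by (intro sum.cong) auto
  also have "\<dots> = 0" using assms finite_C by simp
  finally have "?c e = 0"
    using assms C_0 by (intro cycle_top_degree_eq_0[of 0 ?c "dg (Suc 0) e" e]) (auto simp: R_def split: if_splits)
  then show False using ne by simp
qed

text \<open>The usual comparison argument: \<open>x_v\<close> lies in the ideal, hence annihilates
  the cyclic module. In coordinates multiplication by \<open>x_v\<close> is the identity matrix with
  degrees raised by \<open>inc v\<close>. The bound on \<open>e0\<close> admits both
  \<open>x_v\<close> and 1 as the generator.\<close>

lemma exists_homotopy:
  assumes e0: "e0 \<in> C (Suc 0)" "dg (Suc 0) e0 \<le> inc v (\<lambda>_. 0)"
  obtains K :: "nat \<Rightarrow> 'e \<Rightarrow> 'e \<Rightarrow> 'k" where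
    "\<And>i e e'. e \<in> C i \<Longrightarrow> e' \<in> C (Suc i) \<Longrightarrow> K i e e' \<noteq> 0 \<Longrightarrow> dg (Suc i) e' \<le> inc v (dg i e)"
    "\<And>i e e'. e \<in> C (Suc i) \<Longrightarrow> e' \<in> C (Suc i) \<Longrightarrow>
       (\<Sum>x\<in>C (Suc (Suc i)). K (Suc i) e x * D (Suc i) x e') =
       (if e = e' then 1 else 0) - (\<Sum>x\<in>C i. D i e x * K i x e')"
proof -
  \<comment> \<open>The invariant is \<open>D K D = D\<close>: it makes the rows of the identity
    minus \<open>D K\<close> cycles, so exactness supplies the next level of the homotopy.
    \<open>Q\<close> records the homotopy identity linking two levels.\<close>
  define P where "P i K \<longleftrightarrow>
      (\<forall>e\<in>C i. \<forall>e'\<in>C (Suc i). K e e' \<noteq> 0 \<longrightarrow> dg (Suc i) e' \<le> inc v (dg i e)) \<and>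
      (\<forall>e\<in>C (Suc i). \<forall>y\<in>C i. (\<Sum>x\<in>C i. D i e x * (\<Sum>e'\<in>C (Suc i). K x e' * D i e' y)) = D i e y)"
    for i and K :: "'e \<Rightarrow> 'e \<Rightarrow> 'k"
  define Q where "Q i K K' \<longleftrightarrow> (\<forall>e\<in>C (Suc i). \<forall>e'\<in>C (Suc i).
      (\<Sum>x\<in>C (Suc (Suc i)). K' e x * D (Suc i) x e') =
      (if e = e' then 1 else 0) - (\<Sum>x\<in>C i. D i e x * K x e'))"
    for i and K K' :: "'e \<Rightarrow> 'e \<Rightarrow> 'k"
  have "\<exists>K. \<forall>i. P i (K i) \<and> Q i (K i) (K (Suc i))"
  proof (rule dependent_nat_choice)
    have nz: "D 0 e0 unit \<noteq> 0" using exists_D_nonzero[OF e0(1)] C_0 by auto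
    \<comment> \<open>The homotopy starts by writing \<open>x_v\<close> as a multiple of the
      generator \<open>e0\<close>.\<close>
    let ?K = "\<lambda>e e'. if e' = e0 then 1 / D 0 e0 unit else 0"
    have "(\<Sum>e'\<in>C (Suc 0). ?K x e' * D 0 e' unit) = (\<Sum>e'\<in>C (Suc 0). if e' = e0 then 1 else 0)" for x :: 'e
      using nz by (intro sum.cong) auto
    then have "(\<Sum>e'\<in>C (Suc 0). ?K x e' * D 0 e' unit) = 1" for x :: 'e
      using e0 finite_C by simp
    then show "\<exists>K. P 0 K"
      using e0 C_0 dg_0 unfolding P_def by (intro exI[of _ ?K]) auto
  next
    fix K i assume P: "P i K"
    define c where "c e e' = (if e = e' then 1 else 0) - (\<Sum>x\<in>C i. D i e x * K x e')" for e e'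
    have "\<exists>c'. (\<forall>x\<in>C (Suc (Suc i)). c' x \<noteq> 0 \<longrightarrow> dg (Suc (Suc i)) x \<le> inc v (dg (Suc i) e)) \<and>
        (\<forall>e'\<in>C (Suc i). c e e' = (\<Sum>x\<in>C (Suc (Suc i)). c' x * D (Suc i) x e'))"
      if e: "e \<in> C (Suc i)" for e
    proof (rule D_exact)
      fix e' assume e': "e' \<in> C (Suc i)" "c e e' \<noteq> 0"
      show "dg (Suc i) e' \<le> inc v (dg (Suc i) e)"
      proof (cases "e = e'")
        case True
        then show ?thesis by (simp add: inc_ge)
      next
        case False
        then obtain x where x: "x \<in> C i" "D i e x \<noteq> 0" "K x e' \<noteq> 0"
          using e' unfolding c_def by (auto elim: sum.not_neutral_contains_not_neutral)
        then have "dg (Suc i) e' \<le> inc v (dg i x)" using P e' unfolding P_def by blast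
        also have "\<dots> \<le> inc v (dg (Suc i) e)" using D_le[OF e x(1,2)] by (rule inc_mono)
        finally show ?thesis .
      qed
    next
      fix y assume y: "y \<in> C i"
      have "(\<Sum>e'\<in>C (Suc i). c e e' * D i e' y) =
          (\<Sum>e'\<in>C (Suc i). if e = e' then D i e y else 0) -
          (\<Sum>e'\<in>C (Suc i). \<Sum>x\<in>C i. D i e x * (K x e' * D i e' y))"
        unfolding sum_subtractf[symmetric] c_def
        by (intro sum.cong) (auto simp: sum_distrib_right sum_distrib_left algebra_simps)
      also have "(\<Sum>e'\<in>C (Suc i). \<Sum>x\<in>C i. D i e x * (K x e' * D i e' y)) =
          (\<Sum>x\<in>C i. D i e x * (\<Sum>e'\<in>C (Suc i). K x e' * D i e' y))"
        unfolding sum_distrib_left by (rule sum.swap)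
      also have "\<dots> = D i e y" using P e y unfolding P_def by blast
      also have "(\<Sum>e'\<in>C (Suc i). if e = e' then D i e y else 0) = D i e y"
        using e finite_C by simp
      finally show "(\<Sum>e'\<in>C (Suc i). c e e' * D i e' y) = 0" by simp
    qed
    then obtain K' where K': "\<And>e. e \<in> C (Suc i) \<Longrightarrow>
        (\<forall>x\<in>C (Suc (Suc i)). K' e x \<noteq> 0 \<longrightarrow> dg (Suc (Suc i)) x \<le> inc v (dg (Suc i) e)) \<and>
        (\<forall>e'\<in>C (Suc i). c e e' = (\<Sum>x\<in>C (Suc (Suc i)). K' e x * D (Suc i) x e'))"
      by metis
    have Q: "Q i K K'" unfolding Q_def using K' by (simp add: c_def)
    have "(\<Sum>x\<in>C (Suc i). D (Suc i) e x * (\<Sum>e'\<in>C (Suc (Suc i)). K' x e' * D (Suc i) e' y)) = D (Suc i) e y"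
      if e: "e \<in> C (Suc (Suc i))" and y: "y \<in> C (Suc i)" for e y
    proof -
      have "(\<Sum>x\<in>C (Suc i). D (Suc i) e x * (\<Sum>e'\<in>C (Suc (Suc i)). K' x e' * D (Suc i) e' y)) =
          (\<Sum>x\<in>C (Suc i). D (Suc i) e x * c x y)"
        using K' y by (intro sum.cong) auto
      also have "\<dots> = (\<Sum>x\<in>C (Suc i). if x = y then D (Suc i) e y else 0) -
          (\<Sum>x\<in>C (Suc i). \<Sum>w\<in>C i. D (Suc i) e x * D i x w * K w y)"
        unfolding sum_subtractf[symmetric] c_def
        by (intro sum.cong) (auto simp: sum_distrib_left algebra_simps)
      also have "(\<Sum>x\<in>C (Suc i). \<Sum>w\<in>C i. D (Suc i) e x * D i x w * K w y) =
          (\<Sum>w\<in>C i. (\<Sum>x\<in>C (Suc i). D (Suc i) e x * D i x w) * K w y)"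
        unfolding sum_distrib_right by (rule sum.swap)
      also have "\<dots> = 0" using DD[OF e] by (intro sum.neutral) simp
      finally show ?thesis using y finite_C by simp
    qed
    then have "P (Suc i) K'" unfolding P_def using K' by blast
    then show "\<exists>K'. P (Suc i) K' \<and> Q i K K'" using Q by blast
  qed
  then obtain K where K: "\<And>i. P i (K i)" "\<And>i. Q i (K i) (K (Suc i))" by blast
  show ?thesis
  proof (rule that[of K])
    show "dg (Suc i) e' \<le> inc v (dg i e)" if "e \<in> C i" "e' \<in> C (Suc i)" "K i e e' \<noteq> 0" for i e e'
      using K(1)[of i] that unfolding P_def by blast
    show "(\<Sum>x\<in>C (Suc (Suc i)). K (Suc i) e x * D (Suc i) x e') =
       (if e = e' then 1 else 0) - (\<Sum>x\<in>C i. D i e x * K i x e')"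
      if "e \<in> C (Suc i)" "e' \<in> C (Suc i)" for i e e'
      using K(2)[of i] that unfolding Q_def by blast
  qed
qed

text \<open>If the exponent of \<open>v\<close> exceeded 1, the differential of \<open>e\<close>
  would by induction already live in degree \<open>dec v a\<close>, and exactness there would give a
  vector with the same differential. Its difference from \<open>e\<close> would be a cycle with
  coefficient 1 at \<open>e\<close> in the degree of \<open>e\<close>. For \<open>i = 0\<close> a
  multiple of \<open>e0\<close> provides that vector directly.\<close>

lemma dg_le_1_of_variable:
  assumes e0: "e0 \<in> C (Suc 0)" "dg (Suc 0) e0 \<le> inc v (\<lambda>_. 0)"
    and e: "e \<in> C (Suc i)"
  shows "dg (Suc i) e v \<le> 1"
  using e
proof (induction i arbitrary: e rule: less_induct)
  case (less i)
  show ?case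
  proof (rule ccontr)
    assume "\<not> dg (Suc i) e v \<le> 1"
    then have e: "e \<in> C (Suc i)" "1 < dg (Suc i) e v" using less.prems by auto
    define a where "a = dg (Suc i) e"
    have "\<exists>c. (\<forall>x\<in>C (Suc i). c x \<noteq> 0 \<longrightarrow> dg (Suc i) x \<le> dec v a) \<and>
        (\<forall>e'\<in>C i. D i e e' = (\<Sum>x\<in>C (Suc i). c x * D i x e'))"
    proof (cases i)
      case 0
      have nz: "D 0 e0 unit \<noteq> 0" using exists_D_nonzero[OF e0(1)] C_0 by auto
      have "inc v (\<lambda>_. 0) \<le> dec v a"
        using e dg_nonneg[OF e(1)] unfolding a_def by (auto simp: le_fun_def inc_apply dec_apply)
      then have le: "dg (Suc 0) e0 \<le> dec v a" using e0 by auto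
      have "(\<Sum>x\<in>C (Suc 0). (if x = e0 then D 0 e unit / D 0 e0 unit else 0) * D 0 x unit) =
          (\<Sum>x\<in>C (Suc 0). if x = e0 then D 0 e unit else 0)"
        using nz by (intro sum.cong) auto
      then show ?thesis using 0 e0 C_0 le finite_C
        by (intro exI[of _ "\<lambda>x. if x = e0 then D 0 e unit / D 0 e0 unit else 0"]) auto
    next
      case (Suc j)
      show ?thesis unfolding Suc
      proof (rule D_exact)
        fix x assume x: "x \<in> C (Suc j)" "D (Suc j) e x \<noteq> 0"
        have "dg (Suc j) x \<le> a" using D_le[of e "Suc j" x] x e Suc by (simp add: a_def)
        moreover have "dg (Suc j) x v < a v" using less.IH[of j x] x e Suc by (simp add: a_def)
        ultimately show "dg (Suc j) x \<le> dec v a" by (auto simp: le_fun_def dec_apply)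
      next
        show "(\<Sum>x\<in>C (Suc j). D (Suc j) e x * D j x y) = 0" if "y \<in> C j" for y
          using DD that e Suc by auto
      qed
    qed
    then obtain c where c: "\<And>x. x \<in> C (Suc i) \<Longrightarrow> c x \<noteq> 0 \<Longrightarrow> dg (Suc i) x \<le> dec v a"
      "\<And>e'. e' \<in> C i \<Longrightarrow> D i e e' = (\<Sum>x\<in>C (Suc i). c x * D i x e')" by blast
    have "c e = 0" using c(1)[OF e(1)] le_funD[of "dg (Suc i) e" "dec v a" v]
      by (auto simp: a_def dec_apply)
    let ?c = "\<lambda>x. (if x = e then 1 else 0) - c x"
    have "(\<Sum>x\<in>C (Suc i). ?c x * D i x e') = 0" if e': "e' \<in> C i" for e'
    proof -
      have "(\<Sum>x\<in>C (Suc i). ?c x * D i x e') =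
         (\<Sum>x\<in>C (Suc i). if x = e then D i e e' else 0) - (\<Sum>x\<in>C (Suc i). c x * D i x e')"
        unfolding sum_subtractf[symmetric] by (intro sum.cong) (auto simp: algebra_simps)
      then show ?thesis using c(2)[OF e'] e finite_C by simp
    qed
    moreover have "dg (Suc i) x \<le> a" if "x \<in> C (Suc i)" "?c x \<noteq> 0" for x
      using c(1)[OF that(1)] dec_le[of v a] that(2) by (cases "x = e") (auto simp: a_def)
    ultimately have "?c e = 0"
      using e by (intro cycle_top_degree_eq_0[of i ?c a e]) (auto simp: R_def a_def)
    then show False using \<open>c e = 0\<close> by simp
  qed
qed

lemma not_clean_variable:
  assumes "\<not> clean a" "1 \<le> total_degree a" "\<And>u. 0 \<le> a u"
  obtains e0 v where "e0 \<in> C (Suc 0)" "dg (Suc 0) e0 \<le> inc v (\<lambda>_. 0)" "1 \<le> a v"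
proof -
  obtain e0 where e0: "e0 \<in> C (Suc 0)" "dg (Suc 0) e0 \<le> a" "total_degree (dg (Suc 0) e0) < 2"
    using assms(1) by (auto simp: clean_def gens_def)
  let ?b = "dg (Suc 0) e0" and ?z = "\<lambda>_ :: 'n. 0 :: int"
  have z: "total_degree ?z = 0" by (simp add: total_degree_def)
  have ge: "?z \<le> ?b" using dg_nonneg[OF e0(1)] by (simp add: le_fun_def)
  show ?thesis
  proof (cases "total_degree ?b = 1")
    case True
    then obtain v where "?z = dec v ?b" using eq_dec[OF ge] z by auto
    then have b: "?b = inc v ?z" using dec_eq_iff by metis
    moreover have "1 \<le> a v" using le_funD[OF e0(2), of v] b by (simp add: inc_apply)
    ultimately show ?thesis using that[OF e0(1), of v] by simp
  \<comment> \<open>The remaining generator is 1, the case of the unit ideal; then every variable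
    lies in the ideal and any \<open>v\<close> in the support of \<open>a\<close> will do.\<close>
  next
    case False
    have "?b = ?z"
    proof (rule ccontr)
      assume "?b \<noteq> ?z"
      then have "total_degree ?z < total_degree ?b" by (intro total_degree_strict_mono[OF ge]) simp
      then show False using z e0(3) False by simp
    qed
    have "\<exists>v. 1 \<le> a v"
    proof (rule ccontr)
      assume "\<not> (\<exists>v. 1 \<le> a v)"
      then have "a v \<le> 0" for v by (metis int_one_le_iff_zero_less not_le)
      then have "total_degree a \<le> 0" unfolding total_degree_def by (intro sum_nonpos) simp
      then show False using assms(2) by simp
    qed
    then obtain v where "1 \<le> a v" by blast
    then show ?thesis using that[OF e0(1)] \<open>?b = ?z\<close> inc_ge by metis
  qed
qed

lemma regular_if_empty: "R (Suc n) a = {} \<Longrightarrow> regular n a"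
  unfolding regular_def coord_def by simp

text \<open>If the variable \<open>v\<close> lies in the ideal, multiplication by \<open>v\<close> is null-homotopic on the resolution
  of the cyclic module; the linear part of the homotopy inverts the \<open>v\<close>-component of the differential.\<close>

lemma regular_step_variable:
  assumes e0: "e0 \<in> C (Suc 0)" "dg (Suc 0) e0 \<le> inc v (\<lambda>_. 0)" and v: "1 \<le> a v"
    and a: "total_degree a = int n + 3" and IH: "regular n (dec v a)"
  shows "regular (Suc n) a"
proof (cases "R (Suc (Suc n)) a = {}")
  case False
  let ?S = "R (Suc (Suc n)) a" and ?T = "R (Suc n) (dec v a)"
  have "a v \<le> 1" using False dg_le_1_of_variable[OF e0, of _ "Suc n"] by (auto simp: R_def)
  then have av: "a v = 1" using v by simp
  obtain K :: "nat \<Rightarrow> 'e \<Rightarrow> 'e \<Rightarrow> 'k" where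
    K_le: "\<And>i e e'. e \<in> C i \<Longrightarrow> e' \<in> C (Suc i) \<Longrightarrow> K i e e' \<noteq> 0 \<Longrightarrow> dg (Suc i) e' \<le> inc v (dg i e)" and
    K: "\<And>i e e'. e \<in> C (Suc i) \<Longrightarrow> e' \<in> C (Suc i) \<Longrightarrow>
       (\<Sum>x\<in>C (Suc (Suc i)). K (Suc i) e x * D (Suc i) x e') =
       (if e = e' then 1 else 0) - (\<Sum>x\<in>C i. D i e x * K i x e')"
    by (rule exists_homotopy[OF e0]) blast
  \<comment> \<open>The other half of the homotopy identity would pass through an element of degree
    \<open>inc v a\<close>, whose exponent of \<open>v\<close> would be 2.\<close>
  have DK: "(\<Sum>x\<in>?T. D (Suc n) e x * K (Suc n) x e') = (if e = e' then 1 else 0)"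
    if e: "e \<in> ?S" "e' \<in> ?S" for e e'
  proof -
    have c: "e \<in> C (Suc (Suc n))" "e' \<in> C (Suc (Suc n))" "dg (Suc (Suc n)) e = a" "dg (Suc (Suc n)) e' = a"
      using e by (auto simp: R_def)
    have "K (Suc (Suc n)) e x * D (Suc (Suc n)) x e' = 0" if x: "x \<in> C (Suc (Suc (Suc n)))" for x
    proof (rule ccontr)
      assume "\<not> ?thesis"
      then have "dg (Suc (Suc (Suc n))) x \<le> inc v a" "a \<le> dg (Suc (Suc (Suc n))) x"
        "a \<noteq> dg (Suc (Suc (Suc n))) x"
        using K_le[OF c(1) x] D_le[OF x c(2)] D_minimal[OF x c(2)] c by auto
      then have "a = dec v (dg (Suc (Suc (Suc n))) x)" using le_inc_cases by metis
      then have "dg (Suc (Suc (Suc n))) x v = 2" using av by (metis dec_apply add.commute diff_eq_eq one_add_one)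
      then show False using dg_le_1_of_variable[OF e0 x] by simp
    qed
    then have "(\<Sum>x\<in>C (Suc n). D (Suc n) e x * K (Suc n) x e') = (if e = e' then 1 else 0)"
      using K[OF c(1,2)] by (simp add: sum.neutral)
    moreover have "D (Suc n) e x * K (Suc n) x e' = 0" if x: "x \<in> C (Suc n) - ?T" for x
    proof (rule ccontr)
      assume "\<not> ?thesis"
      then have "dg (Suc n) x \<le> a" "dg (Suc n) x \<noteq> a" "a \<le> inc v (dg (Suc n) x)"
        using K_le[of x "Suc n" e'] D_le[of e "Suc n" x] D_minimal[of e n x] c x by auto
      then show False using le_inc_cases[of "dg (Suc n) x" a v] x by (auto simp: R_def)
    qed
    then have "(\<Sum>x\<in>?T. D (Suc n) e x * K (Suc n) x e') = (\<Sum>x\<in>C (Suc n). D (Suc n) e x * K (Suc n) x e')"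
      using finite_C by (intro sum.mono_neutral_left) (auto simp: R_def)
    ultimately show ?thesis by simp
  qed
  \<comment> \<open>Here the other half would pass through degree \<open>dec v (dec v a)\<close>,
    where the exponent of \<open>v\<close> is negative, or through \<open>dec v a\<close>, which
    minimality excludes; for \<open>n = 0\<close> the total degree excludes it.\<close>
  have KD: "(\<Sum>e\<in>?S. K (Suc n) x e * D (Suc n) e x') = (if x = x' then 1 else 0)"
    if x: "x \<in> ?T" "x' \<in> ?T" for x x'
  proof -
    have c: "x \<in> C (Suc n)" "x' \<in> C (Suc n)" "dg (Suc n) x = dec v a" "dg (Suc n) x' = dec v a"
      using x by (auto simp: R_def)
    have "D n x y * K n y x' = 0" if y: "y \<in> C n" for y
    proof (rule ccontr)
      assume nz: "\<not> ?thesis"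
      then have le: "dg n y \<le> dec v a" "dec v a \<le> inc v (dg n y)"
        using K_le[OF y c(2)] D_le[OF c(1) y] c by auto
      have "dg n y v \<noteq> dec v (dec v a) v" using av dg_nonneg[OF y, of v] by (simp add: dec_apply)
      then have eq: "dg n y = dec v a" using le_inc_cases[OF le] by metis
      show False
      proof (cases n)
        case 0
        then have "dec v a = (\<lambda>_. 0)" using eq y C_0 dg_0 by simp
        then have "total_degree (dec v a) = 0" by (simp add: total_degree_def)
        then show False using a by simp
      next
        case (Suc m)
        then show False using D_minimal[of x m y] nz c y eq by auto
      qed
    qed
    then have "(\<Sum>e\<in>C (Suc (Suc n)). K (Suc n) x e * D (Suc n) e x') = (if x = x' then 1 else 0)"
      using K[OF c(1,2)] by (simp add: sum.neutral)
    moreover have "K (Suc n) x e * D (Suc n) e x' = 0" if e: "e \<in> C (Suc (Suc n)) - ?S" for e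
    proof (rule ccontr)
      assume "\<not> ?thesis"
      then have "dg (Suc (Suc n)) e \<le> inc v (dec v a)" "dec v a \<le> dg (Suc (Suc n)) e"
        "dec v a \<noteq> dg (Suc (Suc n)) e"
        using K_le[of x "Suc n" e] D_le[of e "Suc n" x'] D_minimal[of e n x'] c e by auto
      then have "dec v a = dec v (dg (Suc (Suc n)) e)" using le_inc_cases by metis
      then have "dg (Suc (Suc n)) e = a" using dec_eq_iff by metis
      then show False using e by (simp add: R_def)
    qed
    then have "(\<Sum>e\<in>?S. K (Suc n) x e * D (Suc n) e x') =
        (\<Sum>e\<in>C (Suc (Suc n)). K (Suc n) x e * D (Suc n) e x')"
      using finite_C by (intro sum.mono_neutral_left) (auto simp: R_def)
    ultimately show ?thesis by simp
  qed
  have coord_v: "coord (Suc n) a c (v # t) = coord n (dec v a) (push n a c) t" if "length t = n" for c t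
    using that by (rule coord_Cons)
  \<comment> \<open>Otherwise the generator reached along \<open>t\<close> has exponent 1 at
    \<open>v\<close>, so it is a multiple of \<open>e0\<close> and equals \<open>e0\<close>. Its
    total degree would then be at most 1, whereas removing \<open>n + 1\<close> variables from total
    degree \<open>n + 3\<close> leaves 2.\<close>
  have mem: "v \<in> set t" if t: "length t = Suc n" "coord (Suc n) a c t \<noteq> 0" for c t
  proof (rule ccontr)
    assume "v \<notin> set t"
    then have "dec_list t a v = 1" using av by (simp add: dec_list_apply count_list_0_iff)
    obtain e1 where e1: "e1 \<in> C (Suc 0)" "dg (Suc 0) e1 = dec_list t a"
      using coord_nonzero(1)[OF t(2,1)] by (auto simp: gens_def)
    then have "inc v (\<lambda>_. 0) \<le> dg (Suc 0) e1"
      using dg_nonneg[OF e1(1)] \<open>dec_list t a v = 1\<close> by (simp add: le_fun_def inc_apply)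
    then have "e0 = e1" using generators_antichain[OF e1(1) e0(1)] e0(2) by auto
    then have "total_degree (dec_list t a) \<le> 1"
      using total_degree_mono[OF e0(2)] e1 by (simp add: total_degree_inc) (simp add: total_degree_def)
    then show False using a t by (simp add: total_degree_dec_list)
  qed
  \<comment> \<open>The rearranged list serves all vectors at once; only the choice between the two
    signs is made for each \<open>c\<close> separately, which is harmless.\<close>
  have perm: "\<exists>t'. length t' = n \<and> (\<forall>c. coord (Suc n) a c t = coord (Suc n) a c (v # t') \<or>
      coord (Suc n) a c t = - coord (Suc n) a c (v # t'))" if "length t = Suc n" "v \<in> set t" for t
  proof (intro exI[of _ "remove1 v t"] conjI allI)
    show l: "length (remove1 v t) = n" using that by (simp add: length_remove1)
    show "coord (Suc n) a c t = coord (Suc n) a c (v # remove1 v t) \<or>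
      coord (Suc n) a c t = - coord (Suc n) a c (v # remove1 v t)" for c
      using alternating_mset_eq[of "v # remove1 v t" "coord (Suc n) a c" t] alternating_coord that l by simp
  qed
  show ?thesis
    unfolding regular_def
  proof (intro conjI allI impI)
    fix c assume c: "\<forall>t. length t = Suc n \<longrightarrow> coord (Suc n) a c t = 0"
    then have "coord n (dec v a) (push n a c) t = 0" if "length t = n" for t
      using coord_v[OF that, of c] that by simp
    then have z: "push n a c x = 0" if "x \<in> ?T" for x
      using IH that unfolding regular_def by blast
    show "\<forall>e\<in>?S. c e = 0"
    proof
      fix e' assume e': "e' \<in> ?S"
      have "0 = (\<Sum>x\<in>?T. push n a c x * K (Suc n) x e')" using z by simp
      also have "\<dots> = (\<Sum>x\<in>?T. \<Sum>e\<in>?S. c e * (D (Suc n) e x * K (Suc n) x e'))"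
        unfolding push_def by (simp add: sum_distrib_right mult.assoc)
      also have "\<dots> = (\<Sum>e\<in>?S. c e * (\<Sum>x\<in>?T. D (Suc n) e x * K (Suc n) x e'))"
        unfolding sum_distrib_left by (rule sum.swap)
      also have "\<dots> = (\<Sum>e\<in>?S. if e = e' then c e else 0)"
        using DK e' by (intro sum.cong) auto
      also have "\<dots> = c e'" using e' finite_R by simp
      finally show "c e' = 0" by simp
    qed
  next
    fix c t0 assume t0: "length t0 = Suc n" "coord (Suc n) a c t0 \<noteq> 0"
    obtain t1 where t1: "length t1 = n" "\<And>c. coord (Suc n) a c t0 = coord (Suc n) a c (v # t1) \<or>
      coord (Suc n) a c t0 = - coord (Suc n) a c (v # t1)"
      using perm[OF t0(1) mem[OF t0]] by blast
    have "coord n (dec v a) (push n a c) t1 \<noteq> 0" using t0(2) t1(2)[of c] coord_v[OF t1(1), of c] by auto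
    then obtain c1 where c1: "coord n (dec v a) c1 t1 \<noteq> 0"
      "\<And>t. length t = n \<Longrightarrow> coord n (dec v a) c1 t \<in> {-1, 0, 1} \<and>
          (coord n (dec v a) (push n a c) t = 0 \<longrightarrow> coord n (dec v a) c1 t = 0)"
      using IH t1(1) unfolding regular_def by blast
    \<comment> \<open>The homotopy inverts \<open>push\<close> between the degrees \<open>a\<close>
      and \<open>dec v a\<close>, so it carries the signed vector \<open>c1\<close> back up.\<close>
    define c' where "c' e = (\<Sum>x\<in>?T. c1 x * K (Suc n) x e)" for e
    have "push n a c' x' = c1 x'" if x': "x' \<in> ?T" for x'
    proof -
      have "push n a c' x' = (\<Sum>e\<in>?S. \<Sum>x\<in>?T. c1 x * (K (Suc n) x e * D (Suc n) e x'))"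
        unfolding push_def c'_def by (simp add: sum_distrib_right mult.assoc)
      also have "\<dots> = (\<Sum>x\<in>?T. c1 x * (\<Sum>e\<in>?S. K (Suc n) x e * D (Suc n) e x'))"
        unfolding sum_distrib_left by (rule sum.swap)
      also have "\<dots> = (\<Sum>x\<in>?T. if x = x' then c1 x else 0)"
        using KD x' by (intro sum.cong) auto
      also have "\<dots> = c1 x'" using x' finite_R by simp
      finally show ?thesis .
    qed
    then have c'_v: "coord (Suc n) a c' (v # t) = coord n (dec v a) c1 t" if "length t = n" for t
      unfolding coord_v[OF that] unfolding coord_def by (intro sum.cong) auto
    show "\<exists>c'. coord (Suc n) a c' t0 \<noteq> 0 \<and>
           (\<forall>t. length t = Suc n \<longrightarrow> coord (Suc n) a c' t \<in> {-1, 0, 1} \<and>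
              (coord (Suc n) a c t = 0 \<longrightarrow> coord (Suc n) a c' t = 0))"
    proof (intro exI[of _ c'] conjI allI impI)
      show "coord (Suc n) a c' t0 \<noteq> 0"
        using t1(2)[of c'] c1(1) c'_v[OF t1(1)] by auto
    next
      fix t :: "'n list" assume t: "length t = Suc n"
      show "coord (Suc n) a c' t \<in> {-1, 0, 1}"
      proof (cases "v \<in> set t")
        case True
        then obtain t' where "length t' = n" "coord (Suc n) a c' t = coord (Suc n) a c' (v # t') \<or>
          coord (Suc n) a c' t = - coord (Suc n) a c' (v # t')" using perm[OF t] by blast
        then show ?thesis using c'_v[of t'] c1(2)[of t'] by auto
      next
        case False
        then show ?thesis using mem[OF t] by auto
      qed
      assume z: "coord (Suc n) a c t = 0"
      show "coord (Suc n) a c' t = 0"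
      proof (cases "v \<in> set t")
        case True
        then obtain t' where t': "length t' = n" "\<And>c. coord (Suc n) a c t = coord (Suc n) a c (v # t') \<or>
          coord (Suc n) a c t = - coord (Suc n) a c (v # t')" using perm[OF t] by blast
        then have "coord n (dec v a) (push n a c) t' = 0"
          using z t'(2)[of c] coord_v[OF t'(1), of c] by auto
        then show ?thesis using c'_v[OF t'(1)] c1(2)[OF t'(1)] t'(2)[of c'] by auto
      next
        case False
        then show ?thesis using mem[OF t] by auto
      qed
    qed
  qed
qed (rule regular_if_empty)

text \<open>Variables of the ideal are removed from the degree one at a time, each removal lowering
  \<open>n\<close>. At \<open>n = 0\<close> none can occur: a generator of total degree 2 would be a
  multiple of a generator of smaller degree.\<close>

theorem regular_linear_strand:
  "total_degree a = int n + 2 \<Longrightarrow> regular n a"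
proof (induction n arbitrary: a)
  case 0
  show ?case
  proof (cases "clean a \<or> R (Suc 0) a = {}")
    case False
    then obtain e where e: "e \<in> C (Suc 0)" "dg (Suc 0) e = a" by (auto simp: R_def)
    then obtain e0 v where e0: "e0 \<in> C (Suc 0)" "dg (Suc 0) e0 \<le> inc v (\<lambda>_. 0)" "1 \<le> a v"
      using not_clean_variable[of a] False 0 dg_nonneg[OF e(1)] by auto
    then have "inc v (\<lambda>_. 0) \<le> a"
      using dg_nonneg[OF e(1)] e by (auto simp: le_fun_def inc_apply)
    then have "e0 = e" using generators_antichain[OF e(1) e0(1)] e e0 by auto
    then have "total_degree a \<le> 1"
      using total_degree_mono[OF e0(2)] e by (simp add: total_degree_inc) (simp add: total_degree_def)
    then show ?thesis using 0 by simp
  qed (use 0 clean_regular regular_if_empty in auto)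
next
  case (Suc n)
  show ?case
  proof (cases "clean a \<or> R (Suc (Suc n)) a = {}")
    case False
    then obtain e where e: "e \<in> C (Suc (Suc n))" "dg (Suc (Suc n)) e = a" by (auto simp: R_def)
    then obtain e0 v where "e0 \<in> C (Suc 0)" "dg (Suc 0) e0 \<le> inc v (\<lambda>_. 0)" "1 \<le> a v"
      using not_clean_variable[of a] False Suc.prems dg_nonneg[OF e(1)] by auto
    then show ?thesis using Suc.prems Suc.IH[of "dec v a"] by (intro regular_step_variable) auto
  next
    case True
    then show ?thesis
    proof
      assume "clean a"
      then show ?thesis using Suc.prems by (intro clean_regular) simp_all
    qed (rule regular_if_empty)
  qed
qed

end

section \<open>A basis change with signed entries\<close>

context monomial_complex
begin

text \<open>\<open>P i\<close> expresses a new homogeneous basis, indexed by \<open>J i\<close> with degrees \<open>\<delta> i\<close>, in terms of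
  \<open>C (Suc i)\<close>, and \<open>Q i\<close> is the inverse matrix.\<close>

lemma exists_signed_basis_change:
  obtains J :: "nat \<Rightarrow> ('e + ('n \<Rightarrow> int) \<times> 'n list) set"
    and \<delta> :: "nat \<Rightarrow> ('e + ('n \<Rightarrow> int) \<times> 'n list) \<Rightarrow> 'n \<Rightarrow> int"
    and P :: "nat \<Rightarrow> ('e + ('n \<Rightarrow> int) \<times> 'n list) \<Rightarrow> 'e \<Rightarrow> 'k"
    and Q :: "nat \<Rightarrow> 'e \<Rightarrow> ('e + ('n \<Rightarrow> int) \<times> 'n list) \<Rightarrow> 'k"
  where "\<And>i. finite (J i)"
    and "\<And>i e e'. e \<in> C (Suc i) \<Longrightarrow> e' \<in> C (Suc i) \<Longrightarrow> (\<Sum>j\<in>J i. Q i e j * P i j e') = (if e = e' then 1 else 0)"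
    and "\<And>i j j'. j \<in> J i \<Longrightarrow> j' \<in> J i \<Longrightarrow> (\<Sum>e\<in>C (Suc i). P i j e * Q i e j') = (if j = j' then 1 else 0)"
    and "\<And>i j e. j \<in> J i \<Longrightarrow> e \<in> C (Suc i) \<Longrightarrow> P i j e \<noteq> 0 \<Longrightarrow> dg (Suc i) e = \<delta> i j"
    and "\<And>i j e. j \<in> J i \<Longrightarrow> e \<in> C (Suc i) \<Longrightarrow> Q i e j \<noteq> 0 \<Longrightarrow> dg (Suc i) e = \<delta> i j"
    and "\<And>i j j'. j \<in> J (Suc i) \<Longrightarrow> j' \<in> J i \<Longrightarrow> total_degree (\<delta> (Suc i) j) = int i + 3 \<Longrightarrow>
           total_degree (\<delta> i j') = int i + 2 \<Longrightarrow>
           (\<Sum>e\<in>C (Suc (Suc i)). \<Sum>e'\<in>C (Suc i). P (Suc i) j e * D (Suc i) e e' * Q i e' j') \<in> {-1, 0, 1}"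
proof -
  define dual_basis where "dual_basis n a T b \<longleftrightarrow> T \<subseteq> {t. length t = n} \<and> finite T \<and>
    (\<forall>t\<in>T. \<forall>t'\<in>T. coord n a (b t) t' = (if t = t' then 1 else 0)) \<and>
    (\<forall>t\<in>T. \<forall>t'. length t' = n \<longrightarrow> coord n a (b t) t' \<in> {-1, 0, 1}) \<and>
    (\<forall>c. (\<forall>t\<in>T. coord n a c t = 0) \<longrightarrow> (\<forall>e\<in>R (Suc n) a. c e = 0))" for n a T b
  have ex: "\<exists>T b. dual_basis n a T b" if "total_degree a = int n + 2" for n a
  proof -
    have g: "regular n a" using that by (rule regular_linear_strand)
    obtain T and b :: "'n list \<Rightarrow> 'e \<Rightarrow> 'k" where "T \<subseteq> {t. length t = n}" "finite T"
      "\<And>t t'. t \<in> T \<Longrightarrow> t' \<in> T \<Longrightarrow> coord n a (b t) t' = (if t = t' then 1 else 0)"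
      "\<And>t t'. t \<in> T \<Longrightarrow> length t' = n \<Longrightarrow> coord n a (b t) t' \<in> {-1, 0, 1}"
      "\<And>c e. (\<And>t. t \<in> T \<Longrightarrow> coord n a c t = 0) \<Longrightarrow> e \<in> R (Suc n) a \<Longrightarrow> c e = 0"
      by (rule regular_dual_basis[OF g]) blast
    then show ?thesis unfolding dual_basis_def by (intro exI[of _ T] exI[of _ b]) blast
  qed
  define T where "T n a = (SOME T. \<exists>b. dual_basis n a T b)" for n a
  define b where "b n a = (SOME b. dual_basis n a (T n a) b)" for n a
  have Tb: "dual_basis n a (T n a) (b n a)" if "total_degree a = int n + 2" for n a
  proof -
    have "\<exists>b. dual_basis n a (T n a) b" unfolding T_def using ex[OF that] by (rule someI_ex)
    then show ?thesis unfolding b_def by (rule someI_ex)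
  qed
  note Tb' = Tb[unfolded dual_basis_def]
  have T_length: "length t = n" if "total_degree a = int n + 2" "t \<in> T n a" for n a t
    using Tb'[OF that(1)] that(2) by blast
  have T_finite: "finite (T n a)" if "total_degree a = int n + 2" for n a
    using Tb'[OF that(1)] by blast
  have b_dual: "coord n a (b n a t) t' = (if t = t' then 1 else 0)"
    if "total_degree a = int n + 2" "t \<in> T n a" "t' \<in> T n a" for n a t t'
    using Tb'[OF that(1)] that by blast
  have b_signed: "coord n a (b n a t) t' \<in> {-1, 0, 1}"
    if "total_degree a = int n + 2" "t \<in> T n a" "length t' = n" for n a t t'
    using Tb'[OF that(1)] that by blast
  have T_inj: "c e = 0"
    if "total_degree a = int n + 2" "\<And>t. t \<in> T n a \<Longrightarrow> coord n a c t = 0" "e \<in> R (Suc n) a" for n a c e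
    using Tb'[OF that(1)] that by blast

  \<comment> \<open>Only the degrees of the strand get a new basis; the elements of
    \<open>X i\<close> are kept. In \<open>J i\<close> the left summand labels kept elements, the
    right one a degree together with a list of its dual basis.\<close>
  define A where "A i = {a \<in> dg (Suc i) ` C (Suc i). total_degree a = int i + 2}" for i
  define X where "X i = {e \<in> C (Suc i). total_degree (dg (Suc i) e) \<noteq> int i + 2}" for i
  define J where "J i = X i <+> (SIGMA a:A i. T i a)" for i
  define \<delta> where "\<delta> i j = (case j of Inl e \<Rightarrow> dg (Suc i) e | Inr x \<Rightarrow> fst x)"
    for i and j :: "'e + ('n \<Rightarrow> int) \<times> 'n list"
  define P where "P i j e' = (case j of Inl e \<Rightarrow> if e = e' then 1 else 0
     | Inr x \<Rightarrow> if dg (Suc i) e' = fst x then b i (fst x) (snd x) e' else 0)" for i j e'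
  \<comment> \<open>The coefficient of \<open>e\<close> at the member of the dual basis belonging to
    a list is the coordinate of \<open>e\<close> at that list, so the inverse matrix consists of
    values of \<open>L\<close>.\<close>
  define Q where "Q i e j = (case j of Inl e' \<Rightarrow> if e = e' then 1 else 0
     | Inr x \<Rightarrow> if dg (Suc i) e = fst x then L (snd x) e else 0)" for i e j
  have finA: "finite (A i)" "finite (X i)" for i using finite_C by (auto simp: A_def X_def)
  have A_deg: "total_degree a = int i + 2" if "a \<in> A i" for a i using that by (simp add: A_def)
  have finS: "finite (SIGMA a:A i. T i a)" for i using finA T_finite A_deg by auto
  have sum_row: "(\<Sum>e\<in>C (Suc i). if dg (Suc i) e = a then f e else 0) = (\<Sum>e\<in>R (Suc i) a. f e)"
    for i a and f :: "'e \<Rightarrow> 'k"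
    unfolding R_def using finite_C by (simp add: sum.inter_filter)
  show ?thesis
  proof (rule that[of J Q P \<delta>])
    show "finite (J i)" for i unfolding J_def using finA finS by (intro finite_Plus)
  next
    fix i e e' assume e: "e \<in> C (Suc i)" "e' \<in> C (Suc i)"
    have "(\<Sum>j\<in>J i. Q i e j * P i j e') = (\<Sum>x\<in>X i. (if e = x then 1 else 0) * (if x = e' then 1 else 0)) +
        (\<Sum>x\<in>(SIGMA a:A i. T i a). Q i e (Inr x) * P i (Inr x) e')"
      unfolding J_def using finA finS by (subst sum.Plus) (auto simp: Q_def P_def)
    also have "(\<Sum>x\<in>X i. (if e = x then 1 else 0) * (if x = e' then 1 else 0)) =
        (\<Sum>x\<in>X i. if e = x then (if e = e' then 1 else 0 :: 'k) else 0)"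
      by (intro sum.cong) auto
    also have "\<dots> = (if e \<in> X i \<and> e = e' then 1 else 0)" using finA by auto
    also have "(\<Sum>x\<in>(SIGMA a:A i. T i a). Q i e (Inr x) * P i (Inr x) e') =
        (\<Sum>a\<in>A i. \<Sum>t\<in>T i a. Q i e (Inr (a, t)) * P i (Inr (a, t)) e')"
      using finA T_finite A_deg by (subst sum.Sigma) auto
    also have "\<dots> = (\<Sum>a\<in>A i. if a = dg (Suc i) e then
        (if dg (Suc i) e' = a then (\<Sum>t\<in>T i a. L t e * b i a t e') else 0) else 0)"
      by (intro sum.cong refl) (auto simp: Q_def P_def)
    also have "\<dots> = (if e \<notin> X i \<and> e = e' then 1 else 0)"
    proof (cases "e \<in> X i")
      case True
      then show ?thesis by (intro trans[OF sum.neutral]) (auto simp: X_def A_def)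
    next
      case False
      define a where "a = dg (Suc i) e"
      have aA: "a \<in> A i" using False e by (auto simp: X_def A_def a_def)
      \<comment> \<open>The difference between \<open>e\<close> and its expansion in the dual basis
        has zero coordinates on \<open>T i a\<close>, hence vanishes. No dimension count is
        involved.\<close>
      let ?c = "\<lambda>x. (if x = e then 1 else 0) - (\<Sum>t\<in>T i a. L t e * b i a t x)"
      have eR: "e \<in> R (Suc i) a" using e by (simp add: R_def a_def)
      have "coord i a ?c t' = 0" if t': "t' \<in> T i a" for t'
      proof -
        have "coord i a ?c t' = (\<Sum>x\<in>R (Suc i) a. if x = e then L t' e else 0) -
            (\<Sum>x\<in>R (Suc i) a. \<Sum>t\<in>T i a. L t e * (b i a t x * L t' x))"
          unfolding coord_def sum_subtractf[symmetric]
          by (intro sum.cong) (auto simp: left_diff_distrib sum_distrib_right mult.assoc)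
        also have "(\<Sum>x\<in>R (Suc i) a. \<Sum>t\<in>T i a. L t e * (b i a t x * L t' x)) =
            (\<Sum>t\<in>T i a. L t e * coord i a (b i a t) t')"
          unfolding coord_def sum_distrib_left by (rule sum.swap)
        also have "\<dots> = (\<Sum>t\<in>T i a. if t = t' then L t e else 0)"
          using b_dual[OF A_deg[OF aA] _ t'] by (intro sum.cong) auto
        finally show ?thesis using eR t' finite_R T_finite[OF A_deg[OF aA]] by simp
      qed
      then have c0: "?c x = 0" if "x \<in> R (Suc i) a" for x
        using T_inj[OF A_deg[OF aA], of ?c x] that by blast
      have "(\<Sum>t\<in>T i a. L t e * b i a t e') = (if e = e' then 1 else 0)" if "dg (Suc i) e' = a"
        using c0[of e'] that e by (auto simp: R_def)
      moreover have "dg (Suc i) e' \<noteq> a \<Longrightarrow> e \<noteq> e'" by (auto simp: a_def)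
      ultimately have "(if dg (Suc i) e' = a then (\<Sum>t\<in>T i a. L t e * b i a t e') else 0) = (if e = e' then 1 else 0)"
        by presburger
      then show ?thesis
        unfolding a_def[symmetric] sum.delta[OF finA(1)] using False aA by simp
    qed
    finally show "(\<Sum>j\<in>J i. Q i e j * P i j e') = (if e = e' then 1 else 0)" by auto
  next
    fix i j j' assume j: "j \<in> J i" "j' \<in> J i"
    have neq: "dg (Suc i) e \<noteq> a" if "e \<in> X i" "a \<in> A i" for e a
      using that by (auto simp: X_def A_def)
    have single: "(\<Sum>e\<in>C (Suc i). (if x = e then 1 else 0) * f e) = f x" if "x \<in> X i" for x and f :: "'e \<Rightarrow> 'k"
    proof -
      have "(\<Sum>e\<in>C (Suc i). (if x = e then 1 else 0) * f e) = (\<Sum>e\<in>C (Suc i). if x = e then f x else 0)"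
        by (intro sum.cong) auto
      then show ?thesis using that finite_C by (simp add: X_def)
    qed
    show "(\<Sum>e\<in>C (Suc i). P i j e * Q i e j') = (if j = j' then 1 else 0)"
    proof (cases j)
      case (Inl x)
      then have x: "x \<in> X i" using j by (auto simp: J_def)
      have "(\<Sum>e\<in>C (Suc i). P i j e * Q i e j') = Q i x j'"
        using single[OF x, of "\<lambda>e. Q i e j'"] by (simp add: P_def Inl)
      moreover have "dg (Suc i) x \<notin> A i" using neq[OF x] by blast
      ultimately show ?thesis using Inl j by (cases j') (auto simp: Q_def J_def)
    next
      case (Inr y)
      then obtain a t where at: "y = (a, t)" "a \<in> A i" "t \<in> T i a" using j by (auto simp: J_def)
      show ?thesis
      proof (cases j')
        case (Inl x)
        then have x: "x \<in> X i" using j by (auto simp: J_def)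
        have "(\<Sum>e\<in>C (Suc i). P i j e * Q i e j') = (\<Sum>e\<in>C (Suc i). (if x = e then 1 else 0) * P i j e)"
          using Inl by (intro sum.cong) (auto simp: Q_def)
        also have "\<dots> = P i j x" by (rule single[OF x])
        finally show ?thesis using neq[OF x at(2)] Inl \<open>j = Inr y\<close> at by (simp add: P_def)
      next
        case (Inr y')
        then obtain a' t' where at': "y' = (a', t')" "a' \<in> A i" "t' \<in> T i a'" using j by (auto simp: J_def)
        have "(\<Sum>e\<in>C (Suc i). P i j e * Q i e j') =
            (\<Sum>e\<in>C (Suc i). if dg (Suc i) e = a then (if a = a' then b i a t e * L t' e else 0) else 0)"
          using Inr \<open>j = Inr y\<close> at at' by (intro sum.cong) (auto simp: P_def Q_def)
        also have "\<dots> = (if a = a' then coord i a (b i a t) t' else 0)"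
          unfolding sum_row coord_def by simp
        also have "\<dots> = (if j = j' then 1 else 0)"
          using b_dual[OF A_deg[OF at(2)] at(3)] at at' Inr \<open>j = Inr y\<close> by auto
        finally show ?thesis .
      qed
    qed
  next
    show "dg (Suc i) e = \<delta> i j" if "j \<in> J i" "e \<in> C (Suc i)" "P i j e \<noteq> 0" for i j e
      using that by (auto simp: P_def \<delta>_def split: sum.splits if_splits)
    show "dg (Suc i) e = \<delta> i j" if "j \<in> J i" "e \<in> C (Suc i)" "Q i e j \<noteq> 0" for i j e
      using that by (auto simp: Q_def \<delta>_def split: sum.splits if_splits)
  next
    fix i j j' assume j: "j \<in> J (Suc i)" "j' \<in> J i" "total_degree (\<delta> (Suc i) j) = int i + 3"
      "total_degree (\<delta> i j') = int i + 2"
    obtain a t where at: "j = Inr (a, t)" "a \<in> A (Suc i)" "t \<in> T (Suc i) a"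
      using j by (auto simp: J_def X_def \<delta>_def)
    obtain a' t' where at': "j' = Inr (a', t')" "a' \<in> A i" "t' \<in> T i a'"
      using j by (auto simp: J_def X_def \<delta>_def)
    have lt': "length t' = i" using T_length[OF A_deg] at' by blast
    let ?S = "\<Sum>e\<in>C (Suc (Suc i)). \<Sum>e'\<in>C (Suc i). P (Suc i) j e * D (Suc i) e e' * Q i e' j'"
    show "?S \<in> {-1, 0, 1}"
    proof (cases "\<exists>u. a' = dec u a")
      case True
      then obtain u where u: "a' = dec u a" by blast
      \<comment> \<open>The columns of \<open>Q\<close> evaluate \<open>L t'\<close> on the
        differential of \<open>e\<close>, which is \<open>L (u # t') e\<close> by definition. The
        entry thus is one coordinate of a signed basis vector of the source.\<close>
      have "?S = (\<Sum>e\<in>C (Suc (Suc i)). if dg (Suc (Suc i)) e = a then b (Suc i) a t e * L (u # t') e else 0)"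
      proof (intro sum.cong refl)
        fix e assume "e \<in> C (Suc (Suc i))"
        have "(\<Sum>e'\<in>C (Suc i). P (Suc i) j e * D (Suc i) e e' * Q i e' j') =
            (\<Sum>e'\<in>C (Suc i). if dg (Suc i) e' = a' then P (Suc i) j e * D (Suc i) e e' * L t' e' else 0)"
          using at' by (intro sum.cong) (auto simp: Q_def)
        also have "\<dots> = P (Suc i) j e * (\<Sum>e'\<in>R (Suc i) a'. D (Suc i) e e' * L t' e')"
          unfolding sum_row by (simp add: sum_distrib_left mult.assoc)
        finally show "(\<Sum>e'\<in>C (Suc i). P (Suc i) j e * D (Suc i) e e' * Q i e' j') =
            (if dg (Suc (Suc i)) e = a then b (Suc i) a t e * L (u # t') e else 0)"
          using lt' u at by (simp add: P_def)
      qed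
      also have "\<dots> = coord (Suc i) a (b (Suc i) a t) (u # t')"
        unfolding sum_row coord_def ..
      finally show ?thesis using b_signed[OF A_deg[OF at(2)] at(3), of "u # t'"] lt' by simp
    next
      case False
      have "P (Suc i) j e * D (Suc i) e e' * Q i e' j' = 0"
        if e: "e \<in> C (Suc (Suc i))" "e' \<in> C (Suc i)" for e e'
      proof (rule ccontr)
        assume "\<not> ?thesis"
        then have "dg (Suc (Suc i)) e = a" "dg (Suc i) e' = a'" "a' \<le> a"
          using D_le[OF e] at at' by (auto simp: P_def Q_def split: if_splits)
        then show False using eq_dec[of a' a] A_deg[OF at(2)] A_deg[OF at'(2)] False by auto
      qed
      then have "?S = 0" by (intro sum.neutral ballI) blast
      then show ?thesis by simp
    qed
  qed
qed

end

section \<open>Polynomials and bases of modules\<close>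

lemma sum_single_keys: "(\<Sum>m\<in>Poly_Mapping.keys p. Poly_Mapping.single m (Poly_Mapping.lookup p m)) = p"
proof (rule poly_mapping_eqI)
  fix k
  have "Poly_Mapping.lookup (\<Sum>m\<in>Poly_Mapping.keys p. Poly_Mapping.single m (Poly_Mapping.lookup p m)) k
      = (\<Sum>m\<in>Poly_Mapping.keys p. if m = k then Poly_Mapping.lookup p k else 0)"
    unfolding lookup_sum by (intro sum.cong) (auto simp: lookup_single when_def)
  also have "\<dots> = Poly_Mapping.lookup p k"
    by (simp add: in_keys_iff)
  finally show "Poly_Mapping.lookup (\<Sum>m\<in>Poly_Mapping.keys p. Poly_Mapping.single m (Poly_Mapping.lookup p m)) k
      = Poly_Mapping.lookup p k" .
qed

lemma mult_eq_sum_single: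
  fixes p q :: "('n, 'k::comm_ring_1) mpoly"
  shows "p * q = (\<Sum>m\<in>Poly_Mapping.keys p. \<Sum>m'\<in>Poly_Mapping.keys q.
     Poly_Mapping.single (m + m') (Poly_Mapping.lookup p m * Poly_Mapping.lookup q m'))"
proof -
  have "p * q = (\<Sum>m\<in>Poly_Mapping.keys p. Poly_Mapping.single m (Poly_Mapping.lookup p m)) *
      (\<Sum>m'\<in>Poly_Mapping.keys q. Poly_Mapping.single m' (Poly_Mapping.lookup q m'))"
    by (simp only: sum_single_keys)
  then show ?thesis by (simp only: sum_product mult_single)
qed

text \<open>Evaluation at \<open>(1, \<dots>, 1)\<close> is a ring homomorphism that is injective on each graded piece, so
  it reads off the coefficients of homogeneous matrices.\<close>

definition eval_one :: "('n, 'k::comm_ring_1) mpoly \<Rightarrow> 'k" where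
  "eval_one p = (\<Sum>m\<in>Poly_Mapping.keys p. Poly_Mapping.lookup p m)"

lemma eval_one_superset:
  "finite A \<Longrightarrow> Poly_Mapping.keys p \<subseteq> A \<Longrightarrow> eval_one p = (\<Sum>m\<in>A. Poly_Mapping.lookup p m)"
  unfolding eval_one_def by (intro sum.mono_neutral_left) (auto simp: in_keys_iff)

lemma eval_one_0 [simp]: "eval_one 0 = 0"
  by (simp add: eval_one_def)

lemma eval_one_single [simp]: "eval_one (Poly_Mapping.single m c) = c"
  by (subst eval_one_superset[of "{m}"]) auto

lemma eval_one_add: "eval_one (p + q) = eval_one p + eval_one q"
proof -
  let ?A = "Poly_Mapping.keys p \<union> Poly_Mapping.keys q"
  have "Poly_Mapping.keys (p + q) \<subseteq> ?A" by (rule Poly_Mapping.keys_add)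
  then show ?thesis
    by (simp add: eval_one_superset[of ?A] lookup_add sum.distrib)
qed

lemma eval_one_sum: "eval_one (\<Sum>x\<in>A. f x) = (\<Sum>x\<in>A. eval_one (f x))"
  by (induction A rule: infinite_finite_induct) (auto simp: eval_one_add)

lemma eval_one_mult: "eval_one (p * q) = eval_one p * eval_one q"
  unfolding mult_eq_sum_single[of p q] eval_one_sum eval_one_single
  by (simp add: eval_one_def sum_product)

lemma add_eq_0_exponent: "m + m' = (0 :: 'n \<Rightarrow>\<^sub>0 nat) \<Longrightarrow> m' = 0"
  by (rule poly_mapping_eqI) (metis add_is_0 lookup_add lookup_zero)

lemma lookup_0_mult:
  fixes p q :: "('n, 'k::comm_ring_1) mpoly"
  assumes "Poly_Mapping.lookup q 0 = 0"
  shows "Poly_Mapping.lookup (p * q) 0 = 0"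
  unfolding mult_eq_sum_single lookup_sum using assms add_eq_0_exponent
  by (intro sum.neutral ballI) (auto simp: lookup_single when_def)

lemma module_mult: "module ((*) :: ('n, 'k::comm_ring_1) mpoly \<Rightarrow> _ \<Rightarrow> _)"
  by unfold_locales (auto simp: algebra_simps)

lemma irrelevant_ideal_lookup_0:
  fixes p :: "('n, 'k::field) mpoly"
  assumes "p \<in> irrelevant_ideal"
  shows "Poly_Mapping.lookup p 0 = 0"
  using assms unfolding irrelevant_ideal_def
proof (induction rule: module.span_induct_alt[OF module_mult, consumes 1, case_names base step])
  case (step c x y)
  then obtain u where x: "x = var u" by blast
  have "Poly_Mapping.single u 1 \<noteq> (0 :: 'n \<Rightarrow>\<^sub>0 nat)" by (metis lookup_single_eq lookup_zero zero_neq_one)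
  then have "Poly_Mapping.lookup x 0 = 0" by (simp add: x var_def lookup_single_not_eq)
  then show ?case using step lookup_0_mult[of x c] by (simp add: lookup_add)
qed simp

text \<open>Negative exponents are truncated to 0, so this inverts \<open>mdeg\<close> only on
  nonnegative degrees.\<close>

definition expo :: "('n::finite \<Rightarrow> int) \<Rightarrow> 'n \<Rightarrow>\<^sub>0 nat" where
  "expo a = Abs_poly_mapping (\<lambda>u. nat (a u))"

lemma lookup_expo [simp]: "Poly_Mapping.lookup (expo a) u = nat (a u)"
  by (simp add: expo_def)

lemma mdeg_expo: "(\<And>u. 0 \<le> a u) \<Longrightarrow> mdeg (expo a) = a"
  by (simp add: mdeg_def fun_eq_iff)

lemma expo_mdeg [simp]: "expo (mdeg m) = m"
  by (rule poly_mapping_eqI) (simp add: mdeg_def)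

lemma poly_grading_eq:
  fixes p :: "('n::finite, 'k::comm_ring_1) mpoly"
  assumes "p \<in> poly_grading a"
  shows "p = Poly_Mapping.single (expo a) (eval_one p)"
proof -
  have "m = expo a" if "m \<in> Poly_Mapping.keys p" for m
    using assms that expo_mdeg[of m] by (simp add: poly_grading_def)
  then have keys: "Poly_Mapping.keys p \<subseteq> {expo a}" by blast
  then have "eval_one p = Poly_Mapping.lookup p (expo a)"
    by (subst eval_one_superset[of "{expo a}"]) auto
  then show ?thesis
    using keys by (intro poly_mapping_eqI) (auto simp: lookup_single when_def in_keys_iff)
qed

lemma poly_grading_nonneg:
  fixes p :: "('n::finite, 'k::comm_ring_1) mpoly"
  assumes "p \<in> poly_grading a" "p \<noteq> 0"
  shows "0 \<le> a u"
proof -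
  obtain m where "m \<in> Poly_Mapping.keys p" using assms(2) by fastforce
  then have "mdeg m = a" using assms(1) by (simp add: poly_grading_def)
  then show ?thesis by (auto simp: mdeg_def)
qed

lemma poly_grading_0_if_eval_one_0:
  fixes p :: "('n::finite, 'k::comm_ring_1) mpoly"
  shows "p \<in> poly_grading a \<Longrightarrow> eval_one p = 0 \<Longrightarrow> p = 0"
  by (metis poly_grading_eq single_zero)

lemma single_in_poly_grading:
  "(c \<noteq> 0 \<Longrightarrow> (\<And>u. 0 \<le> a u)) \<Longrightarrow> Poly_Mapping.single (expo a) c \<in> poly_grading a"
  by (cases "c = 0") (auto simp: poly_grading_def mdeg_expo)

definition component :: "('n \<Rightarrow> int) \<Rightarrow> ('n, 'k::comm_ring_1) mpoly \<Rightarrow> ('n, 'k) mpoly" where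
  "component a p = Abs_poly_mapping (\<lambda>m. if mdeg m = a then Poly_Mapping.lookup p m else 0)"

lemma lookup_component:
  "Poly_Mapping.lookup (component a p) m = (if mdeg m = a then Poly_Mapping.lookup p m else 0)"
proof -
  have "finite {m. (if mdeg m = a then Poly_Mapping.lookup p m else 0) \<noteq> 0}"
    by (rule finite_subset[of _ "Poly_Mapping.keys p"]) (auto simp: in_keys_iff split: if_splits)
  then show ?thesis unfolding component_def by simp
qed

lemma component_in_poly_grading: "component a p \<in> poly_grading a"
  unfolding poly_grading_def by (auto simp: in_keys_iff lookup_component split: if_splits)

lemma component_eq_0: "a \<notin> mdeg ` Poly_Mapping.keys p \<Longrightarrow> component a p = 0"
  by (rule poly_mapping_eqI) (auto simp: lookup_component in_keys_iff)

lemma sum_component: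
  fixes p :: "('n, 'k::comm_ring_1) mpoly"
  assumes "finite A" "inj_on f A" "mdeg ` Poly_Mapping.keys p \<subseteq> f ` A"
  shows "(\<Sum>b\<in>A. component (f b) p) = p"
proof (rule poly_mapping_eqI)
  fix m
  show "Poly_Mapping.lookup (\<Sum>b\<in>A. component (f b) p) m = Poly_Mapping.lookup p m"
  proof (cases "m \<in> Poly_Mapping.keys p")
    case True
    then obtain b where b: "b \<in> A" "mdeg m = f b" using assms(3) by blast
    have "(\<Sum>b'\<in>A. Poly_Mapping.lookup (component (f b') p) m) =
        (\<Sum>b'\<in>A. if b' = b then Poly_Mapping.lookup p m else 0)"
      using assms(2) b by (intro sum.cong) (auto simp: lookup_component dest: inj_onD)
    then show ?thesis using b assms(1) by (simp add: lookup_sum)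
  next
    case False
    then show ?thesis by (auto simp: lookup_sum lookup_component in_keys_iff intro!: sum.neutral)
  qed
qed

section \<open>Bases and changes of basis over a ring\<close>

context module
begin

lemma representation_lincomb:
  assumes "independent E" "finite E" "e \<in> E"
  shows "representation E (\<Sum>x\<in>E. scale (c x) x) e = c e"
proof -
  have "representation E (\<Sum>x\<in>E. scale (c x) x) = (\<lambda>b. \<Sum>x\<in>E. representation E (scale (c x) x) b)"
    by (intro representation_sum assms) (simp add: span_base span_scale)
  also have "\<dots> = (\<lambda>b. \<Sum>x\<in>E. c x * (if b = x then 1 else 0))"
    using assms by (intro ext sum.cong) (auto simp: representation_scale span_base representation_basis)
  finally have "representation E (\<Sum>x\<in>E. scale (c x) x) e = (\<Sum>x\<in>E. c x * (if e = x then 1 else 0))"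
    by simp
  also have "\<dots> = (\<Sum>x\<in>E. if x = e then c e else 0)"
    by (intro sum.cong) auto
  finally show ?thesis using assms by simp
qed

lemma lincomb_representation:
  "independent E \<Longrightarrow> finite E \<Longrightarrow> x \<in> span E \<Longrightarrow> (\<Sum>e\<in>E. scale (representation E x e) e) = x"
  by (intro sum_representation_eq) auto

text \<open>Both matrix products are assumed: \<open>PQ\<close> gives independence of the new family
  and \<open>QP\<close> gives spanning, without a rank argument over the ring of scalars.\<close>

lemma change_of_basis:
  fixes P :: "'j \<Rightarrow> 'b \<Rightarrow> 'a" and Q :: "'b \<Rightarrow> 'j \<Rightarrow> 'a"
  assumes E: "independent E" "finite E" and J: "finite J"
    and QP: "\<And>e e'. e \<in> E \<Longrightarrow> e' \<in> E \<Longrightarrow> (\<Sum>j\<in>J. Q e j * P j e') = (if e = e' then 1 else 0)"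
    and PQ: "\<And>j j'. j \<in> J \<Longrightarrow> j' \<in> J \<Longrightarrow> (\<Sum>e\<in>E. P j e * Q e j') = (if j = j' then 1 else 0)"
  defines "\<beta> \<equiv> \<lambda>j. \<Sum>e\<in>E. scale (P j e) e"
  shows "independent (\<beta> ` J)" "span (\<beta> ` J) = span E" "inj_on \<beta> J"
    "\<And>x j. x \<in> span E \<Longrightarrow> j \<in> J \<Longrightarrow>
       representation (\<beta> ` J) x (\<beta> j) = (\<Sum>e\<in>E. representation E x e * Q e j)"
proof -
  have zero: "c j = 0" if c: "(\<Sum>j\<in>J. scale (c j) (\<beta> j)) = 0" and j: "j \<in> J" for c j
  proof -
    have "(\<Sum>j\<in>J. scale (c j) (\<beta> j)) = (\<Sum>j\<in>J. \<Sum>e\<in>E. scale (c j * P j e) e)"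
      by (simp add: \<beta>_def scale_sum_right)
    also have "\<dots> = (\<Sum>e\<in>E. scale (\<Sum>j\<in>J. c j * P j e) e)"
      by (subst sum.swap) (simp add: scale_sum_left)
    finally have s: "(\<Sum>e\<in>E. scale (\<Sum>j\<in>J. c j * P j e) e) = 0" using c by simp
    have "(\<Sum>j\<in>J. c j * P j e) = 0" if "e \<in> E" for e
      using independentD[OF E subset_refl s that] .
    then have "0 = (\<Sum>e\<in>E. (\<Sum>j\<in>J. c j * P j e) * Q e j)" by simp
    also have "\<dots> = (\<Sum>j'\<in>J. c j' * (\<Sum>e\<in>E. P j' e * Q e j))"
      unfolding sum_distrib_right sum_distrib_left by (subst sum.swap) (simp add: mult.assoc)
    also have "\<dots> = (\<Sum>j'\<in>J. if j' = j then c j' else 0)"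
      using PQ j by (intro sum.cong) auto
    finally show "c j = 0" using J j by simp
  qed
  show inj: "inj_on \<beta> J"
  proof (rule inj_onI, rule ccontr)
    fix j j' assume j: "j \<in> J" "j' \<in> J" "\<beta> j = \<beta> j'" "j \<noteq> j'"
    let ?c = "\<lambda>x. (if x = j then 1 else 0) - (if x = j' then 1 else 0) :: 'a"
    have "(\<Sum>x\<in>J. scale (?c x) (\<beta> x)) =
        (\<Sum>x\<in>J. if x = j then \<beta> j else 0) - (\<Sum>x\<in>J. if x = j' then \<beta> j' else 0)"
      unfolding sum_subtractf[symmetric] by (intro sum.cong) (auto simp: scale_left_diff_distrib)
    also have "\<dots> = 0" using j J by simp
    finally have "?c j = 0" using zero[of ?c j] j by blast
    then show False using j by simp
  qed
  show ind: "independent (\<beta> ` J)"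
  proof
    assume "dependent (\<beta> ` J)"
    then obtain u j where u: "j \<in> J" "u (\<beta> j) \<noteq> 0" "(\<Sum>v\<in>\<beta> ` J. scale (u v) v) = 0"
      using J by (auto simp: dependent_finite)
    have "(\<Sum>j\<in>J. scale (u (\<beta> j)) (\<beta> j)) = 0"
      using u(3) by (simp add: sum.reindex[OF inj])
    then show False using zero[of "\<lambda>j. u (\<beta> j)"] u by blast
  qed
  have \<beta>_span: "\<beta> j \<in> span E" for j
    unfolding \<beta>_def by (intro span_sum span_scale span_base)
  have expand: "x = (\<Sum>j\<in>J. scale (\<Sum>e\<in>E. representation E x e * Q e j) (\<beta> j))" if x: "x \<in> span E" for x
  proof -
    have "(\<Sum>j\<in>J. scale (\<Sum>e\<in>E. representation E x e * Q e j) (\<beta> j)) =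
        (\<Sum>j\<in>J. \<Sum>e\<in>E. \<Sum>e'\<in>E. scale (representation E x e * (Q e j * P j e')) e')"
      by (simp only: \<beta>_def scale_sum_left) (simp only: scale_sum_right scale_scale mult.assoc)
    also have "\<dots> = (\<Sum>e\<in>E. \<Sum>e'\<in>E. \<Sum>j\<in>J. scale (representation E x e * (Q e j * P j e')) e')"
      by (subst sum.swap, intro sum.cong refl, rule sum.swap)
    also have "\<dots> = (\<Sum>e\<in>E. \<Sum>e'\<in>E. scale (representation E x e * (\<Sum>j\<in>J. Q e j * P j e')) e')"
      by (simp add: sum_distrib_left scale_sum_left)
    also have "\<dots> = (\<Sum>e\<in>E. \<Sum>e'\<in>E. if e = e' then scale (representation E x e) e else 0)"
      using QP by (intro sum.cong refl) auto
    also have "\<dots> = x" using E x by (simp add: lincomb_representation)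
    finally show ?thesis by simp
  qed
  show span: "span (\<beta> ` J) = span E"
  proof
    show "span (\<beta> ` J) \<subseteq> span E"
      using \<beta>_span by (intro span_minimal) auto
    show "span E \<subseteq> span (\<beta> ` J)"
    proof
      fix x assume "x \<in> span E"
      then have "x = (\<Sum>j\<in>J. scale (\<Sum>e\<in>E. representation E x e * Q e j) (\<beta> j))" by (rule expand)
      moreover have "\<dots> \<in> span (\<beta> ` J)" by (intro span_sum span_scale span_base) auto
      ultimately show "x \<in> span (\<beta> ` J)" by simp
    qed
  qed
  show "representation (\<beta> ` J) x (\<beta> j) = (\<Sum>e\<in>E. representation E x e * Q e j)"
    if x: "x \<in> span E" and j: "j \<in> J" for x j
  proof -
    let ?c = "\<lambda>j. \<Sum>e\<in>E. representation E x e * Q e j"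
    have "x = (\<Sum>j\<in>J. scale (?c j) (\<beta> j))" using x by (rule expand)
    also have "\<dots> = (\<Sum>v\<in>\<beta> ` J. scale (?c (the_inv_into J \<beta> v)) v)"
      by (subst sum.reindex[OF inj]) (simp add: the_inv_into_f_f[OF inj])
    finally have "representation (\<beta> ` J) x (\<beta> j) =
        representation (\<beta> ` J) (\<Sum>v\<in>\<beta> ` J. scale (?c (the_inv_into J \<beta> v)) v) (\<beta> j)" by simp
    also have "\<dots> = ?c (the_inv_into J \<beta> (\<beta> j))"
      using ind J j by (intro representation_lincomb) auto
    finally show ?thesis using inj j by (simp add: the_inv_into_f_f)
  qed
qed

end

section \<open>The monomial matrices of a resolution\<close>

text \<open>Both \<open>f\<close> on \<open>A\<close> and \<open>x\<close> placed in degree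
  \<open>a\<close> decompose \<open>x\<close> into homogeneous parts, and such a decomposition is
  unique.\<close>

lemma graded_component_eq:
  fixes s :: "('n, 'k::field) mpoly \<Rightarrow> 'm::ab_group_add \<Rightarrow> 'm"
  assumes M: "graded_module s M G" and A: "finite A" "\<And>b. b \<in> A \<Longrightarrow> f b \<in> G b"
    and x: "x \<in> G a" "x = (\<Sum>b\<in>A. f b)"
  shows "x = (if a \<in> A then f a else 0)"
proof -
  let ?P = "\<lambda>g. (\<forall>a. g a \<in> G a) \<and> finite {a. g a \<noteq> 0} \<and> x = (\<Sum>a | g a \<noteq> 0. g a)"
  let ?g = "\<lambda>b. if b \<in> A then f b else 0" and ?h = "\<lambda>b. if b = a then x else 0"
  have G0: "0 \<in> G b" for b using M by (simp add: graded_module_def)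
  have "x \<in> M" using M x(1) by (auto simp: graded_module_def)
  then have ex1: "\<exists>!g. ?P g" using M by (simp add: graded_module_def)
  have sub: "{b. ?g b \<noteq> 0} \<subseteq> A" by auto
  have P_g: "?P ?g"
  proof (intro conjI allI)
    show "finite {b. ?g b \<noteq> 0}" using finite_subset[OF sub A(1)] .
    show "x = (\<Sum>b | ?g b \<noteq> 0. ?g b)"
      unfolding x(2) using A(1) by (intro sum.mono_neutral_cong_right) auto
  qed (use A G0 in auto)
  have P_h: "?P ?h"
  proof (intro conjI allI)
    have sub: "{b. ?h b \<noteq> 0} \<subseteq> {a}" by auto
    then show "finite {b. ?h b \<noteq> 0}" by (rule finite_subset) simp
    have "(\<Sum>b | ?h b \<noteq> 0. ?h b) = (\<Sum>b\<in>{a}. ?h b)" using sub by (intro sum.mono_neutral_left) auto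
    then show "x = (\<Sum>b | ?h b \<noteq> 0. ?h b)" by simp
  qed (use x(1) G0 in auto)
  obtain g0 where g0: "\<And>g. ?P g \<Longrightarrow> g = g0" using ex1 by (elim ex1E) blast
  have "?g = ?h" by (rule trans[OF g0[OF P_g] sym[OF g0[OF P_h]]])
  then have "?h a = ?g a" by (rule fun_cong[OF sym])
  then show ?thesis by simp
qed

lemma graded_module_sum:
  assumes "graded_module s M G" "\<And>b. b \<in> A \<Longrightarrow> f b \<in> G a"
  shows "(\<Sum>b\<in>A. f b) \<in> G a"
  using assms(2)
proof (induction A rule: infinite_finite_induct)
  case (insert x A)
  then show ?case using assms(1) by (simp add: graded_module_def)
qed (use assms(1) in \<open>auto simp: graded_module_def\<close>)

lemma graded_hom_lincomb:
  fixes s :: "('n, 'k::field) mpoly \<Rightarrow> 'm::ab_group_add \<Rightarrow> 'm"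
    and t :: "('n, 'k) mpoly \<Rightarrow> 'l::ab_group_add \<Rightarrow> 'l"
  assumes "module s" "module.subspace s M" and hom: "graded_hom s M G t N H f"
    and x: "\<And>e. e \<in> A \<Longrightarrow> x e \<in> M"
  shows "f (\<Sum>e\<in>A. s (c e) (x e)) = (\<Sum>e\<in>A. t (c e) (f (x e)))"
proof -
  interpret module s by fact
  have zero: "0 \<in> M" using assms(2) by (rule subspace_0)
  have add: "f (y + z) = f y + f z" if "y \<in> M" "z \<in> M" for y z
    using hom that by (simp add: graded_hom_def)
  have f0: "f 0 = 0" using add[OF zero zero] by simp
  show ?thesis using x
  proof (induction A rule: infinite_finite_induct)
    case (insert e A)
    have "s (c e) (x e) \<in> M" using insert assms(2) by (intro subspace_scale) auto
    moreover have "(\<Sum>e\<in>A. s (c e) (x e)) \<in> M"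
      using insert assms(2) by (intro subspace_sum subspace_scale) auto
    moreover have "f (s (c e) (x e)) = t (c e) (f (x e))"
      using hom insert by (simp add: graded_hom_def)
    ultimately show ?case using insert by (simp add: add)
  qed (simp_all add: f0)
qed

section \<open>From a resolution with chosen bases to scalar matrices\<close>

locale based_resolution = minimal_free_resolution s F G d \<epsilon> I
  for s :: "('n::finite, 'k::field) mpoly \<Rightarrow> 'm::ab_group_add \<Rightarrow> 'm" and F G d \<epsilon> I +
  fixes E :: "nat \<Rightarrow> 'm set" and deg :: "nat \<Rightarrow> 'm \<Rightarrow> 'n \<Rightarrow> int"
  assumes finite_E: "finite (E i)"
    and basis_E: "homogeneous_basis s (F i) (G i) (E i)"
    and deg: "e \<in> E i \<Longrightarrow> e \<in> G i (deg i e)"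
begin

lemma independent_E: "independent (E i)"
  using basis_E by (simp add: homogeneous_basis_def)

lemma span_E: "span (E i) = F i"
  using basis_E by (simp add: homogeneous_basis_def)

lemma subspace_F: "subspace (F i)"
  using graded[of i] by (simp add: graded_module_def)

lemma E_subset: "e \<in> E i \<Longrightarrow> e \<in> F i"
  using span_base span_E by blast

lemma G_subset: "x \<in> G i a \<Longrightarrow> x \<in> F i"
  using graded[of i] by (auto simp: graded_module_def)

lemma G_scale: "p \<in> poly_grading a \<Longrightarrow> x \<in> G i b \<Longrightarrow> s p x \<in> G i (\<lambda>u. a u + b u)"
  using graded[of i] by (simp add: graded_module_def)

lemma G_scale_diff: "p \<in> poly_grading (\<lambda>u. a u - b u) \<Longrightarrow> x \<in> G i b \<Longrightarrow> s p x \<in> G i a"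
  using G_scale[of p "\<lambda>u. a u - b u" x i b] by simp

abbreviation rep :: "nat \<Rightarrow> 'm \<Rightarrow> 'm \<Rightarrow> ('n, 'k) mpoly" where
  "rep i \<equiv> representation (E i)"

lemma sum_rep: "x \<in> F i \<Longrightarrow> (\<Sum>e\<in>E i. s (rep i x e) e) = x"
  using lincomb_representation[OF independent_E finite_E] span_E by simp

lemma rep_sum: "e \<in> E i \<Longrightarrow> rep i (\<Sum>x\<in>E i. s (c x) x) e = c e"
  by (rule representation_lincomb[OF independent_E finite_E])

lemma rep_lincomb:
  assumes "\<And>x. x \<in> A \<Longrightarrow> f x \<in> F i"
  shows "rep i (\<Sum>x\<in>A. s (c x) (f x)) e = (\<Sum>x\<in>A. c x * rep i (f x) e)"
  using assms unfolding span_E[symmetric] by (simp add: representation_sum representation_scale independent_E span_scale)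

text \<open>Splitting every coefficient into graded pieces and regrouping by degree writes
  \<open>x\<close> as a sum of homogeneous parts. Only the part of degree \<open>a\<close> survives,
  and uniqueness of coefficients transfers this to the representation.\<close>

lemma rep_homogeneous:
  assumes x: "x \<in> G i a" and e: "e \<in> E i"
  shows "rep i x e \<in> poly_grading (\<lambda>u. a u - deg i e u)"
proof -
  let ?sh = "\<lambda>e b u. b u - deg i e u"
  define A where "A = (\<Union>e\<in>E i. (\<lambda>c u. c u + deg i e u) ` mdeg ` Poly_Mapping.keys (rep i x e))"
  have finA: "finite A" unfolding A_def using finite_E by auto
  have inj: "inj_on (?sh e) A" for e by (auto simp: inj_on_def fun_eq_iff)
  have sub: "mdeg ` Poly_Mapping.keys (rep i x e) \<subseteq> ?sh e ` A" if e: "e \<in> E i" for e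
  proof
    fix c assume "c \<in> mdeg ` Poly_Mapping.keys (rep i x e)"
    then have "(\<lambda>u. c u + deg i e u) \<in> A" using e by (auto simp: A_def)
    then show "c \<in> ?sh e ` A" by (rule rev_image_eqI) simp
  qed
  define f where "f b = (\<Sum>e\<in>E i. s (component (?sh e b) (rep i x e)) e)" for b
  have fG: "f b \<in> G i b" for b
    unfolding f_def
    by (rule graded_module_sum[OF graded], rule G_scale_diff[OF component_in_poly_grading deg])
  have "x = (\<Sum>e\<in>E i. s (rep i x e) e)" using sum_rep[OF G_subset[OF x]] by simp
  also have "\<dots> = (\<Sum>e\<in>E i. s (\<Sum>b\<in>A. component (?sh e b) (rep i x e)) e)"
    using sum_component[OF finA inj sub] by simp
  also have "\<dots> = (\<Sum>b\<in>A. f b)"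
    unfolding f_def scale_sum_left by (rule sum.swap)
  finally have "x = (if a \<in> A then f a else 0)"
    using graded_component_eq[OF graded finA fG x] by blast
  moreover have "f a = 0" if "a \<notin> A"
  proof -
    have "component (?sh e a) (rep i x e) = 0" if "e \<in> E i" for e
    proof (rule component_eq_0)
      show "?sh e a \<notin> mdeg ` Poly_Mapping.keys (rep i x e)"
      proof
        assume "?sh e a \<in> mdeg ` Poly_Mapping.keys (rep i x e)"
        then have "(\<lambda>u. ?sh e a u + deg i e u) \<in> A"
          unfolding A_def by (intro UN_I[OF that] imageI)
        then show False using \<open>a \<notin> A\<close> by simp
      qed
    qed
    then show ?thesis unfolding f_def by (intro sum.neutral) simp
  qed
  ultimately have "x = f a" by (auto split: if_splits)
  then have "rep i x e = component (?sh e a) (rep i x e)"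
    using rep_sum[OF e, of "\<lambda>e. component (?sh e a) (rep i x e)"] by (simp add: f_def)
  then show ?thesis using component_in_poly_grading by metis
qed

lemma d_G: "x \<in> G (Suc i) a \<Longrightarrow> d (Suc i) x \<in> G i a"
  using differential[of i] unfolding graded_hom_def by blast

lemma d_F: "x \<in> F (Suc i) \<Longrightarrow> d (Suc i) x \<in> F i"
  using differential[of i] unfolding graded_hom_def by blast

lemma d_lincomb:
  "(\<And>x. x \<in> A \<Longrightarrow> f x \<in> F (Suc i)) \<Longrightarrow>
    d (Suc i) (\<Sum>x\<in>A. s (c x) (f x)) = (\<Sum>x\<in>A. s (c x) (d (Suc i) (f x)))"
  using graded_hom_lincomb[OF module_axioms subspace_F differential] .

lemma eps_lincomb:
  "(\<And>x. x \<in> A \<Longrightarrow> f x \<in> F 0) \<Longrightarrow> \<epsilon> (\<Sum>x\<in>A. s (c x) (f x)) = (\<Sum>x\<in>A. c x * \<epsilon> (f x))"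
  using graded_hom_lincomb[OF module_axioms subspace_F augmentation] .

lemma eps_grading: "x \<in> G 0 a \<Longrightarrow> \<epsilon> x \<in> poly_grading a"
  using augmentation unfolding graded_hom_def by blast

lemma d_d: "x \<in> F (Suc (Suc i)) \<Longrightarrow> d (Suc i) (d (Suc (Suc i)) x) = 0"
  using exact[of i] by blast

lemma eps_d: "x \<in> F 1 \<Longrightarrow> \<epsilon> (d 1 x) = 0"
  using exact_0 by blast

text \<open>The component of degree \<open>a\<close> of an arbitrary preimage works, since the
  differential respects the decomposition into degrees.\<close>

lemma homogeneous_preimage:
  assumes "x \<in> F (Suc i)" "d (Suc i) x \<in> G i a"
  obtains y where "y \<in> G (Suc i) a" "d (Suc i) y = d (Suc i) x"
proof -
  obtain f where f: "\<And>b. f b \<in> G (Suc i) b" "finite {b. f b \<noteq> 0}" "x = (\<Sum>b | f b \<noteq> 0. f b)"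
    using graded[of "Suc i"] assms(1) unfolding graded_module_def by blast
  have "d (Suc i) x = d (Suc i) (\<Sum>b | f b \<noteq> 0. s 1 (f b))" using f(3) by simp
  also have "\<dots> = (\<Sum>b | f b \<noteq> 0. s 1 (d (Suc i) (f b)))"
    using f(1) G_subset by (intro d_lincomb) blast
  also have "\<dots> = (\<Sum>b | f b \<noteq> 0. d (Suc i) (f b))" by simp
  finally have "d (Suc i) x = (if a \<in> {b. f b \<noteq> 0} then d (Suc i) (f a) else 0)"
    by (intro graded_component_eq[OF graded f(2) _ assms(2)] d_G f(1)) auto
  moreover have "d (Suc i) 0 = 0"
    using d_lincomb[of "{}" _ i] by simp
  ultimately show ?thesis using that[OF f(1)] by (auto split: if_splits)
qed

lemma d_exact:
  assumes "x \<in> G (Suc i) a" "d (Suc i) x = 0"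
  obtains y where "y \<in> G (Suc (Suc i)) a" "d (Suc (Suc i)) y = x"
proof -
  have "x \<in> d (Suc (Suc i)) ` F (Suc (Suc i))" using exact[of i] assms G_subset by blast
  then show ?thesis using homogeneous_preimage[of _ "Suc i" a] assms(1) that by (metis imageE)
qed

lemma eps_exact:
  assumes "x \<in> G 0 a" "\<epsilon> x = 0"
  obtains y where "y \<in> G 1 a" "d 1 y = x"
proof -
  have "x \<in> d 1 ` F 1" using exact_0 assms G_subset by blast
  then show ?thesis using homogeneous_preimage[of _ 0 a] assms(1) that by (metis One_nat_def imageE)
qed

text \<open>The ideal form of minimality is turned into the absence of constant terms in the
  matrices of the differential.\<close>

lemma rep_d_lookup_0:
  assumes "x \<in> F (Suc i)"
  shows "Poly_Mapping.lookup (rep i (d (Suc i) x) e) 0 = 0"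
proof -
  have "d (Suc i) x \<in> span {s p y | p y. p \<in> irrelevant_ideal \<and> y \<in> F i}"
    using minimal[of i] assms by blast
  then have "d (Suc i) x \<in> F i \<and> (\<forall>e. Poly_Mapping.lookup (rep i (d (Suc i) x) e) 0 = 0)"
  proof (induction rule: span_induct_alt)
    case base
    then show ?case using subspace_F by (simp add: subspace_0 representation_zero)
  next
    case (step c x z)
    then obtain p y where x: "x = s p y" "p \<in> irrelevant_ideal" "y \<in> F i" by blast
    have F: "y \<in> span (E i)" "z \<in> span (E i)" using x step span_E by auto
    have "rep i (s c x + z) e = c * (p * rep i y e) + rep i z e" for e
      using F by (simp add: x representation_add representation_scale independent_E span_scale
        del: scale_scale)
    moreover have "Poly_Mapping.lookup (c * (p * rep i y e)) 0 = 0" for e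
      unfolding mult.commute[of p] using x(2) by (intro lookup_0_mult irrelevant_ideal_lookup_0)
    ultimately show ?case
      using step x subspace_F[of i] by (simp add: lookup_add subspace_add subspace_scale)
  qed
  then show ?thesis by blast
qed

text \<open>At index 0 the zero of the ambient module is a mere label for the basis element 1 of the
  polynomial ring, so that all indices share one type.\<close>

definition C :: "nat \<Rightarrow> 'm set" where
  "C i = (case i of 0 \<Rightarrow> {0} | Suc j \<Rightarrow> E j)"

definition dg :: "nat \<Rightarrow> 'm \<Rightarrow> 'n \<Rightarrow> int" where
  "dg i e = (case i of 0 \<Rightarrow> (\<lambda>_. 0) | Suc j \<Rightarrow> deg j e)"

definition D :: "nat \<Rightarrow> 'm \<Rightarrow> 'm \<Rightarrow> 'k" where
  "D i e e' = (case i of 0 \<Rightarrow> eval_one (\<epsilon> e) | Suc j \<Rightarrow> eval_one (rep j (d (Suc j) e) e'))"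

lemma C_simps [simp]: "C 0 = {0}" "C (Suc i) = E i"
  and dg_simps [simp]: "dg 0 e = (\<lambda>_. 0)" "dg (Suc i) e = deg i e"
  and D_simps [simp]: "D 0 e e' = eval_one (\<epsilon> e)" "D (Suc i) e e' = eval_one (rep i (d (Suc i) e) e')"
  by (simp_all add: C_def dg_def D_def)

lemma rep_d_grading:
  "e \<in> E (Suc i) \<Longrightarrow> e' \<in> E i \<Longrightarrow> rep i (d (Suc i) e) e' \<in> poly_grading (\<lambda>u. deg (Suc i) e u - deg i e' u)"
  by (intro rep_homogeneous d_G deg)

lemma lincomb_homogeneous:
  assumes "\<And>e. e \<in> E i \<Longrightarrow> c e \<noteq> 0 \<Longrightarrow> deg i e \<le> a"
  shows "(\<Sum>e\<in>E i. s (Poly_Mapping.single (expo (\<lambda>u. a u - deg i e u)) (c e)) e) \<in> G i a"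
  using assms
  by (intro graded_module_sum[OF graded] G_scale_diff[OF single_in_poly_grading deg]) (auto simp: le_fun_def)

text \<open>Comparing coefficients of \<open>d (Suc i) y\<close> and evaluating at (1, ..., 1) turns
  exactness over the ring into a linear statement over the field. The monomials \<open>m e\<close>
  may be arbitrary because evaluation forgets them.\<close>

lemma exact_coefficients:
  assumes y: "y \<in> G (Suc i) a" "d (Suc i) y = (\<Sum>e\<in>E i. s (Poly_Mapping.single (m e) (c e)) e)"
  shows "\<exists>c'. (\<forall>e\<in>E (Suc i). c' e \<noteq> 0 \<longrightarrow> deg (Suc i) e \<le> a) \<and>
    (\<forall>e\<in>E i. c e = (\<Sum>e''\<in>E (Suc i). c' e'' * D (Suc i) e'' e))"
proof (intro exI[of _ "\<lambda>e. eval_one (rep (Suc i) y e)"] conjI ballI impI)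
  fix e assume e: "e \<in> E (Suc i)" "eval_one (rep (Suc i) y e) \<noteq> 0"
  then have "rep (Suc i) y e \<noteq> 0" by auto
  then show "deg (Suc i) e \<le> a"
    using poly_grading_nonneg[OF rep_homogeneous[OF y(1) e(1)]] by (simp add: le_fun_def)
next
  fix e assume e: "e \<in> E i"
  have "d (Suc i) y = d (Suc i) (\<Sum>e''\<in>E (Suc i). s (rep (Suc i) y e'') e'')"
    using sum_rep[OF G_subset[OF y(1)]] by simp
  also have "\<dots> = (\<Sum>e''\<in>E (Suc i). s (rep (Suc i) y e'') (d (Suc i) e''))"
    by (intro d_lincomb E_subset)
  finally have "rep i (d (Suc i) y) e = (\<Sum>e''\<in>E (Suc i). rep (Suc i) y e'' * rep i (d (Suc i) e'') e)"
    by (simp add: rep_lincomb d_F E_subset)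
  moreover have "rep i (d (Suc i) y) e = Poly_Mapping.single (m e) (c e)"
    unfolding y(2) using e by (rule rep_sum)
  ultimately have "eval_one (Poly_Mapping.single (m e) (c e)) =
      eval_one (\<Sum>e''\<in>E (Suc i). rep (Suc i) y e'' * rep i (d (Suc i) e'') e)" by simp
  then show "c e = (\<Sum>e''\<in>E (Suc i). eval_one (rep (Suc i) y e'') * D (Suc i) e'' e)"
    by (simp add: eval_one_sum eval_one_mult)
qed

sublocale monomial_complex C dg D 0
proof
  show "finite (C i)" for i by (cases i) (simp_all add: finite_E)
  show "dg i e' \<le> dg (Suc i) e" if "e \<in> C (Suc i)" "e' \<in> C i" "D i e e' \<noteq> 0" for e i e'
  proof (cases i)
    case 0
    then have "\<epsilon> e \<noteq> 0" using that by auto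
    then show ?thesis using 0 that poly_grading_nonneg[OF eps_grading[OF deg]] by (simp add: le_fun_def)
  next
    case (Suc j)
    then have "rep j (d (Suc j) e) e' \<noteq> 0" using that by auto
    then show ?thesis using Suc that poly_grading_nonneg[OF rep_d_grading] by (simp add: le_fun_def)
  qed
  show "dg (Suc i) e' \<noteq> dg (Suc (Suc i)) e"
    if "e \<in> C (Suc (Suc i))" "e' \<in> C (Suc i)" "D (Suc i) e e' \<noteq> 0" for e i e'
  proof
    \<comment> \<open>With equal degrees the matrix entry would be a constant, and minimality leaves
      no constant term.\<close>
    assume "dg (Suc i) e' = dg (Suc (Suc i)) e"
    then have "rep i (d (Suc i) e) e' = Poly_Mapping.single (expo (\<lambda>_. 0)) (D (Suc i) e e')"
      using poly_grading_eq[OF rep_d_grading] that by fastforce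
    moreover have "expo (\<lambda>_ :: 'n. 0) = 0" by (rule poly_mapping_eqI) simp
    ultimately have "Poly_Mapping.lookup (rep i (d (Suc i) e) e') 0 = D (Suc i) e e'"
      by (metis lookup_single_eq)
    moreover have "Poly_Mapping.lookup (rep i (d (Suc i) e) e') 0 = 0"
      using that by (intro rep_d_lookup_0 E_subset) simp
    ultimately show False using that by simp
  qed
  show "(\<Sum>e'\<in>C (Suc i). D (Suc i) e e' * D i e' e'') = 0"
    if "e \<in> C (Suc (Suc i))" "e'' \<in> C i" for e i e''
  proof -
    have e: "e \<in> F (Suc i)" using that E_subset by simp
    have de: "d (Suc i) e = (\<Sum>e'\<in>E i. s (rep i (d (Suc i) e) e') e')"
      using sum_rep[OF d_F[OF e]] by simp
    show ?thesis
    proof (cases i)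
      case 0
      have "0 = \<epsilon> (\<Sum>e'\<in>E i. s (rep i (d (Suc i) e) e') e')"
        unfolding de[symmetric] using eps_d e 0 by simp
      also have "\<dots> = (\<Sum>e'\<in>E i. rep i (d (Suc i) e) e' * \<epsilon> e')"
        using 0 E_subset by (intro eps_lincomb) auto
      finally have "eval_one (\<Sum>e'\<in>E i. rep i (d (Suc i) e) e' * \<epsilon> e') = 0" by simp
      then show ?thesis using 0 by (simp add: eval_one_sum eval_one_mult)
    next
      case (Suc j)
      have "0 = d (Suc j) (\<Sum>e'\<in>E i. s (rep i (d (Suc i) e) e') e')"
        unfolding de[symmetric] using d_d e Suc by simp
      also have "\<dots> = (\<Sum>e'\<in>E i. s (rep i (d (Suc i) e) e') (d (Suc j) e'))"
        using Suc E_subset by (intro d_lincomb) auto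
      finally have "rep j (\<Sum>e'\<in>E i. s (rep i (d (Suc i) e) e') (d (Suc j) e')) e'' = 0"
        by (simp add: representation_zero)
      then have "eval_one (\<Sum>e'\<in>E i. rep i (d (Suc i) e) e' * rep j (d (Suc j) e') e'') = 0"
        using Suc by (simp add: rep_lincomb d_F E_subset)
      then show ?thesis using Suc by (simp add: eval_one_sum eval_one_mult)
    qed
  qed
  show "\<exists>c'. (\<forall>e\<in>C (Suc (Suc i)). c' e \<noteq> 0 \<longrightarrow> dg (Suc (Suc i)) e \<le> a) \<and>
      (\<forall>e\<in>C (Suc i). c e = (\<Sum>e''\<in>C (Suc (Suc i)). c' e'' * D (Suc i) e'' e))"
    if c: "\<And>e. e \<in> C (Suc i) \<Longrightarrow> c e \<noteq> 0 \<Longrightarrow> dg (Suc i) e \<le> a"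
      and z: "\<And>e'. e' \<in> C i \<Longrightarrow> (\<Sum>e\<in>C (Suc i). c e * D i e e') = 0" for i c a
  proof -
    \<comment> \<open>Each basis element is multiplied up to degree \<open>a\<close>. A nonzero
      coefficient occurs only where \<open>deg i e\<close> is at most \<open>a\<close>, so
      truncation in \<open>expo\<close> does no harm.\<close>
    let ?m = "\<lambda>e. expo (\<lambda>u. a u - deg i e u)"
    define x where "x = (\<Sum>e\<in>E i. s (Poly_Mapping.single (?m e) (c e)) e)"
    have x: "x \<in> G i a" unfolding x_def using c by (intro lincomb_homogeneous) simp
    have "\<exists>y\<in>G (Suc i) a. d (Suc i) y = x"
    proof (cases i)
      case 0
      have "\<epsilon> x = (\<Sum>e\<in>E i. Poly_Mapping.single (?m e) (c e) * \<epsilon> e)"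
        unfolding x_def using 0 E_subset by (intro eps_lincomb) auto
      then have "eval_one (\<epsilon> x) = 0" using z[of 0] 0 by (simp add: eval_one_sum eval_one_mult)
      then have "\<epsilon> x = 0" using poly_grading_0_if_eval_one_0[OF eps_grading] x 0 by blast
      then show ?thesis using eps_exact[of x a] x 0 by auto
    next
      case (Suc j)
      have "d i x = (\<Sum>e\<in>E i. s (Poly_Mapping.single (?m e) (c e)) (d i e))"
        unfolding x_def Suc by (intro d_lincomb E_subset)
      then have "rep j (d i x) e' = (\<Sum>e\<in>E i. Poly_Mapping.single (?m e) (c e) * rep j (d i e) e')" for e'
        unfolding Suc by (simp add: rep_lincomb d_F E_subset)
      then have ev: "eval_one (rep j (d i x) e') = 0" if "e' \<in> E j" for e'
        using z[of e'] that Suc by (simp add: eval_one_sum eval_one_mult)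
      have dx: "d i x \<in> G j a" using x d_G Suc by simp
      have "rep j (d i x) e' = 0" if "e' \<in> E j" for e'
        using poly_grading_0_if_eval_one_0[OF rep_homogeneous[OF dx that] ev[OF that]] .
      then have "d i x = 0" using sum_rep[OF G_subset[OF dx]] by simp
      then show ?thesis using d_exact[of x j a] x Suc by auto
    qed
    then show ?thesis using exact_coefficients[of _ i a ?m c] by (auto simp: x_def simp del: D_simps)
  qed
qed simp_all

end

section \<open>Entries of the strand as scalar multiples of variables\<close>

lemma const_0 [simp]: "const 0 = 0"
  and const_1 [simp]: "const 1 = 1"
  and const_mult: "const (c * c') = const c * const c'"
  by (simp_all add: const_def mult_single)

lemma const_sum: "const (\<Sum>x\<in>A. f x) = (\<Sum>x\<in>A. const (f x))"
  by (induction A rule: infinite_finite_induct) (simp_all add: const_def single_add)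

lemma single_mult_const:
  "const c * Poly_Mapping.single m c' = Poly_Mapping.single m (c * c')"
  "Poly_Mapping.single m c' * const c = Poly_Mapping.single m (c' * c)"
  by (simp_all add: const_def mult_single)

lemma single_variable: "Poly_Mapping.single (Poly_Mapping.single u 1) c = const c * var u"
  by (simp add: var_def single_mult_const)

lemma single_sum: "Poly_Mapping.single m (\<Sum>x\<in>A. f x) = (\<Sum>x\<in>A. Poly_Mapping.single m (f x))"
  by (induction A rule: infinite_finite_induct) (simp_all add: single_add)

lemma expo_dec: "expo (\<lambda>w. a w - dec u a w) = Poly_Mapping.single u 1"
  by (rule poly_mapping_eqI) (simp add: dec_apply lookup_single when_def)

context based_resolution
begin

lemma degree_unique:
  assumes "x \<in> G i a" "x \<in> G i b" "x \<noteq> 0"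
  shows "a = b"
  using graded_component_eq[OF graded, of "{b}" "\<lambda>_. x" i x a] assms by (auto split: if_splits)

lemma exists_signed_linear_strand:
  "\<exists>B. (\<forall>i. homogeneous_basis s (F i) (G i) (B i)) \<and>
       (\<forall>i\<ge>1. \<forall>b \<in> linear_strand_basis G B i. \<forall>b' \<in> linear_strand_basis G B (i - 1).
          \<exists>c \<in> {-1, 0, 1}. \<exists>u. differential_entry s d B i b' b = const c * var u)"
proof -
  obtain J :: "nat \<Rightarrow> ('m + ('n \<Rightarrow> int) \<times> 'n list) set" and \<delta> P Q where
    J: "\<And>i. finite (J i)"
    and QP: "\<And>i e e'. e \<in> E i \<Longrightarrow> e' \<in> E i \<Longrightarrow> (\<Sum>j\<in>J i. Q i e j * P i j e') = (if e = e' then 1 else 0)"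
    and PQ: "\<And>i j j'. j \<in> J i \<Longrightarrow> j' \<in> J i \<Longrightarrow> (\<Sum>e\<in>E i. P i j e * Q i e j') = (if j = j' then 1 else 0)"
    and P_deg: "\<And>i j e. j \<in> J i \<Longrightarrow> e \<in> E i \<Longrightarrow> P i j e \<noteq> 0 \<Longrightarrow> deg i e = \<delta> i j"
    and Q_deg: "\<And>i j e. j \<in> J i \<Longrightarrow> e \<in> E i \<Longrightarrow> Q i e j \<noteq> 0 \<Longrightarrow> deg i e = \<delta> i j"
    and entry: "\<And>i j j'. j \<in> J (Suc i) \<Longrightarrow> j' \<in> J i \<Longrightarrow> total_degree (\<delta> (Suc i) j) = int i + 3 \<Longrightarrow>
           total_degree (\<delta> i j') = int i + 2 \<Longrightarrow>
           (\<Sum>e\<in>E (Suc i). \<Sum>e'\<in>E i. P (Suc i) j e * D (Suc i) e e' * Q i e' j') \<in> {-1, 0, 1}"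
    by (rule exists_signed_basis_change[unfolded C_simps dg_simps]) (rule that; assumption)
  define \<beta> where "\<beta> i j = (\<Sum>e\<in>E i. s (const (P i j e)) e)" for i j
  define B where "B i = \<beta> i ` J i" for i
  have QP': "(\<Sum>j\<in>J i. const (Q i e j) * const (P i j e')) = (if e = e' then 1 else 0)"
    if "e \<in> E i" "e' \<in> E i" for i e e'
    using QP[OF that] by (simp flip: const_mult const_sum)
  have PQ': "(\<Sum>e\<in>E i. const (P i j e) * const (Q i e j')) = (if j = j' then 1 else 0)"
    if "j \<in> J i" "j' \<in> J i" for i j j'
    using PQ[OF that] by (simp flip: const_mult const_sum)
  have \<beta>_fun: "\<beta> i = (\<lambda>j. \<Sum>e\<in>E i. s (const (P i j e)) e)" for i
    by (simp add: \<beta>_def fun_eq_iff)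
  note change = change_of_basis[OF independent_E finite_E J QP' PQ']
  have indep_B: "independent (B i)" for i
    unfolding B_def \<beta>_fun by (rule change)
  have span_B: "span (B i) = span (E i)" for i
    unfolding B_def \<beta>_fun by (rule change)
  have rep_B: "representation (B i) x (\<beta> i j) = (\<Sum>e\<in>E i. rep i x e * const (Q i e j))"
    if "x \<in> span (E i)" "j \<in> J i" for i x j
    unfolding B_def \<beta>_fun by (rule change) (use that in auto)
  have \<beta>_G: "\<beta> i j \<in> G i (\<delta> i j)" if j: "j \<in> J i" for i j
    unfolding \<beta>_def
  proof (rule graded_module_sum[OF graded])
    fix e assume e: "e \<in> E i"
    \<comment> \<open>A nonzero \<open>P i j e\<close> requires equal degrees, so the required
      degree of the scalar is 0.\<close>
    have "const (P i j e) \<in> poly_grading (\<lambda>u. \<delta> i j u - deg i e u)"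
      using P_deg[OF j e] by (auto simp: const_def poly_grading_def mdeg_def)
    then show "s (const (P i j e)) e \<in> G i (\<delta> i j)" using deg[OF e] by (rule G_scale_diff)
  qed
  have strand: "\<exists>j\<in>J i. b = \<beta> i j \<and> total_degree (\<delta> i j) = int i + 2"
    if b: "b \<in> linear_strand_basis G B i" for i b
  proof -
    obtain j a where j: "j \<in> J i" "b = \<beta> i j" "b \<in> G i a" "total_degree a = int i + 2"
      using b by (auto simp: linear_strand_basis_def B_def)
    \<comment> \<open>Every homogeneous component contains 0, so the degree of \<open>b\<close> is
      determined only because \<open>b\<close> is nonzero.\<close>
    have "b \<noteq> 0" using indep_B[of i] j dependent_zero unfolding B_def by blast
    then have "a = \<delta> i j" using degree_unique j \<beta>_G by blast
    then show ?thesis using j by blast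
  qed
  have entry_eq: "\<exists>c\<in>{-1, 0, 1}. \<exists>u. representation (B k) (d (Suc k) (\<beta> (Suc k) j)) (\<beta> k j') = const c * var u"
    if j: "j \<in> J (Suc k)" "j' \<in> J k" "total_degree (\<delta> (Suc k) j) = int k + 3"
      "total_degree (\<delta> k j') = int k + 2" for k j j'
  proof -
    let ?m = "expo (\<lambda>u. \<delta> (Suc k) j u - \<delta> k j' u)"
    let ?c = "\<Sum>e\<in>E (Suc k). \<Sum>e'\<in>E k. P (Suc k) j e * D (Suc k) e e' * Q k e' j'"
    have "d (Suc k) (\<beta> (Suc k) j) = (\<Sum>e\<in>E (Suc k). s (const (P (Suc k) j e)) (d (Suc k) e))"
      unfolding \<beta>_def by (intro d_lincomb E_subset)
    then have rep_d: "rep k (d (Suc k) (\<beta> (Suc k) j)) e' =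
        (\<Sum>e\<in>E (Suc k). const (P (Suc k) j e) * rep k (d (Suc k) e) e')" for e'
      by (simp add: rep_lincomb d_F E_subset)
    have "d (Suc k) (\<beta> (Suc k) j) \<in> span (E k)"
      unfolding span_E by (rule d_F[OF G_subset[OF \<beta>_G[OF j(1)]]])
    then have "representation (B k) (d (Suc k) (\<beta> (Suc k) j)) (\<beta> k j') =
        (\<Sum>e'\<in>E k. rep k (d (Suc k) (\<beta> (Suc k) j)) e' * const (Q k e' j'))"
      using j(2) by (rule rep_B)
    also have "\<dots> = (\<Sum>e\<in>E (Suc k). \<Sum>e'\<in>E k.
        const (P (Suc k) j e) * rep k (d (Suc k) e) e' * const (Q k e' j'))"
      unfolding rep_d sum_distrib_right by (rule sum.swap)
    also have "\<dots> = (\<Sum>e\<in>E (Suc k). \<Sum>e'\<in>E k.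
        Poly_Mapping.single ?m (P (Suc k) j e * D (Suc k) e e' * Q k e' j'))"
    proof (intro sum.cong refl)
      fix e e' assume e: "e \<in> E (Suc k)" "e' \<in> E k"
      show "const (P (Suc k) j e) * rep k (d (Suc k) e) e' * const (Q k e' j') =
          Poly_Mapping.single ?m (P (Suc k) j e * D (Suc k) e e' * Q k e' j')"
      proof (cases "P (Suc k) j e = 0 \<or> Q k e' j' = 0")
        case False
        then have "rep k (d (Suc k) e) e' = Poly_Mapping.single ?m (D (Suc k) e e')"
          using poly_grading_eq[OF rep_d_grading[OF e]] P_deg[OF j(1) e(1)] Q_deg[OF j(2) e(2)] by simp
        then show ?thesis by (simp only: single_mult_const)
      qed auto
    qed
    also have "\<dots> = Poly_Mapping.single ?m ?c" by (simp only: single_sum)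
    finally have eq: "representation (B k) (d (Suc k) (\<beta> (Suc k) j)) (\<beta> k j') = Poly_Mapping.single ?m ?c" .
    \<comment> \<open>A zero entry is a multiple of any variable. A nonzero one contains a nonzero
      product of entries of \<open>P\<close>, \<open>D\<close> and \<open>Q\<close>, which makes the
      two degrees comparable; total degrees differing by 1 then leave a single variable as
      quotient.\<close>
    have "\<exists>u. Poly_Mapping.single ?m ?c = const ?c * var u"
    proof (cases "?c = 0")
      case False
      then obtain e where e: "e \<in> E (Suc k)" "(\<Sum>e'\<in>E k. P (Suc k) j e * D (Suc k) e e' * Q k e' j') \<noteq> 0"
        by (rule sum.not_neutral_contains_not_neutral)
      obtain e' where e': "e' \<in> E k" "P (Suc k) j e * D (Suc k) e e' * Q k e' j' \<noteq> 0"
        using e(2) by (rule sum.not_neutral_contains_not_neutral)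
      have "deg k e' \<le> deg (Suc k) e"
        using D_le[of e "Suc k" e'] e e' by simp
      then have "\<delta> k j' \<le> \<delta> (Suc k) j"
        using P_deg[OF j(1) e(1)] Q_deg[OF j(2) e'(1)] e'(2) by simp
      then obtain u where "\<delta> k j' = dec u (\<delta> (Suc k) j)" by (rule eq_dec) (use j in simp)
      then have "?m = Poly_Mapping.single u 1" by (simp only: expo_dec)
      then have "Poly_Mapping.single ?m ?c = const ?c * var u" by (simp only: single_variable)
      then show ?thesis by (rule exI)
    qed (simp only: single_zero const_0 mult_zero_left simp_thms)
    then show ?thesis unfolding eq by (rule bexI) (rule entry[OF j])
  qed
  show ?thesis
  proof (intro exI[of _ B] conjI allI impI ballI)
    fix i
    show "homogeneous_basis s (F i) (G i) (B i)"
      unfolding homogeneous_basis_def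
    proof (intro conjI)
      show "B i \<subseteq> (\<Union>a. G i a)"
        unfolding B_def
      proof (rule image_subsetI)
        fix j assume "j \<in> J i"
        then have "\<beta> i j \<in> G i (\<delta> i j)" by (rule \<beta>_G)
        then show "\<beta> i j \<in> (\<Union>a. G i a)" by blast
      qed
      show "independent (B i)" by (rule indep_B)
      show "span (B i) = F i" by (simp only: span_B span_E)
    qed
  next
    fix i b b' assume i: "1 \<le> i" and b: "b \<in> linear_strand_basis G B i"
      and b': "b' \<in> linear_strand_basis G B (i - 1)"
    then obtain k where k: "i = Suc k" by (cases i) auto
    obtain j where "j \<in> J (Suc k)" "b = \<beta> (Suc k) j" "total_degree (\<delta> (Suc k) j) = int k + 3"
      using strand[OF b] k by auto
    moreover obtain j' where "j' \<in> J k" "b' = \<beta> k j'" "total_degree (\<delta> k j') = int k + 2"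
      using strand[OF b'] k by auto
    ultimately show "\<exists>c\<in>{-1, 0, 1}. \<exists>u. differential_entry s d B i b' b = const c * var u"
      using entry_eq[of j k j'] k by (simp add: differential_entry_def)
  qed
qed

end

theorem corollary3p2:
  fixes s :: "('n::finite, 'k::field) mpoly \<Rightarrow> 'm::ab_group_add \<Rightarrow> 'm"
    and F :: "nat \<Rightarrow> 'm set"
    and G :: "nat \<Rightarrow> ('n \<Rightarrow> int) \<Rightarrow> 'm set"
    and d :: "nat \<Rightarrow> 'm \<Rightarrow> 'm"
    and \<epsilon> :: "'m \<Rightarrow> ('n, 'k) mpoly"
    and I :: "('n, 'k) mpoly set"
  assumes "monomial_ideal I"
    and "minimal_free_resolution s F G d \<epsilon> I"
  shows "\<exists>B. (\<forall>i. homogeneous_basis s (F i) (G i) (B i)) \<and>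
             (\<forall>i\<ge>1. \<forall>b \<in> linear_strand_basis G B i. \<forall>b' \<in> linear_strand_basis G B (i - 1).
                \<exists>c \<in> {-1, 0, 1}. \<exists>u. differential_entry s d B i b' b = const c * var u)"
proof -
  interpret minimal_free_resolution s F G d \<epsilon> I by fact
  obtain E where E: "\<And>i. finite (E i) \<and> homogeneous_basis s (F i) (G i) (E i)"
    using free by metis
  define deg where "deg i e = (SOME a. e \<in> G i a)" for i e
  have "e \<in> G i (deg i e)" if "e \<in> E i" for i e
  proof -
    have "E i \<subseteq> (\<Union>a. G i a)" using E[of i] by (simp add: homogeneous_basis_def)
    then have "\<exists>a. e \<in> G i a" using that by blast
    then show ?thesis unfolding deg_def by (rule someI_ex)
  qed
  then interpret based_resolution s F G d \<epsilon> I E deg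
    using E by unfold_locales auto
  show ?thesis by (rule exists_signed_linear_strand)
qed

end
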